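(* Let $\mathcal G=(\mathcal P_S,\mathcal P_E,\mathcal T,\mathcal F,\mathit{In},\mathcal W)$ be a sliceable Petri game with reachability objective (winning places $\mathcal W$), let $\{\varsigma\}_{\varsigma\in\mathscr S}$ be a distribution of $\mathcal G$ into slices, and let $\mathcal C_{\mathcal G}$ and $\widehat{\mathcal C_{\mathcal G}}$ be the control games constructed from this distribution as described in the context. Then $\mathcal G$ and $\mathcal C_{\mathcal G}$ are strategy-equivalent. Moreover, $\mathcal G$ and $\widehat{\mathcal C_{\mathcal G}}$ are strategy-equivalent if deterministic Petri game strategies are required, i.e., for every winning deterministic strategy for $\mathcal G$ there is a bisimilar winning controller for $\widehat{\mathcal C_{\mathcal G}}$, and for every winning controller for $\widehat{\mathcal C_{\mathcal G}}$ there is a bisimilar winning deterministic strategy for $\mathcal G$.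
   Context: Control games. Let $\mathscr P$ be a finite set of processes, $\Sigma$ a finite set of actions and $\mathit{dom}:\Sigma\to 2^{\mathscr P}\setminus\{\emptyset\}$; $\Sigma_p=\{a\mid p\in\mathit{dom}(a)\}$. An asynchronous automaton $\mathcal A=(\{S_p\}_{p\in\mathscr P},s_{in},\{\delta_a\}_{a\in\Sigma})$ has finite sets of local states $S_p$, an initial global state $s_{in}\in\prod_p S_p$, and partial functions $\delta_a:\prod_{p\in\mathit{dom}(a)}S_p\rightharpoonup\prod_{p\in\mathit{dom}(a)}S_p$. A global step $s\xrightarrow{a}s'$ holds iff $\delta_a(s_{\mathit{dom}(a)})=s'_{\mathit{dom}(a)}$ and $s,s'$ agree outside $\mathit{dom}(a)$. $\mathit{Plays}(\mathcal A)$ is the set of finite and infinite action sequences executable from $s_{in}$, taken up to trace equivalence (commuting adjacent actions with disjoint domains). $\mathit{state}(u)$ is the global state after a finite play $u$. The $p$-view $\mathit{view}_p(u)$ is the shortest trace $v$ with $u\sim vw$ where $w$ contains no action of $\Sigma_p$; $\mathit{Plays}_p$ is the set of $p$-views. A control game $\mathcal C=(\mathcal A,\Sigma^{sys},\Sigma^{env},\{\mathcal S_p\})$ partitions $\Sigma$ into controllable $\Sigma^{sys}$ and uncontrollable $\Sigma^{env}$ actions and fixes special local states (winning states $\mathcal W_p$ for reachability, losing states $\mathcal B_p$ for safety). A controller $\varrho=\{f_p\}_{p}$ has local controllers $f_p:\mathit{Plays}_p\to 2^{\Sigma^{sys}\cap\Sigma_p}$; $\mathit{Plays}(\mathcal C,\varrho)$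 is the smallest set containing the empty play such that if $u$ is in it and $ua\in\mathit{Plays}(\mathcal A)$ with either $a\in\Sigma^{env}$, or $a\in\Sigma^{sys}$ and $a\in f_p(\mathit{view}_p(u))$ for all $p\in\mathit{dom}(a)$, then $ua$ is in it. Final plays are finite plays of $\mathit{Plays}(\mathcal C,\varrho)$ with no extension in it. $\varrho$ is (reachability-)winning if all its plays are finite and in every final play every process ends in a winning state. The number of players of $\mathcal C$ is $|\mathscr P|$. A parallel composition of local deterministic automata $(Q_p,q_{0,p},\vartheta_p\subseteq Q_p\times\Sigma_p\times Q_p)$ is the asynchronous automaton with $S_p=Q_p$, $s_{in}=(q_{0,p})_p$, and $\delta_a((s_p)_{p\in\mathit{dom}(a)})=(s'_p)_{p}$ iff $(s_p,a,s'_p)\in\vartheta_p$ for all $p\in\mathit{dom}(a)$ (undefined otherwise). Petri games. A Petri net $(\mathcal P,\mathcal T,\mathcal F,\mathit{In})$ has a flow multiset $\mathcal F$ over $(\mathcal P\times\mathcal T)\cup(\mathcal T\times\mathcal P)$ and initial marking $\mathit{In}$ (multiset over $\mathcal P$); ${}^\bullet x$, $x^\bullet$ are pre/postsets; $t$ is enabled in $M$ if ${}^\bullet t\subseteq M$ and then fires to $M-{}^\bullet t+t^\bullet$; a marking is final if nothing is enabled. Branching processes $(\mathcal N^\sigma,\lambda)$ (occurrence net with initial homomorphism $\lambda$ into the net, injective on transitions with equal presets) and pairwise concurrent places are as usual. A Petri game $\mathcal G=(\mathcal P_S,\mathcal P_E,\mathcal T,\mathcal F,\mathit{In},\mathcal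 W)$ is a finite Petri net with places partitioned into system places $\mathcal P_S$ and environment places $\mathcal P_E$ and winning places $\mathcal W$. A strategy is a branching process $\sigma=(\mathcal N^\sigma,\lambda)$ with justified refusal: whenever $C$ is a set of pairwise concurrent places of $\mathcal N^\sigma$ and $t\in\mathcal T$ with $\lambda[C]={}^\bullet t$, either some $t'$ with $\lambda(t')=t$ and ${}^\bullet t'=C$ exists, or some $q\in C$ with $\lambda(q)\in\mathcal P_S$ satisfies $t\notin\lambda[q^\bullet]$. $\sigma$ is (reachability-)winning if $\mathcal N^\sigma$ is finite and in every final reachable marking every token is on a place labelled in $\mathcal W$; deterministic if for every reachable marking $M$ and system place $q\in M$ at most one transition of $q^\bullet$ is enabled in $M$. Slices. A slice of a net $\mathcal N$ is a subnet $\varsigma=(\mathcal P^\varsigma,\mathcal T^\varsigma,\mathcal F^\varsigma,\mathit{In}^\varsigma)$ ($\mathcal P^\varsigma\subseteq\mathcal P$, $\mathcal T^\varsigma\subseteq\mathcal T$, $\mathit{In}^\varsigma\subseteq\mathit{In}$, $\mathcal F^\varsigma$ the restriction of $\mathcal F$) with $|\mathit{In}^\varsigma|=1$, $|{}^\bullet t|=|t^\bullet|=1$ in $\varsigma$ for every $t\in\mathcal T^\varsigma$, and $q^\bullet\subseteq\mathcal T^\varsigma$ (postset in $\mathcal N$) for every $q\in\mathcal P^\varsigma$. $\mathcal N$ is sliceable if there is a family of slices whose place sets partition $\mathcal P$ and whose composition (disjoint union of places, flows and initial markings; union of transitions) equals $\mathcal N$. Construction of $\mathcal C_{\mathcal G}$.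 Processes are the slices $\mathscr S$. Actions: $\Sigma=\mathcal T\cup\{\tau_{(q,A)}\mid q\in\mathcal P_S, A\subseteq q^\bullet\}$, with $\mathit{dom}(t)=\{\varsigma\mid t\in\mathcal T^\varsigma\}$ and $\mathit{dom}(\tau_{(q,A)})=\{\varsigma\}$ for the unique slice with $q\in\mathcal P^\varsigma$. The local automaton of $\varsigma$ has states $\mathcal P^\varsigma\cup\{(q,A)\mid q\in\mathcal P^\varsigma\cap\mathcal P_S, A\subseteq q^\bullet\}$, initial state the initial place of $\varsigma$, and transitions: (1) $q\xrightarrow{\tau_{(q,A)}}(q,A)$ for $q\in\mathcal P_S$; (2) $q\xrightarrow{t}q'$ for $q\in\mathcal P_E$, $t\in\mathcal T$ with $q\in{}^\bullet t$, $q'\in t^\bullet$ in $\varsigma$; (3) $(q,A)\xrightarrow{t}q'$ for $q\in\mathcal P_S$, $t\in A$, $q\in{}^\bullet t$, $q'\in t^\bullet$ in $\varsigma$. $\mathcal C_{\mathcal G}$ has the parallel composition as arena, $\Sigma^{sys}=\{\tau_{(q,A)}\}$, $\Sigma^{env}=\mathcal T$, and winning states $\mathcal W_\varsigma=(\mathcal W\cap\mathcal P^\varsigma)\cup\{(q,A)\mid q\in\mathcal W\cap\mathcal P^\varsigma\}$. $\widehat{\mathcal C_{\mathcal G}}$ additionally has a non-winning state $\bot_\varsigma$ in each process and uncontrollable actions $\text{↯}^{(q,A)}_{[t_1,t_2]}$ for $q\in\mathcal P_S$, $A\subseteq q^\bullet$, $t_1\neq t_2\in A$, with domain $\{\varsigma\mid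 t_1\in\mathcal T^\varsigma\vee t_2\in\mathcal T^\varsigma\}$, and local transitions to $\bot_\varsigma$: (4) $(q,A)\xrightarrow{\text{↯}^{(q,A)}_{[t_1,t_2]}}\bot_\varsigma$; (5) $q\xrightarrow{\text{↯}^{(q',A')}_{[t_1,t_2]}}\bot_\varsigma$ if $q'$ is not a state of $\varsigma$, $q\in\mathcal P_E$, and for $i=1,2$: $t_i\in\mathcal T^\varsigma\Rightarrow t_i\in q^\bullet$; (6) $(q,A)\xrightarrow{\text{↯}^{(q',A')}_{[t_1,t_2]}}\bot_\varsigma$ if $q'$ is not a state of $\varsigma$ and for $i=1,2$: $t_i\in\mathcal T^\varsigma\Rightarrow t_i\in A$. Bisimilarity and strategy-equivalence. Transitions of $\mathcal G$ are identified with the equally named actions (observable); all other actions are internal, written $\tau$ (transitions of $\mathcal N^\sigma$ are identified with their $\lambda$-labels). A strategy $\sigma$ and a controller $\varrho$ are bisimilar if there is a relation $\approx$ between reachable markings of $\mathcal N^\sigma$ and finite plays of $\mathit{Plays}(\mathcal C,\varrho)$ with $\mathit{In}^\sigma\approx\epsilon$ such that: if $M\approx u$ and $M\xrightarrow{a}M'$ (observable $a$) then some $u'=u\tau^*a\tau^*\in\mathit{Plays}(\mathcal C,\varrho)$ has $M'\approx u'$; if $M\approx u$ and $M\xrightarrow{\tau}M'$ then some $u'=u\tau^*$ in $\mathit{Plays}(\mathcal C,\varrho)$ has $M'\approx u'$; if $M\approx u$ and $ua\in\mathit{Plays}(\mathcal C,\varrho)$ (observable $a$) then some $M'$ with $M\xrightarrow{\tau^*a\tau^*}M'$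 has $M'\approx ua$; if $M\approx u$ and $u\tau\in\mathit{Plays}(\mathcal C,\varrho)$ then some $M'$ with $M\xrightarrow{\tau^*}M'$ has $M'\approx u\tau$. $\mathcal G$ and $\mathcal C$ are strategy-equivalent if every winning strategy for $\mathcal G$ has a bisimilar winning controller for $\mathcal C$ and every winning controller for $\mathcal C$ has a bisimilar winning strategy for $\mathcal G$.
   Formalization: Equivalence is restricted to winning controllers that never offer one process two different commitments after the same play (a winning controller offering both {a} and {b} can have no bisimilar strategy); it is also proved that every winning controller can be restricted to such a winning one. *)

theory Defs
  imports
    "HOL-Library.Multiset"
    "HOL-Library.FuncSet"
    "HOL-Library.Disjoint_Sets"
    "HOL-Library.Infinite_Typeclass"
begin

section \<open>Petri nets\<close>

text \<open>
  The flow multiset is given by the presets and postsets of the transitions: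
  \<open>count (pre N t) q\<close> is the multiplicity of \<open>(q, t)\<close>, \<open>count (post N t) q\<close> that of \<open>(t, q)\<close>.
  This also covers infinite nets (strategies need not be finite), where the flow as a whole is not
  a finite multiset. The values of \<open>pre\<close> and \<open>post\<close> outside \<open>transitions\<close> are irrelevant.
\<close>

record ('p, 't) net =
  places :: "'p set"
  transitions :: "'t set"
  pre :: "'t \<Rightarrow> 'p multiset"
  post :: "'t \<Rightarrow> 'p multiset"
  initial :: "'p multiset"

definition petri_net :: "('p, 't, 'z) net_scheme \<Rightarrow> bool" where
  "petri_net N \<longleftrightarrow>
     (\<forall>t \<in> transitions N. set_mset (pre N t) \<subseteq> places N \<and> set_mset (post N t) \<subseteq> places N) \<and>
     set_mset (initial N) \<subseteq> places N"

definition finite_net :: "('p, 't, 'z) net_scheme \<Rightarrow> bool" where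
  "finite_net N \<longleftrightarrow> finite (places N) \<and> finite (transitions N)"

definition place_post :: "('p, 't, 'z) net_scheme \<Rightarrow> 'p \<Rightarrow> 't set" where
  "place_post N q = {t \<in> transitions N. q \<in># pre N t}"

definition place_pre :: "('p, 't, 'z) net_scheme \<Rightarrow> 'p \<Rightarrow> 't set" where
  "place_pre N q = {t \<in> transitions N. q \<in># post N t}"

definition enabled :: "('p, 't, 'z) net_scheme \<Rightarrow> 'p multiset \<Rightarrow> 't \<Rightarrow> bool" where
  "enabled N M t \<longleftrightarrow> t \<in> transitions N \<and> pre N t \<subseteq># M"

definition fire :: "('p, 't, 'z) net_scheme \<Rightarrow> 'p multiset \<Rightarrow> 't \<Rightarrow> 'p multiset" where
  "fire N M t = M - pre N t + post N t"

inductive reachable :: "('p, 't, 'z) net_scheme \<Rightarrow> 'p multiset \<Rightarrow> bool" for N where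
  reachable_initial: "reachable N (initial N)"
| reachable_fire: "reachable N M \<Longrightarrow> enabled N M t \<Longrightarrow> reachable N (fire N M t)"

definition final_marking :: "('p, 't, 'z) net_scheme \<Rightarrow> 'p multiset \<Rightarrow> bool" where
  "final_marking N M \<longleftrightarrow> (\<forall>t. \<not> enabled N M t)"


subsection \<open>Occurrence nets and branching processes\<close>

definition flow_rel :: "('p, 't, 'z) net_scheme \<Rightarrow> (('p + 't) \<times> ('p + 't)) set" where
  "flow_rel N =
     {(Inl q, Inr t) | q t. t \<in> transitions N \<and> q \<in># pre N t} \<union>
     {(Inr t, Inl q) | q t. t \<in> transitions N \<and> q \<in># post N t}"

definition conflict :: "('p, 't, 'z) net_scheme \<Rightarrow> 'p + 't \<Rightarrow> 'p + 't \<Rightarrow> bool" where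
  "conflict N x y \<longleftrightarrow>
     (\<exists>q t1 t2. t1 \<in> place_post N q \<and> t2 \<in> place_post N q \<and> t1 \<noteq> t2 \<and>
        (Inr t1, x) \<in> (flow_rel N)\<^sup>* \<and> (Inr t2, y) \<in> (flow_rel N)\<^sup>*)"

definition concurrent :: "('p, 't, 'z) net_scheme \<Rightarrow> 'p + 't \<Rightarrow> 'p + 't \<Rightarrow> bool" where
  "concurrent N x y \<longleftrightarrow>
     (x, y) \<notin> (flow_rel N)\<^sup>* \<and> (y, x) \<notin> (flow_rel N)\<^sup>* \<and> \<not> conflict N x y"

definition pairwise_concurrent :: "('p, 't, 'z) net_scheme \<Rightarrow> 'p set \<Rightarrow> bool" where
  "pairwise_concurrent N C \<longleftrightarrow>
     C \<subseteq> places N \<and> (\<forall>q \<in> C. \<forall>q' \<in> C. q \<noteq> q' \<longrightarrow> concurrent N (Inl q) (Inl q'))"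

text \<open>\<open>wf (flow_rel N)\<close> says that there is no infinite path against the flow.\<close>

definition occurrence_net :: "('p, 't, 'z) net_scheme \<Rightarrow> bool" where
  "occurrence_net N \<longleftrightarrow>
     petri_net N \<and>
     (\<forall>t \<in> transitions N. \<forall>q. count (pre N t) q \<le> 1 \<and> count (post N t) q \<le> 1) \<and>
     initial N = mset_set {q \<in> places N. place_pre N q = {}} \<and>
     finite {q \<in> places N. place_pre N q = {}} \<and>
     (\<forall>q \<in> places N. \<forall>t1 \<in> place_pre N q. \<forall>t2 \<in> place_pre N q. t1 = t2) \<and>
     wf (flow_rel N) \<and>
     (\<forall>t \<in> transitions N. \<not> conflict N (Inr t) (Inr t))"

record ('q, 'u, 'p, 't) labelled_net = "('q, 'u) net" +
  place_label :: "'q \<Rightarrow> 'p"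
  trans_label :: "'u \<Rightarrow> 't"

definition initial_homomorphism ::
    "('q, 'u, 'p, 't) labelled_net \<Rightarrow> ('p, 't, 'z) net_scheme \<Rightarrow> bool" where
  "initial_homomorphism \<sigma> N \<longleftrightarrow>
     place_label \<sigma> ` places \<sigma> \<subseteq> places N \<and>
     trans_label \<sigma> ` transitions \<sigma> \<subseteq> transitions N \<and>
     (\<forall>t \<in> transitions \<sigma>.
        image_mset (place_label \<sigma>) (pre \<sigma> t) = pre N (trans_label \<sigma> t) \<and>
        image_mset (place_label \<sigma>) (post \<sigma> t) = post N (trans_label \<sigma> t)) \<and>
     image_mset (place_label \<sigma>) (initial \<sigma>) = initial N"

definition branching_process ::
    "('p, 't, 'z) net_scheme \<Rightarrow> ('q, 'u, 'p, 't) labelled_net \<Rightarrow> bool" where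
  "branching_process N \<sigma> \<longleftrightarrow>
     occurrence_net \<sigma> \<and> initial_homomorphism \<sigma> N \<and>
     (\<forall>t \<in> transitions \<sigma>. \<forall>t' \<in> transitions \<sigma>.
        pre \<sigma> t = pre \<sigma> t' \<and> trans_label \<sigma> t = trans_label \<sigma> t' \<longrightarrow> t = t')"


section \<open>Petri games\<close>

record ('p, 't) petri_game = "('p, 't) net" +
  sys_places :: "'p set"
  env_places :: "'p set"
  win_places :: "'p set"

definition petri_game :: "('p, 't) petri_game \<Rightarrow> bool" where
  "petri_game G \<longleftrightarrow>
     petri_net G \<and> finite_net G \<and>
     places G = sys_places G \<union> env_places G \<and> sys_places G \<inter> env_places G = {} \<and>
     win_places G \<subseteq> places G"

definition justified_refusal ::
    "('p, 't) petri_game \<Rightarrow> ('q, 'u, 'p, 't) labelled_net \<Rightarrow> bool" where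
  "justified_refusal G \<sigma> \<longleftrightarrow>
     (\<forall>C. \<forall>t \<in> transitions G.
        finite C \<and> pairwise_concurrent \<sigma> C \<and>
        image_mset (place_label \<sigma>) (mset_set C) = pre G t \<longrightarrow>
          (\<exists>t' \<in> transitions \<sigma>. trans_label \<sigma> t' = t \<and> pre \<sigma> t' = mset_set C) \<or>
          (\<exists>q \<in> C. place_label \<sigma> q \<in> sys_places G \<and> t \<notin> trans_label \<sigma> ` place_post \<sigma> q))"

definition strategy :: "('p, 't) petri_game \<Rightarrow> ('q, 'u, 'p, 't) labelled_net \<Rightarrow> bool" where
  "strategy G \<sigma> \<longleftrightarrow> branching_process G \<sigma> \<and> justified_refusal G \<sigma>"

definition winning_strategy ::
    "('p, 't) petri_game \<Rightarrow> ('q, 'u, 'p, 't) labelled_net \<Rightarrow> bool" where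
  "winning_strategy G \<sigma> \<longleftrightarrow>
     strategy G \<sigma> \<and> finite_net \<sigma> \<and>
     (\<forall>M. reachable \<sigma> M \<and> final_marking \<sigma> M \<longrightarrow>
        (\<forall>q \<in># M. place_label \<sigma> q \<in> win_places G))"

definition deterministic_strategy ::
    "('p, 't) petri_game \<Rightarrow> ('q, 'u, 'p, 't) labelled_net \<Rightarrow> bool" where
  "deterministic_strategy G \<sigma> \<longleftrightarrow>
     (\<forall>M q. reachable \<sigma> M \<and> q \<in># M \<and> place_label \<sigma> q \<in> sys_places G \<longrightarrow>
        (\<forall>t1 \<in> place_post \<sigma> q. \<forall>t2 \<in> place_post \<sigma> q.
           enabled \<sigma> M t1 \<and> enabled \<sigma> M t2 \<longrightarrow> t1 = t2))"


subsection \<open>Slices\<close>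

definition slice :: "('p, 't, 'z) net_scheme \<Rightarrow> ('p, 't) net \<Rightarrow> bool" where
  "slice N sl \<longleftrightarrow>
     petri_net sl \<and>
     places sl \<subseteq> places N \<and> transitions sl \<subseteq> transitions N \<and> initial sl \<subseteq># initial N \<and>
     (\<forall>t \<in> transitions sl.
        pre sl t = filter_mset (\<lambda>q. q \<in> places sl) (pre N t) \<and>
        post sl t = filter_mset (\<lambda>q. q \<in> places sl) (post N t)) \<and>
     size (initial sl) = 1 \<and>
     (\<forall>t \<in> transitions sl. size (pre sl t) = 1 \<and> size (post sl t) = 1) \<and>
     (\<forall>q \<in> places sl. place_post N q \<subseteq> transitions sl)"

text \<open>
  A family of slices is given by the set of its members; as slices have nonempty, pairwise disjoint
  place sets, no two members of a family coincide.
\<close>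

definition slice_distribution ::
    "('p, 't, 'z) net_scheme \<Rightarrow> ('p, 't) net set \<Rightarrow> bool" where
  "slice_distribution N S \<longleftrightarrow>
     finite S \<and> (\<forall>sl \<in> S. slice N sl) \<and>
     disjoint_family_on places S \<and>
     places N = (\<Union>sl \<in> S. places sl) \<and>
     transitions N = (\<Union>sl \<in> S. transitions sl) \<and>
     (\<forall>t \<in> transitions N.
        pre N t = (\<Sum>sl \<in> {sl \<in> S. t \<in> transitions sl}. pre sl t) \<and>
        post N t = (\<Sum>sl \<in> {sl \<in> S. t \<in> transitions sl}. post sl t)) \<and>
     initial N = (\<Sum>sl \<in> S. initial sl)"


section \<open>Asynchronous automata\<close>

text \<open>
  Tuples indexed by a set of processes are functions with value \<open>undefined\<close> outside that set.
\<close>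

record ('r, 'a, 's) async_automaton =
  processes :: "'r set"
  actions :: "'a set"
  action_dom :: "'a \<Rightarrow> 'r set"
  local_states :: "'r \<Rightarrow> 's set"
  start :: "'r \<Rightarrow> 's"
  delta :: "'a \<Rightarrow> ('r \<Rightarrow> 's) \<Rightarrow> ('r \<Rightarrow> 's) option"

definition local_actions :: "('r, 'a, 's) async_automaton \<Rightarrow> 'r \<Rightarrow> 'a set" where
  "local_actions A p = {a \<in> actions A. p \<in> action_dom A a}"

definition global_step ::
    "('r, 'a, 's) async_automaton \<Rightarrow> ('r \<Rightarrow> 's) \<Rightarrow> 'a \<Rightarrow> ('r \<Rightarrow> 's) \<Rightarrow> bool" where
  "global_step A s a s' \<longleftrightarrow>
     a \<in> actions A \<and>
     delta A a (restrict s (action_dom A a)) = Some (restrict s' (action_dom A a)) \<and>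
     (\<forall>p. p \<notin> action_dom A a \<longrightarrow> s' p = s p)"

inductive run ::
    "('r, 'a, 's) async_automaton \<Rightarrow> ('r \<Rightarrow> 's) \<Rightarrow> 'a list \<Rightarrow> ('r \<Rightarrow> 's) \<Rightarrow> bool" for A where
  run_Nil: "run A s [] s"
| run_Cons: "global_step A s a s' \<Longrightarrow> run A s' u s'' \<Longrightarrow> run A s (a # u) s''"

definition state :: "('r, 'a, 's) async_automaton \<Rightarrow> 'a list \<Rightarrow> 'r \<Rightarrow> 's" where
  "state A u = (THE s. run A (start A) u s)"

inductive commute1 :: "('a \<Rightarrow> 'r set) \<Rightarrow> 'a list \<Rightarrow> 'a list \<Rightarrow> bool" for d where
  "d a \<inter> d b = {} \<Longrightarrow> commute1 d (u @ [a, b] @ v) (u @ [b, a] @ v)"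

definition trace_equiv :: "('r, 'a, 's) async_automaton \<Rightarrow> 'a list \<Rightarrow> 'a list \<Rightarrow> bool" where
  "trace_equiv A = (commute1 (action_dom A))\<^sup>*\<^sup>*"

text \<open>Finite plays are traces, i.e. equivalence classes of action sequences.\<close>

definition trace :: "('r, 'a, 's) async_automaton \<Rightarrow> 'a list \<Rightarrow> 'a list set" where
  "trace A u = {v. trace_equiv A u v}"

definition finite_plays :: "('r, 'a, 's) async_automaton \<Rightarrow> 'a list set set" where
  "finite_plays A = {trace A u | u. \<exists>s. run A (start A) u s}"

definition view :: "('r, 'a, 's) async_automaton \<Rightarrow> 'r \<Rightarrow> 'a list \<Rightarrow> 'a list set" where
  "view A p u =
     trace A (ARG_MIN length v. \<exists>w. trace_equiv A u (v @ w) \<and> (\<forall>a \<in> set w. p \<notin> action_dom A a))"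

definition view_plays :: "('r, 'a, 's) async_automaton \<Rightarrow> 'r \<Rightarrow> 'a list set set" where
  "view_plays A p = {view A p u | u. trace A u \<in> finite_plays A}"


subsection \<open>Parallel composition\<close>

record ('a, 's) local_automaton =
  states :: "'s set"
  lstart :: "'s"
  ltrans :: "('s \<times> 'a \<times> 's) set"

definition parallel_composition ::
    "'r set \<Rightarrow> 'a set \<Rightarrow> ('a \<Rightarrow> 'r set) \<Rightarrow> ('r \<Rightarrow> ('a, 's) local_automaton) \<Rightarrow>
     ('r, 'a, 's) async_automaton" where
  "parallel_composition R \<Sigma> d L =
     \<lparr> processes = R,
       actions = \<Sigma>,
       action_dom = d,
       local_states = (\<lambda>p. states (L p)),
       start = restrict (\<lambda>p. lstart (L p)) R,
       delta = (\<lambda>a s.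
         let succ = (\<lambda>s'. s' \<in> extensional (d a) \<and> (\<forall>p \<in> d a. (s p, a, s' p) \<in> ltrans (L p)))
         in if \<exists>s'. succ s' then Some (THE s'. succ s') else None) \<rparr>"


section \<open>Control games\<close>

record ('r, 'a, 's) control_game =
  arena :: "('r, 'a, 's) async_automaton"
  sys_actions :: "'a set"
  env_actions :: "'a set"
  win_states :: "'r \<Rightarrow> 's set"

type_synonym ('r, 'a) controller = "'r \<Rightarrow> 'a list set \<Rightarrow> 'a set"

definition controller :: "('r, 'a, 's) control_game \<Rightarrow> ('r, 'a) controller \<Rightarrow> bool" where
  "controller C f \<longleftrightarrow>
     (\<forall>p \<in> processes (arena C). \<forall>V \<in> view_plays (arena C) p.
        f p V \<subseteq> sys_actions C \<inter> local_actions (arena C) p)"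

inductive_set controlled_plays ::
    "('r, 'a, 's) control_game \<Rightarrow> ('r, 'a) controller \<Rightarrow> 'a list set set" for C f where
  empty_play: "trace (arena C) [] \<in> controlled_plays C f"
| extend_play:
    "trace (arena C) u \<in> controlled_plays C f \<Longrightarrow>
     trace (arena C) (u @ [a]) \<in> finite_plays (arena C) \<Longrightarrow>
     a \<in> env_actions C \<or>
       a \<in> sys_actions C \<and> (\<forall>p \<in> action_dom (arena C) a. a \<in> f p (view (arena C) p u)) \<Longrightarrow>
     trace (arena C) (u @ [a]) \<in> controlled_plays C f"

text \<open>
  An infinite play is represented by a linearization; it is consistent with the controller iff all
  its finite prefixes are.
\<close>

definition infinite_controlled_play ::
    "('r, 'a, 's) control_game \<Rightarrow> ('r, 'a) controller \<Rightarrow> (nat \<Rightarrow> 'a) \<Rightarrow> bool" where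
  "infinite_controlled_play C f w \<longleftrightarrow>
     (\<forall>n. trace (arena C) (map w [0..<n]) \<in> controlled_plays C f)"

definition final_play ::
    "('r, 'a, 's) control_game \<Rightarrow> ('r, 'a) controller \<Rightarrow> 'a list \<Rightarrow> bool" where
  "final_play C f u \<longleftrightarrow>
     trace (arena C) u \<in> controlled_plays C f \<and>
     (\<forall>a. trace (arena C) (u @ [a]) \<notin> controlled_plays C f)"

definition winning_controller ::
    "('r, 'a, 's) control_game \<Rightarrow> ('r, 'a) controller \<Rightarrow> bool" where
  "winning_controller C f \<longleftrightarrow>
     controller C f \<and>
     (\<nexists>w. infinite_controlled_play C f w) \<and>
     (\<forall>u. final_play C f u \<longrightarrow>
        (\<forall>p \<in> processes (arena C). state (arena C) u p \<in> win_states C p))"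

text \<open>
  In a game obtained from a Petri game, the controllable actions of a process are its commitments.
  A controller is single-commitment if no play leaves a process the choice between two of them.
  In general a controller may offer several commitments in the same situation, say to \<open>{a}\<close> and to \<open>{b}\<close>
  in a system place \<open>q\<close>. Commitments are internal, whereas a strategy has no internal
  transitions; bisimilarity would hence relate one marking both to the play committed to \<open>{a}\<close>
  and to the play committed to \<open>{b}\<close>, although these enable different transitions. Such a
  controller therefore has no bisimilar strategy, even if it is winning, which is why
  controllers are compared with strategies only if they are single-commitment.
\<close>

definition single_commitment ::
    "('r, 'a, 's) control_game \<Rightarrow> ('r, 'a) controller \<Rightarrow> bool" where
  "single_commitment C f \<longleftrightarrow>
     (\<forall>u p. \<forall>a \<in> sys_actions C. \<forall>b \<in> sys_actions C.
        p \<in> action_dom (arena C) a \<and> p \<in> action_dom (arena C) b \<and>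
        trace (arena C) u \<in> controlled_plays C f \<and>
        trace (arena C) (u @ [a]) \<in> controlled_plays C f \<and>
        trace (arena C) (u @ [b]) \<in> controlled_plays C f \<longrightarrow> a = b)"

definition restricts ::
    "('r, 'a, 's) control_game \<Rightarrow> ('r, 'a) controller \<Rightarrow> ('r, 'a) controller \<Rightarrow> bool" where
  "restricts C f' f \<longleftrightarrow>
     (\<forall>p \<in> processes (arena C). \<forall>V \<in> view_plays (arena C) p. f' p V \<subseteq> f p V)"


section \<open>From Petri games to control games\<close>

text \<open>
  \<open>Tr t\<close> is the transition \<open>t\<close> as an action, \<open>Commit q A\<close> is $\tau_{(q,A)}$, and
  \<open>Clash q A t1 t2\<close> is the uncontrollable action that punishes the nondeterminism between
  \<open>t1\<close> and \<open>t2\<close> in the commitment \<open>(q, A)\<close>.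
\<close>

datatype ('p, 't) action = Tr 't | Commit 'p "'t set" | Clash 'p "'t set" 't 't

datatype ('p, 't) lstate = Place 'p | Committed 'p "'t set" | Bot

fun slice_dom :: "('p, 't) net set \<Rightarrow> ('p, 't) action \<Rightarrow> ('p, 't) net set" where
  "slice_dom S (Tr t) = {sl \<in> S. t \<in> transitions sl}"
| "slice_dom S (Commit q A) = {sl \<in> S. q \<in> places sl}"
| "slice_dom S (Clash q A t1 t2) = {sl \<in> S. t1 \<in> transitions sl \<or> t2 \<in> transitions sl}"

definition commit_actions :: "('p, 't) petri_game \<Rightarrow> ('p, 't) action set" where
  "commit_actions G = {Commit q A | q A. q \<in> sys_places G \<and> A \<subseteq> place_post G q}"

definition clash_actions :: "('p, 't) petri_game \<Rightarrow> ('p, 't) action set" where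
  "clash_actions G =
     {Clash q A t1 t2 | q A t1 t2.
        q \<in> sys_places G \<and> A \<subseteq> place_post G q \<and> t1 \<in> A \<and> t2 \<in> A \<and> t1 \<noteq> t2}"

definition slice_states :: "('p, 't) petri_game \<Rightarrow> ('p, 't) net \<Rightarrow> ('p, 't) lstate set" where
  "slice_states G sl =
     Place ` places sl \<union>
     {Committed q A | q A. q \<in> places sl \<inter> sys_places G \<and> A \<subseteq> place_post G q}"

definition slice_trans ::
    "('p, 't) petri_game \<Rightarrow> ('p, 't) net \<Rightarrow>
     (('p, 't) lstate \<times> ('p, 't) action \<times> ('p, 't) lstate) set" where
  "slice_trans G sl =
     {(Place q, Commit q A, Committed q A) | q A.
        q \<in> places sl \<inter> sys_places G \<and> A \<subseteq> place_post G q} \<union>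
     {(Place q, Tr t, Place q') | q t q'.
        q \<in> places sl \<inter> env_places G \<and>
        t \<in> transitions sl \<and> q \<in># pre sl t \<and> q' \<in># post sl t} \<union>
     {(Committed q A, Tr t, Place q') | q A t q'.
        q \<in> places sl \<inter> sys_places G \<and> A \<subseteq> place_post G q \<and> t \<in> A \<and>
        t \<in> transitions sl \<and> q \<in># pre sl t \<and> q' \<in># post sl t}"

definition clash_trans ::
    "('p, 't) petri_game \<Rightarrow> ('p, 't) net \<Rightarrow>
     (('p, 't) lstate \<times> ('p, 't) action \<times> ('p, 't) lstate) set" where
  "clash_trans G sl =
     {(Committed q A, Clash q A t1 t2, Bot) | q A t1 t2.
        q \<in> places sl \<and> Clash q A t1 t2 \<in> clash_actions G} \<union>
     {(Place q, Clash q' A' t1 t2, Bot) | q q' A' t1 t2.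
        Clash q' A' t1 t2 \<in> clash_actions G \<and> (t1 \<in> transitions sl \<or> t2 \<in> transitions sl) \<and>
        q' \<notin> places sl \<and> q \<in> places sl \<inter> env_places G \<and>
        (\<forall>t \<in> {t1, t2}. t \<in> transitions sl \<longrightarrow> t \<in> place_post G q)} \<union>
     {(Committed q A, Clash q' A' t1 t2, Bot) | q A q' A' t1 t2.
        Clash q' A' t1 t2 \<in> clash_actions G \<and> (t1 \<in> transitions sl \<or> t2 \<in> transitions sl) \<and>
        q' \<notin> places sl \<and> q \<in> places sl \<inter> sys_places G \<and> A \<subseteq> place_post G q \<and>
        (\<forall>t \<in> {t1, t2}. t \<in> transitions sl \<longrightarrow> t \<in> A)}"

definition initial_place :: "('p, 't) net \<Rightarrow> 'p" where
  "initial_place sl = (THE q. initial sl = {#q#})"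

definition slice_automaton ::
    "('p, 't) petri_game \<Rightarrow> ('p, 't) net \<Rightarrow> (('p, 't) action, ('p, 't) lstate) local_automaton" where
  "slice_automaton G sl =
     \<lparr> states = slice_states G sl,
       lstart = Place (initial_place sl),
       ltrans = slice_trans G sl \<rparr>"

definition slice_automaton_det ::
    "('p, 't) petri_game \<Rightarrow> ('p, 't) net \<Rightarrow> (('p, 't) action, ('p, 't) lstate) local_automaton" where
  "slice_automaton_det G sl =
     \<lparr> states = slice_states G sl \<union> {Bot},
       lstart = Place (initial_place sl),
       ltrans = slice_trans G sl \<union> clash_trans G sl \<rparr>"

definition slice_win :: "('p, 't) petri_game \<Rightarrow> ('p, 't) net \<Rightarrow> ('p, 't) lstate set" where
  "slice_win G sl =
     Place ` (win_places G \<inter> places sl) \<union>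
     {Committed q A | q A.
        q \<in> win_places G \<inter> places sl \<and> q \<in> sys_places G \<and> A \<subseteq> place_post G q}"

definition control_game_of ::
    "('p, 't) petri_game \<Rightarrow> ('p, 't) net set \<Rightarrow>
     (('p, 't) net, ('p, 't) action, ('p, 't) lstate) control_game" where
  "control_game_of G S =
     \<lparr> arena = parallel_composition S (Tr ` transitions G \<union> commit_actions G)
                 (slice_dom S) (slice_automaton G),
       sys_actions = commit_actions G,
       env_actions = Tr ` transitions G,
       win_states = slice_win G \<rparr>"

text \<open>The game written with a hat, in which nondeterministic commitments can be punished.\<close>

definition control_game_det_of ::
    "('p, 't) petri_game \<Rightarrow> ('p, 't) net set \<Rightarrow>
     (('p, 't) net, ('p, 't) action, ('p, 't) lstate) control_game" where
  "control_game_det_of G S =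
     \<lparr> arena = parallel_composition S (Tr ` transitions G \<union> commit_actions G \<union> clash_actions G)
                 (slice_dom S) (slice_automaton_det G),
       sys_actions = commit_actions G,
       env_actions = Tr ` transitions G \<union> clash_actions G,
       win_states = slice_win G \<rparr>"


section \<open>Strategy-equivalence\<close>

definition observable :: "('p, 't) petri_game \<Rightarrow> ('p, 't) action set" where
  "observable G = Tr ` transitions G"

definition strategy_step ::
    "('q, 'u, 'p, 't) labelled_net \<Rightarrow> 'q multiset \<Rightarrow> ('p, 't) action \<Rightarrow> 'q multiset \<Rightarrow> bool" where
  "strategy_step \<sigma> M a M' \<longleftrightarrow>
     (\<exists>t. enabled \<sigma> M t \<and> a = Tr (trans_label \<sigma> t) \<and> M' = fire \<sigma> M t)"

definition internal_step ::
    "('p, 't) petri_game \<Rightarrow> ('q, 'u, 'p, 't) labelled_net \<Rightarrow> 'q multiset \<Rightarrow> 'q multiset \<Rightarrow> bool" where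
  "internal_step G \<sigma> M M' \<longleftrightarrow> (\<exists>a. a \<notin> observable G \<and> strategy_step \<sigma> M a M')"

definition bisimulation ::
    "('p, 't) petri_game \<Rightarrow> ('r, ('p, 't) action, 's) control_game \<Rightarrow>
     ('q, 'u, 'p, 't) labelled_net \<Rightarrow> ('r, ('p, 't) action) controller \<Rightarrow>
     ('q multiset \<Rightarrow> ('p, 't) action list set \<Rightarrow> bool) \<Rightarrow> bool" where
  "bisimulation G C \<sigma> f B \<longleftrightarrow>
     (let tr = trace (arena C); Pl = controlled_plays C f; Obs = observable G;
          internal = (\<lambda>x. set x \<inter> Obs = {}); istep = internal_step G \<sigma>
      in
        (\<forall>M U. B M U \<longrightarrow> reachable \<sigma> M \<and> U \<in> Pl) \<and>
        B (initial \<sigma>) (tr []) \<and>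
        (\<forall>M u a M'. B M (tr u) \<and> a \<in> Obs \<and> strategy_step \<sigma> M a M' \<longrightarrow>
           (\<exists>x y. internal x \<and> internal y \<and>
              tr (u @ x @ [a] @ y) \<in> Pl \<and> B M' (tr (u @ x @ [a] @ y)))) \<and>
        (\<forall>M u M'. B M (tr u) \<and> istep M M' \<longrightarrow>
           (\<exists>x. internal x \<and> tr (u @ x) \<in> Pl \<and> B M' (tr (u @ x)))) \<and>
        (\<forall>M u a. B M (tr u) \<and> a \<in> Obs \<and> tr (u @ [a]) \<in> Pl \<longrightarrow>
           (\<exists>M1 M2 M'. istep\<^sup>*\<^sup>* M M1 \<and> strategy_step \<sigma> M1 a M2 \<and> istep\<^sup>*\<^sup>* M2 M' \<and>
              B M' (tr (u @ [a])))) \<and>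
        (\<forall>M u a. B M (tr u) \<and> a \<notin> Obs \<and> tr (u @ [a]) \<in> Pl \<longrightarrow>
           (\<exists>M'. istep\<^sup>*\<^sup>* M M' \<and> B M' (tr (u @ [a])))))"

definition bisimilar ::
    "('p, 't) petri_game \<Rightarrow> ('r, ('p, 't) action, 's) control_game \<Rightarrow>
     ('q, 'u, 'p, 't) labelled_net \<Rightarrow> ('r, ('p, 't) action) controller \<Rightarrow> bool" where
  "bisimilar G C \<sigma> f \<longleftrightarrow> (\<exists>B. bisimulation G C \<sigma> f B)"

text \<open>
  The classes of winning strategies and winning controllers to be compared are parameters. This
  accommodates the variant for deterministic strategies and fixes the types from which the nodes
  of the strategies are drawn.
\<close>

definition strategy_equivalent ::
    "('p, 't) petri_game \<Rightarrow> ('r, ('p, 't) action, 's) control_game \<Rightarrow>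
     ('q, 'u, 'p, 't) labelled_net set \<Rightarrow> ('r, ('p, 't) action) controller set \<Rightarrow> bool" where
  "strategy_equivalent G C Strs Ctrls \<longleftrightarrow>
     (\<forall>\<sigma> \<in> Strs. \<exists>f \<in> Ctrls. bisimilar G C \<sigma> f) \<and>
     (\<forall>f \<in> Ctrls. \<exists>\<sigma> \<in> Strs. bisimilar G C \<sigma> f)"

end

theory Submission
  imports Defs
begin

text \<open>
  Every slice carries exactly one token, so a reachable marking of a strategy assigns a place to every
  slice, and so does a play; a bisimulation relates a play to the marking that it reaches in the
  strategy.

  Given a strategy, a process replays its view in the strategy and commits to exactly those
  transitions that leave its current place there. Justified refusal says that a transition for which
  all participants are ready is present in the strategy, and a clash would be a violation of
  determinism.

  Given a controller, the places of the strategy are the views of the processes right after a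
  transition, and its transitions are the causal pasts of the transitions in plays. As at most one
  commitment is possible in every situation, the view without the last commitment determines the
  commitment; this makes the set of transitions leaving a place well-defined. The causal past of a
  transition is the join of the views of its participants, hence it is determined by the preset.
  Pairwise concurrent places occur together in a reachable marking, hence in a play, which yields
  justified refusal. A clash leads to the losing state for good, so it occurs in no play of a
  winning controller.

  If a controller offers several commitments, then keeping one of those that are executable
  creates no new final play.
\<close>

section \<open>Traces and views\<close>

text \<open>Three obstacles shape the proof. Plays are traces, whereas everything attached to a play
  is defined by recursion on a linearization. Invariance under commutation is therefore proved once,
  for quantities that an action changes only at its participants and only depending on what these
  know. The same argument shows that a process can compute such a quantity from its view, which is
  what locality of a controller demands.

  Commitments are visible in plays but not in a strategy. Hence they must not change the marking of
  a play, and a transition enabled in the strategy may be playable only after its participants have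
  committed. It is matched after extending the play by commitments until none is left, which
  termination permits.

  The types of places and transitions of a strategy are fixed in advance, but the constructed nodes
  are made of traces. A winning controller admits only finitely many plays, so these nodes embed
  into any infinite types.\<close>

abbreviation teq :: "('a \<Rightarrow> 'r set) \<Rightarrow> 'a list \<Rightarrow> 'a list \<Rightarrow> bool" where
  "teq d \<equiv> (commute1 d)\<^sup>*\<^sup>*"

section \<open>Trace equivalence through projections to single processes\<close>

definition proj :: "('a \<Rightarrow> 'r set) \<Rightarrow> 'r \<Rightarrow> 'a list \<Rightarrow> 'a list" where
  "proj d p u = filter (\<lambda>a. p \<in> d a) u"

lemma proj_simps [simp]:
  "proj d p [] = []" "proj d p (u @ v) = proj d p u @ proj d p v"
  "proj d p (a # u) = (if p \<in> d a then a # proj d p u else proj d p u)"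
  by (auto simp: proj_def)

lemma proj_eq_Nil: "(\<And>b. b \<in> set w \<Longrightarrow> p \<notin> d b) \<Longrightarrow> proj d p w = []"
  by (auto simp: proj_def filter_empty_conv)

lemma commute1_sym: "commute1 d u v \<Longrightarrow> commute1 d v u"
proof (induction rule: commute1.induct)
  case (1 a b u v)
  then show ?case using commute1.intros[of d b a u v] by blast
qed

lemma teq_sym: "teq d u v \<Longrightarrow> teq d v u"
  by (metis commute1_sym sympD sympI symp_rtranclp)

lemma commute1_append: "commute1 d u v \<Longrightarrow> commute1 d (x @ u @ y) (x @ v @ y)"
proof (induction rule: commute1.induct)
  case (1 a b u v)
  then show ?case using commute1.intros[of d a b "x @ u" "v @ y"] by simp
qed

lemma teq_append: "teq d u v \<Longrightarrow> teq d (x @ u @ y) (x @ v @ y)"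
  by (induction rule: rtranclp_induct) (auto intro: commute1_append rtranclp.rtrancl_into_rtrancl)

lemma teq_append_right: "teq d u v \<Longrightarrow> teq d (u @ y) (v @ y)"
  using teq_append[of d u v "[]" y] by simp

lemma teq_append_left: "teq d u v \<Longrightarrow> teq d (x @ u) (x @ v)"
  using teq_append[of d u v x "[]"] by simp

lemma commute1_proj: "commute1 d u v \<Longrightarrow> proj d p u = proj d p v"
  by (induction rule: commute1.induct) auto

lemma teq_proj: "teq d u v \<Longrightarrow> proj d p u = proj d p v"
  by (induction rule: rtranclp_induct) (auto simp: commute1_proj)

lemma commute1_mset: "commute1 d u v \<Longrightarrow> mset u = mset v"
  by (induction rule: commute1.induct) auto

lemma teq_mset: "teq d u v \<Longrightarrow> mset u = mset v"
  by (induction rule: rtranclp_induct) (auto simp: commute1_mset)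

lemma teq_length: "teq d u v \<Longrightarrow> length u = length v"
  by (metis teq_mset size_mset)

lemma teq_move:
  "(\<And>b. b \<in> set x \<Longrightarrow> d b \<inter> d a = {}) \<Longrightarrow> teq d (x @ [a]) (a # x)"
proof (induction x)
  case (Cons b x)
  have "teq d (b # x @ [a]) (b # a # x)"
    using teq_append_left[of d "x @ [a]" "a # x" "[b]"] Cons by simp
  moreover have "commute1 d (b # a # x) (a # b # x)"
    using commute1.intros[of d b a "[]" x] Cons.prems by simp
  ultimately show ?case by simp
qed simp

text \<open>The first letter \<open>a\<close> of \<open>v\<close> also occurs in \<open>u\<close>. A
  letter before its first occurrence that shared a process with \<open>a\<close> would put a letter
  other than \<open>a\<close> in front on that process. So \<open>a\<close> commutes to the front
  and cancels. A letter with empty domain would be invisible to all projections.\<close>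

lemma teq_if_proj:
  assumes "\<And>a. a \<in> set u \<union> set v \<Longrightarrow> d a \<noteq> {}" and "\<And>p. proj d p u = proj d p v"
  shows "teq d u v"
  using assms
proof (induction v arbitrary: u)
  case Nil
  have "u = []"
  proof (cases u)
    case (Cons a u')
    then obtain p where "p \<in> d a" using Nil.prems(1) by auto
    then show ?thesis using Nil.prems(2)[of p] Cons by simp
  qed
  then show ?case by simp
next
  case (Cons a v)
  obtain p0 where p0: "p0 \<in> d a" using Cons.prems(1) by auto
  have "a \<in> set (proj d p0 u)" using Cons.prems(2)[of p0] p0 by simp
  then have "a \<in> set u" by (auto simp: proj_def)
  then obtain x y where u: "u = x @ a # y" "a \<notin> set x" by (meson split_list_first)
  have indep: "d b \<inter> d a = {}" if "b \<in> set x" for b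
  proof (rule ccontr)
    assume "d b \<inter> d a \<noteq> {}"
    then obtain p where p: "p \<in> d b" "p \<in> d a" by auto
    have eq: "proj d p x @ a # proj d p y = a # proj d p v"
      using Cons.prems(2)[of p] p u by simp
    have "b \<in> set (proj d p x)" using that p by (auto simp: proj_def)
    then obtain c z where "proj d p x = c # z" by (cases "proj d p x") auto
    then have "a \<in> set (proj d p x)" using eq by simp
    then show False using u(2) by (auto simp: proj_def)
  qed
  then have move: "teq d u (a # x @ y)"
    using teq_append_right[OF teq_move[of x d a], of y] u by simp
  have "teq d (x @ y) v"
  proof (rule Cons.IH)
    fix b assume "b \<in> set (x @ y) \<union> set v"
    then show "d b \<noteq> {}" using Cons.prems(1)[of b] u by auto
  next
    fix p
    have "proj d p (a # x @ y) = proj d p (a # v)"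
      using teq_proj[OF move, of p] Cons.prems(2)[of p] by simp
    then show "proj d p (x @ y) = proj d p v" by (auto split: if_splits)
  qed
  then have "teq d (a # x @ y) (a # v)" using teq_append_left[of d _ _ "[a]"] by fastforce
  with move show ?case by simp
qed

section \<open>Causal pasts of sets of processes\<close>

fun rpast :: "('a \<Rightarrow> 'r set) \<Rightarrow> 'r set \<Rightarrow> 'a list \<Rightarrow> 'a list" where
  "rpast d P [] = []"
| "rpast d P (a # u) = (if d a \<inter> P = {} then rpast d P u else a # rpast d (P \<union> d a) u)"

text \<open>The causal past of the processes \<open>P\<close>: reading backwards, an action is kept iff it shares a
  process with \<open>P\<close> or with an action kept before. For \<open>P = {p}\<close> this is a linearization of the
  \<open>p\<close>-view.\<close>

definition past :: "('a \<Rightarrow> 'r set) \<Rightarrow> 'r set \<Rightarrow> 'a list \<Rightarrow> 'a list" where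
  "past d P u = rev (rpast d P (rev u))"

lemma past_Nil [simp]: "past d P [] = []"
  by (simp add: past_def)

lemma past_snoc:
  "past d P (u @ [a]) = (if d a \<inter> P = {} then past d P u else past d (P \<union> d a) u @ [a])"
  by (simp add: past_def)

lemma past_snoc_in: "p \<in> d a \<Longrightarrow> past d {p} (u @ [a]) = past d (d a) u @ [a]"
  by (auto simp: past_snoc insert_absorb)

lemma past_snoc_notin: "p \<notin> d a \<Longrightarrow> past d {p} (u @ [a]) = past d {p} u"
  by (auto simp: past_snoc)

lemma past_append_indep:
  "(\<And>b. b \<in> set w \<Longrightarrow> d b \<inter> P = {}) \<Longrightarrow> past d P (v @ w) = past d P v"
  by (induction w rule: rev_induct) (auto simp: past_snoc simp flip: append_assoc)

lemma set_past: "set (past d P u) \<subseteq> set u"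
  by (induction u arbitrary: P rule: rev_induct) (auto simp: past_snoc)

lemma length_past_le: "length (past d P u) \<le> length u"
  by (induction u arbitrary: P rule: rev_induct) (auto simp: past_snoc intro: le_SucI)

lemma past_eq_if_length: "length (past d P u) = length u \<Longrightarrow> past d P u = u"
proof (induction u arbitrary: P rule: rev_induct)
  case (snoc a u)
  show ?case
  proof (cases "d a \<inter> P = {}")
    case True
    then show ?thesis using snoc.prems length_past_le[of d P u] by (simp add: past_snoc)
  next
    case False
    then show ?thesis using snoc by (simp add: past_snoc)
  qed
qed simp

text \<open>A discarded action shares no process with any action kept after it, so the discarded
  actions can be pushed behind all kept ones.\<close>

lemma past_rest: "\<exists>w. teq d u (past d P u @ w) \<and> (\<forall>b \<in> set w. d b \<inter> P = {})"
proof (induction u arbitrary: P rule: rev_induct)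
  case (snoc a u)
  show ?case
  proof (cases "d a \<inter> P = {}")
    case True
    obtain w where w: "teq d u (past d P u @ w)" "\<forall>b \<in> set w. d b \<inter> P = {}"
      using snoc.IH by blast
    have "teq d (u @ [a]) (past d P (u @ [a]) @ (w @ [a]))"
      using teq_append_right[OF w(1), of "[a]"] True by (simp add: past_snoc)
    then show ?thesis using w(2) True by fastforce
  next
    case False
    obtain w where w: "teq d u (past d (P \<union> d a) u @ w)" "\<forall>b \<in> set w. d b \<inter> (P \<union> d a) = {}"
      using snoc.IH by blast
    have "teq d (u @ [a]) (past d (P \<union> d a) u @ (w @ [a]))"
      using teq_append_right[OF w(1), of "[a]"] by simp
    also have "teq d (past d (P \<union> d a) u @ (w @ [a])) (past d (P \<union> d a) u @ (a # w))"
      using w(2) by (intro teq_append_left teq_move) auto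
    finally have "teq d (u @ [a]) (past d P (u @ [a]) @ w)"
      using False by (simp add: past_snoc)
    then show ?thesis using w(2) by blast
  qed
qed (auto intro: exI[of _ "[]"])

text \<open>For a pair at the end of the word, enlarging \<open>P\<close> by one action does not
  affect the test of the other, by independence. So both orders keep the same actions and continue
  with the same set.\<close>

lemma commute1_past:
  assumes "d a \<inter> d b = {}"
  shows "teq d (past d P (x @ [a, b] @ y)) (past d P (x @ [b, a] @ y))"
proof (induction y arbitrary: P rule: rev_induct)
  case Nil
  have ba: "d b \<inter> d a = {}" using assms by blast
  have *: "past d P (x @ [a', b']) = (if d b' \<inter> P = {} then past d P (x @ [a'])
      else past d (P \<union> d b') (x @ [a']) @ [b'])" for a' b'
    using past_snoc[of d P "x @ [a']" b'] by simp
  show ?case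
  proof (cases "d a \<inter> P = {} \<or> d b \<inter> P = {}")
    case True
    then show ?thesis using assms ba by (auto simp: * past_snoc Int_Un_distrib)
  next
    case False
    then have "past d P (x @ [a, b]) = past d (P \<union> d b \<union> d a) x @ [a, b]"
      "past d P (x @ [b, a]) = past d (P \<union> d b \<union> d a) x @ [b, a]"
      by (simp_all add: * past_snoc Int_Un_distrib Un_ac)
    then show ?thesis
      using assms commute1.intros[of d a b "past d (P \<union> d b \<union> d a) x" "[]"] by auto
  qed
next
  case (snoc c y)
  have *: "past d P (x @ [a, b] @ y @ [c]) = past d P ((x @ [a, b] @ y) @ [c])"
    "past d P (x @ [b, a] @ y @ [c]) = past d P ((x @ [b, a] @ y) @ [c])" for P by simp_all
  show ?case unfolding * past_snoc by (simp add: snoc[simplified] teq_append_right)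
qed

lemma teq_past: "teq d u v \<Longrightarrow> teq d (past d P u) (past d P v)"
proof (induction rule: rtranclp_induct)
  case (step v w)
  from step.hyps(2) have "teq d (past d P v) (past d P w)"
    by (induction rule: commute1.induct) (rule commute1_past)
  with step.IH show ?case by simp
qed simp

lemma past_past: "Q \<subseteq> P \<Longrightarrow> past d Q (past d P u) = past d Q u"
proof (induction u arbitrary: P Q rule: rev_induct)
  case (snoc a u)
  show ?case
  proof (cases "d a \<inter> Q = {}")
    case True
    have "Q \<subseteq> P \<union> d a" using snoc.prems by blast
    with True snoc.IH[of Q] show ?thesis using snoc.prems by (simp add: past_snoc)
  next
    case False
    then have ne: "d a \<inter> P \<noteq> {}" and "Q \<union> d a \<subseteq> P \<union> d a" using snoc.prems by blast+
    with False snoc.IH show ?thesis by (simp add: past_snoc)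
  qed
qed simp

lemma proj_past_prefix: "\<exists>z. proj d r u = proj d r (past d P u) @ z"
proof -
  obtain w where "teq d u (past d P u @ w)" using past_rest[of d u P] by auto
  from teq_proj[OF this, of r] show ?thesis by auto
qed

lemma proj_past: "p \<in> P \<Longrightarrow> proj d p (past d P u) = proj d p u"
proof -
  assume p: "p \<in> P"
  obtain w where w: "teq d u (past d P u @ w)" "\<forall>b \<in> set w. d b \<inter> P = {}"
    using past_rest[of d u P] by auto
  have "proj d p w = []" using w(2) p by (intro proj_eq_Nil) auto
  then show ?thesis using teq_proj[OF w(1), of p] by simp
qed

lemma length_proj_past_mono:
  "P \<subseteq> Q \<Longrightarrow> length (proj d r (past d P u)) \<le> length (proj d r (past d Q u))"
proof (induction u arbitrary: P Q rule: rev_induct)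
  case (snoc a u)
  have *: "length (proj d r (past d P u)) \<le> length (proj d r (past d Q u))"
    "length (proj d r (past d P u)) \<le> length (proj d r (past d (Q \<union> d a) u))"
    "length (proj d r (past d (P \<union> d a) u)) \<le> length (proj d r (past d (Q \<union> d a) u))"
    using snoc.prems by (intro snoc.IH; blast)+
  have "d a \<inter> P \<noteq> {} \<Longrightarrow> d a \<inter> Q \<noteq> {}" using snoc.prems by blast
  with * show ?case by (auto simp: past_snoc)
qed simp

text \<open>All pasts of one play project to prefixes of the same word, so comparing lengths is
  enough.\<close>

lemma proj_past_eqI:
  assumes "length (proj d r (past d P u)) = length (proj d r (past d Q u))"
  shows "proj d r (past d P u) = proj d r (past d Q u)"
proof -
  obtain y z where "proj d r u = proj d r (past d P u) @ y" "proj d r u = proj d r (past d Q u) @ z"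
    using proj_past_prefix[of d r u P] proj_past_prefix[of d r u Q] by blast
  then have "proj d r (past d P u) @ y = proj d r (past d Q u) @ z" by simp
  then show ?thesis using assms by simp
qed

text \<open>A past is the union of the pasts of its members, and prefixes of one word are ordered by
  length, so on each process some member attains the whole projection.\<close>

lemma proj_past_attained:
  "P \<noteq> {} \<Longrightarrow> \<exists>p \<in> P. proj d r (past d P u) = proj d r (past d {p} u)"
proof (induction u arbitrary: P rule: rev_induct)
  case (snoc a u)
  show ?case
  proof (cases "d a \<inter> P = {}")
    case True
    obtain p where p: "p \<in> P" "proj d r (past d P u) = proj d r (past d {p} u)"
      using snoc.IH[OF snoc.prems] by blast
    have "p \<notin> d a" using p(1) True by blast
    then have "proj d r (past d P (u @ [a])) = proj d r (past d {p} (u @ [a]))"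
      using True p(2) by (simp add: past_snoc)
    with p(1) show ?thesis by blast
  next
    case False
    then obtain p where p: "p \<in> P" "p \<in> d a" by blast
    show ?thesis
    proof (cases "r \<in> d a")
      case True
      then have "proj d r (past d P (u @ [a])) = proj d r (past d {p} (u @ [a]))"
        using False p by (simp add: past_snoc proj_past)
      with p show ?thesis by blast
    next
      case r: False
      obtain p' where p': "p' \<in> P \<union> d a"
          "proj d r (past d (P \<union> d a) u) = proj d r (past d {p'} u)"
        using snoc.IH[of "P \<union> d a"] p by blast
      show ?thesis
      proof (cases "p' \<in> d a")
        case True
        \<comment> \<open>The past of \<open>d a\<close> lies between those of its member
          \<open>p'\<close> and of \<open>P \<union> d a\<close>, so it attains the maximum too; and
          it is what \<open>p\<close> knows of \<open>u\<close> once it has taken part in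
          \<open>a\<close>.\<close>
        have "length (proj d r (past d {p'} u)) \<le> length (proj d r (past d (d a) u))"
          "length (proj d r (past d (d a) u)) \<le> length (proj d r (past d (P \<union> d a) u))"
          using True by (intro length_proj_past_mono; blast)+
        then have "proj d r (past d (P \<union> d a) u) = proj d r (past d (d a) u)"
          using p'(2) by (intro proj_past_eqI) simp
        then have "proj d r (past d P (u @ [a])) = proj d r (past d {p} (u @ [a]))"
          using False p by (simp only: past_snoc_in past_snoc[of d P] if_False proj_simps(2))
        with p show ?thesis by blast
      next
        case p'a: False
        then have "proj d r (past d P (u @ [a])) = proj d r (past d {p'} (u @ [a]))"
          using False p'(2) r by (simp add: past_snoc[of d P] past_snoc_notin)
        with p'(1) p'a show ?thesis by blast
      qed
    qed
  qed
qed auto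

text \<open>The past of a set of processes is the join of their individual views: on every process it is
  the longest of the individual projections, so it is determined by them even across different
  traces.\<close>

lemma past_join:
  assumes "P \<noteq> {}" and "\<And>a. a \<in> set u \<union> set v \<Longrightarrow> d a \<noteq> {}"
    and eq: "\<And>p. p \<in> P \<Longrightarrow> teq d (past d {p} u) (past d {p} v)"
  shows "teq d (past d P u) (past d P v)"
proof (rule teq_if_proj)
  fix a assume "a \<in> set (past d P u) \<union> set (past d P v)"
  then show "d a \<noteq> {}" using assms(2) set_past by (metis Un_iff subsetD)
next
  fix r
  have le: "length (proj d r (past d P x)) \<le> length (proj d r (past d P y))"
    and at: "\<exists>p \<in> P. proj d r (past d P x) = proj d r (past d {p} y)"
    if "\<And>p. p \<in> P \<Longrightarrow> teq d (past d {p} x) (past d {p} y)" for x y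
  proof -
    obtain p where p: "p \<in> P" "proj d r (past d P x) = proj d r (past d {p} x)"
      using proj_past_attained[OF assms(1)] by blast
    then have *: "proj d r (past d P x) = proj d r (past d {p} y)"
      using teq_proj[OF that[OF p(1)]] by simp
    then show "\<exists>p \<in> P. proj d r (past d P x) = proj d r (past d {p} y)" using p(1) by blast
    show "length (proj d r (past d P x)) \<le> length (proj d r (past d P y))"
      unfolding * using p(1) by (intro length_proj_past_mono) simp
  qed
  have "length (proj d r (past d P u)) = length (proj d r (past d P v))"
    using le[OF eq] le[OF teq_sym[OF eq]] by simp
  moreover obtain p where "proj d r (past d P u) = proj d r (past d {p} v)"
    using at[of u v] eq by blast
  ultimately show "proj d r (past d P u) = proj d r (past d P v)"
    using proj_past_eqI[of d r "{p}" v P] by simp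
qed

lemma teq_cancel_last:
  assumes "\<And>a. a \<in> set (u @ v) \<Longrightarrow> d a \<noteq> {}" and "teq d (u @ [a]) (v @ [a])"
  shows "teq d u v"
proof (rule teq_if_proj)
  fix p show "proj d p u = proj d p v"
    using teq_proj[OF assms(2), of p] by (auto split: if_splits)
qed (use assms(1) in auto)

section \<open>Views as causal pasts\<close>

lemma trace_eq_iff: "trace A u = trace A v \<longleftrightarrow> teq (action_dom A) u v"
  unfolding trace_def trace_equiv_def
  by (auto intro: rtranclp_trans dest: teq_sym)

text \<open>The past is a candidate for the view by \<open>past_rest\<close>. Conversely, cutting
  off a suffix without actions of \<open>p\<close> does not change the past of \<open>p\<close>, so
  every candidate is at least as long as the past, and a shortest one equals its own past.\<close>

lemma view_eq_past: "view A p u = trace A (past (action_dom A) {p} u)"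
proof -
  let ?d = "action_dom A"
  let ?P = "\<lambda>v. \<exists>w. trace_equiv A u (v @ w) \<and> (\<forall>a \<in> set w. p \<notin> ?d a)"
  define v where "v = (ARG_MIN length v. ?P v)"
  have past: "?P (past ?d {p} u)"
    using past_rest[of ?d u "{p}"] by (auto simp: trace_equiv_def)
  have v: "?P v" and min: "length v \<le> length (past ?d {p} u)"
    using arg_min_nat_lemma[of ?P, OF past, of length] past by (auto simp: v_def)
  obtain w where w: "teq ?d u (v @ w)" "\<forall>a \<in> set w. p \<notin> ?d a"
    using v by (auto simp: trace_equiv_def)
  have eq: "teq ?d (past ?d {p} u) (past ?d {p} v)"
    using teq_past[OF w(1), of "{p}"] past_append_indep[of w ?d "{p}" v] w(2) by simp
  then have "past ?d {p} v = v"
    using min teq_length[OF eq] length_past_le[of ?d "{p}" v] by (intro past_eq_if_length) simp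
  with eq have "trace A (past ?d {p} u) = trace A v" by (simp add: trace_eq_iff)
  then show ?thesis by (simp add: view_def v_def)
qed

text \<open>Quantities attached to a process that change only with the actions of that process, and then
  only depending on the common past of the participants.\<close>

locale local_valuation =
  fixes d :: "'a \<Rightarrow> 'r set" and g :: "'a list \<Rightarrow> 'r \<Rightarrow> 'x"
  assumes other: "p \<notin> d a \<Longrightarrow> g (u @ [a]) p = g u p"
    and own: "p \<in> d a \<Longrightarrow> (\<And>r. r \<in> d a \<Longrightarrow> g u r = g v r) \<Longrightarrow>
      teq d (past d (d a) u) (past d (d a) v) \<Longrightarrow> g (u @ [a]) p = g (v @ [a]) p"
begin

text \<open>Neither of the swapped actions changes what the other depends on, neither the values at
  its participants nor their common past. So executing an action after the other has the same local
  effect as executing it alone.\<close>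

lemma commute1_invariant:
  assumes "d a \<inter> d b = {}"
  shows "g (x @ [a, b] @ y) p = g (x @ [b, a] @ y) p"
proof (induction y arbitrary: p rule: rev_induct)
  case Nil
  have *: "g (x @ [a', b']) p = g (x @ [b', a']) p" if "d a' \<inter> d b' = {}" "p \<in> d b'" for a' b'
  proof -
    have "g ((x @ [a']) @ [b']) p = g (x @ [b']) p"
      using that by (intro own) (auto simp: past_snoc intro!: other)
    also have "\<dots> = g ((x @ [b']) @ [a']) p" using that by (intro other[symmetric]) blast
    finally show ?thesis by simp
  qed
  show ?case
  proof (cases "p \<in> d a \<or> p \<in> d b")
    case True
    then show ?thesis using *[of a b] *[of b a] assms by (auto simp: Int_commute)
  next
    case False
    then show ?thesis
      using other[of p b "x @ [a]"] other[of p a x] other[of p a "x @ [b]"] other[of p b x] by simp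
  qed
next
  case (snoc c y)
  have "g ((x @ [a, b] @ y) @ [c]) p = g ((x @ [b, a] @ y) @ [c]) p"
  proof (cases "p \<in> d c")
    case True
    then show ?thesis by (intro own snoc commute1_past assms)
  next
    case False
    then show ?thesis using snoc by (simp only: other[OF False])
  qed
  then show ?case by simp
qed

lemma invariant: "teq d u v \<Longrightarrow> g u = g v"
proof (induction rule: rtranclp_induct)
  case (step v w)
  from step.hyps(2) have "g v = g w"
    by (induction rule: commute1.induct) (rule ext, rule commute1_invariant)
  with step.IH show ?case by simp
qed simp

lemma past_eq: "p \<in> P \<Longrightarrow> g (past d P u) p = g u p"
proof (induction u arbitrary: P p rule: rev_induct)
  case (snoc a u)
  show ?case
  proof (cases "p \<in> d a")
    case True
    then have "d a \<inter> P \<noteq> {}" using snoc.prems by blast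
    moreover have "g (past d (P \<union> d a) u @ [a]) p = g (u @ [a]) p"
      using True by (intro own snoc.IH) (auto simp: past_past)
    ultimately show ?thesis by (simp add: past_snoc)
  next
    case False
    then show ?thesis using snoc by (auto simp: past_snoc other)
  qed
qed simp

end

section \<open>Configurations of occurrence nets\<close>

text \<open>An occurrence net up to the absence of self-conflicts. Presets are required to be nonempty
  because a transition with empty preset could fire repeatedly.\<close>

definition causal_net :: "('p, 't, 'z) net_scheme \<Rightarrow> bool" where
  "causal_net N \<longleftrightarrow>
     petri_net N \<and>
     (\<forall>t \<in> transitions N. \<forall>q. count (pre N t) q \<le> 1 \<and> count (post N t) q \<le> 1) \<and>
     initial N = mset_set {q \<in> places N. place_pre N q = {}} \<and>
     finite {q \<in> places N. place_pre N q = {}} \<and>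
     (\<forall>q \<in> places N. \<forall>t1 \<in> place_pre N q. \<forall>t2 \<in> place_pre N q. t1 = t2) \<and>
     wf (flow_rel N) \<and>
     (\<forall>t \<in> transitions N. pre N t \<noteq> {#})"

lemma occurrence_net_causal:
  "occurrence_net N \<Longrightarrow> (\<And>t. t \<in> transitions N \<Longrightarrow> pre N t \<noteq> {#}) \<Longrightarrow> causal_net N"
  by (auto simp: occurrence_net_def causal_net_def)

text \<open>Only immediate conflicts, that is, shared preplaces, are excluded explicitly; closure
  under producers traces an inherited conflict back to such a pair.\<close>

definition config :: "('p, 't, 'z) net_scheme \<Rightarrow> 't set \<Rightarrow> bool" where
  "config N F \<longleftrightarrow> F \<subseteq> transitions N \<and> finite F \<and>
     (\<forall>t \<in> F. \<forall>q. q \<in># pre N t \<longrightarrow> place_pre N q \<subseteq> F) \<and>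
     (\<forall>q. \<forall>t1 \<in> F. \<forall>t2 \<in> F. q \<in># pre N t1 \<longrightarrow> q \<in># pre N t2 \<longrightarrow> t1 = t2)"

definition frontier :: "('p, 't, 'z) net_scheme \<Rightarrow> 't set \<Rightarrow> 'p set" where
  "frontier N F = {q \<in> places N. place_pre N q \<subseteq> F \<and> place_post N q \<inter> F = {}}"

lemma mset_set_set_mset_if_simple: "(\<And>q. count X q \<le> 1) \<Longrightarrow> mset_set (set_mset X) = X"
proof (rule multiset_eqI)
  fix q assume *: "\<And>q. count X q \<le> 1"
  show "count (mset_set (set_mset X)) q = count X q"
  proof (cases "q \<in># X")
    case True
    then have "count X q > 0" by simp
    then have "count X q = 1" using *[of q] by linarith
    then show ?thesis using True by simp
  qed (simp add: not_in_iff)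
qed

lemma finite_frontier:
  assumes "causal_net N" "config N F"
  shows "finite (frontier N F)"
proof -
  have "frontier N F \<subseteq> {q \<in> places N. place_pre N q = {}} \<union> (\<Union>t \<in> F. set_mset (post N t))"
    by (auto simp: frontier_def place_pre_def)
  moreover have "finite \<dots>" using assms by (auto simp: causal_net_def config_def)
  ultimately show ?thesis by (rule finite_subset)
qed

lemma config_empty: "config N {}"
  by (simp add: config_def)

lemma initial_frontier: "causal_net N \<Longrightarrow> initial N = mset_set (frontier N {})"
  by (simp add: causal_net_def frontier_def)

lemma config_fire:
  assumes N: "causal_net N" and F: "config N F" and en: "enabled N (mset_set (frontier N F)) t"
  shows "t \<notin> F" and "config N (insert t F)"
    and "fire N (mset_set (frontier N F)) t = mset_set (frontier N (insert t F))"
proof -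
  have t: "t \<in> transitions N" and sub: "set_mset (pre N t) \<subseteq> frontier N F"
    using en finite_frontier[OF N F] set_mset_mono[of "pre N t" "mset_set (frontier N F)"]
    by (auto simp: enabled_def)
  have "pre N t \<noteq> {#}" using N t by (simp add: causal_net_def)
  then obtain q0 where "q0 \<in># pre N t" by blast
  then show tF: "t \<notin> F" using sub t by (auto simp: frontier_def place_post_def)
  show "config N (insert t F)"
    using F t sub unfolding config_def by (auto simp: frontier_def place_post_def) blast+
  have places: "set_mset (pre N t) \<subseteq> places N" "set_mset (post N t) \<subseteq> places N"
    using N t by (auto simp: causal_net_def petri_net_def)
  have uniq: "place_pre N q = {t}" if "q \<in># post N t" for q
    using N t places that by (fastforce simp: causal_net_def place_pre_def)
  \<comment> \<open>A consumer in \<open>F\<close> would force its producer \<open>t\<close> into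
    \<open>F\<close> by closure; and \<open>t\<close> itself consumes only frontier places, whose
    producers all lie in \<open>F\<close>.\<close>
  have unconsumed: "place_post N q \<inter> insert t F = {}" if "q \<in># post N t" for q
    using F tF sub uniq[OF that] by (fastforce simp: config_def place_post_def frontier_def)
  have "q \<in> frontier N (insert t F) \<longleftrightarrow> q \<in> (frontier N F - set_mset (pre N t)) \<union> set_mset (post N t)" for q
  proof (cases "q \<in># post N t")
    case True
    then show ?thesis using uniq[OF True] unconsumed[OF True] places by (auto simp: frontier_def)
  next
    case False
    then have "place_pre N q \<subseteq> insert t F \<longleftrightarrow> place_pre N q \<subseteq> F"
      by (auto simp: place_pre_def)
    then show ?thesis using False t by (auto simp: frontier_def place_post_def)
  qed
  then have frontier_eq: "frontier N (insert t F) = (frontier N F - set_mset (pre N t)) \<union> set_mset (post N t)"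
    by blast
  have disj: "(frontier N F - set_mset (pre N t)) \<inter> set_mset (post N t) = {}"
    using uniq tF by (auto simp: frontier_def)
  have simple: "mset_set (set_mset (pre N t)) = pre N t" "mset_set (set_mset (post N t)) = post N t"
    using N t by (auto simp: causal_net_def intro!: mset_set_set_mset_if_simple)
  show "fire N (mset_set (frontier N F)) t = mset_set (frontier N (insert t F))"
    unfolding frontier_eq fire_def using finite_frontier[OF N F] disj sub
    by (simp add: mset_set_Union mset_set_Diff simple)
qed

lemma reachable_config:
  assumes "causal_net N" "reachable N M"
  shows "\<exists>F. config N F \<and> M = mset_set (frontier N F)"
  using assms(2)
proof induction
  case reachable_initial
  then show ?case using config_empty initial_frontier[OF assms(1)] by blast
next
  case (reachable_fire M t)
  then show ?case using config_fire[OF assms(1)] by metis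
qed

text \<open>The missing transitions are fired in causal order: a flow-minimal element of
  \<open>F - F0\<close> finds its preplaces in the frontier of \<open>F0\<close>, since their
  producers are not missing and, by conflict-freeness of \<open>F\<close>, nothing in
  \<open>F0\<close> has consumed them.\<close>

lemma config_reachable_from:
  assumes N: "causal_net N" and F: "config N F"
    and "config N F0" "F0 \<subseteq> F" "reachable N (mset_set (frontier N F0))"
  shows "reachable N (mset_set (frontier N F))"
  using assms(3-)
proof (induction "card (F - F0)" arbitrary: F0 rule: less_induct)
  case less
  show ?case
  proof (cases "F0 = F")
    case False
    then obtain t0 where "t0 \<in> F - F0" using less.prems by blast
    then have "Inr t0 \<in> Inr ` (F - F0)" by blast
    moreover have "wf ((flow_rel N)\<^sup>+)" using N by (auto simp: causal_net_def intro: wf_trancl)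
    ultimately obtain z where z: "z \<in> Inr ` (F - F0)"
        "\<And>y. (y, z) \<in> (flow_rel N)\<^sup>+ \<Longrightarrow> y \<notin> Inr ` (F - F0)"
      by (meson wfE_min)
    then obtain t where t: "t \<in> F" "t \<notin> F0" and zt: "z = Inr t" by blast
    have tN: "t \<in> transitions N" using t F by (auto simp: config_def)
    have "q \<in> frontier N F0" if q: "q \<in># pre N t" for q
    proof -
      have "t' \<in> F0" if t': "t' \<in> place_pre N q" for t'
      proof -
        have "(Inr t', Inl q) \<in> flow_rel N" "(Inl q, Inr t) \<in> flow_rel N"
          using t' q tN by (auto simp: flow_rel_def place_pre_def)
        then have "(Inr t', Inr t) \<in> (flow_rel N)\<^sup>+" by (meson trancl.simps)
        then have "t' \<notin> F - F0" using z(2) zt by blast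
        moreover have "t' \<in> F" using F t(1) q t' by (auto simp: config_def)
        ultimately show ?thesis by blast
      qed
      moreover have "s \<notin> F0" if "s \<in> place_post N q" for s
      proof
        assume "s \<in> F0"
        then have "s = t"
          using F t(1) q less.prems(2) that by (auto simp: config_def place_post_def)
        then show False using t(2) \<open>s \<in> F0\<close> by blast
      qed
      moreover have "q \<in> places N" using N tN q by (auto simp: causal_net_def petri_net_def)
      ultimately show ?thesis by (auto simp: frontier_def)
    qed
    then have "set_mset (pre N t) \<subseteq> frontier N F0" by blast
    then have "mset_set (set_mset (pre N t)) \<subseteq># mset_set (frontier N F0)"
      using finite_frontier[OF N less.prems(1)] by (simp add: subset_imp_msubset_mset_set)
    moreover have "mset_set (set_mset (pre N t)) = pre N t"
      using N tN by (auto simp: causal_net_def intro!: mset_set_set_mset_if_simple)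
    ultimately have en: "enabled N (mset_set (frontier N F0)) t" using tN by (simp add: enabled_def)
    note fired = config_fire[OF N less.prems(1) en]
    show ?thesis
    proof (rule less.hyps)
      show "card (F - insert t F0) < card (F - F0)"
        using t F by (intro psubset_card_mono) (auto simp: config_def)
      show "reachable N (mset_set (frontier N (insert t F0)))"
        using reachable_fire[OF less.prems(3) en] fired(3) by simp
    qed (use fired t less.prems in auto)
  qed (use less.prems in simp)
qed

lemma config_reachable:
  "causal_net N \<Longrightarrow> config N F \<Longrightarrow> reachable N (mset_set (frontier N F))"
  using config_reachable_from[of N F "{}"] config_empty[of N] initial_frontier[of N]
    reachable_initial[of N] by simp

section \<open>Concurrency of places in terms of configurations\<close>

lemma config_causally_closed:
  assumes "config N F" "(x, y) \<in> (flow_rel N)\<^sup>*"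
    and "case y of Inl q \<Rightarrow> place_pre N q \<subseteq> F | Inr t \<Rightarrow> t \<in> F"
  shows "case x of Inl q \<Rightarrow> place_pre N q \<subseteq> F | Inr t \<Rightarrow> t \<in> F"
  using assms(2,3)
proof (induction rule: converse_rtrancl_induct)
  case (step x z)
  then show ?case using assms(1)
    by (auto simp: flow_rel_def config_def place_pre_def split: sum.splits)
qed

lemma config_no_conflict:
  assumes F: "config N F" and "q1 \<in> frontier N F" "q2 \<in> frontier N F"
  shows "\<not> conflict N (Inl q1) (Inl q2)"
proof
  assume "conflict N (Inl q1) (Inl q2)"
  then obtain q t1 t2 where *: "t1 \<in> place_post N q" "t2 \<in> place_post N q" "t1 \<noteq> t2"
      "(Inr t1, Inl q1) \<in> (flow_rel N)\<^sup>*" "(Inr t2, Inl q2) \<in> (flow_rel N)\<^sup>*"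
    by (auto simp: conflict_def)
  have "t1 \<in> F" "t2 \<in> F"
    using config_causally_closed[OF F *(4)] config_causally_closed[OF F *(5)] assms(2,3)
    by (auto simp: frontier_def)
  then show False using * F by (auto simp: config_def place_post_def)
qed

lemma frontier_pairwise_concurrent:
  assumes F: "config N F" and "C \<subseteq> frontier N F"
  shows "pairwise_concurrent N C"
proof -
  have no_path: "(Inl q, Inl q') \<notin> (flow_rel N)\<^sup>*"
    if "q \<in> frontier N F" "q' \<in> frontier N F" "q \<noteq> q'" for q q'
  proof
    assume "(Inl q, Inl q') \<in> (flow_rel N)\<^sup>*"
    then obtain z where z: "(Inl q, z) \<in> flow_rel N" "(z, Inl q') \<in> (flow_rel N)\<^sup>*"
      using \<open>q \<noteq> q'\<close> by (metis converse_rtranclE sum.inject(1))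
    then obtain t where t: "z = Inr t" "t \<in> place_post N q"
      by (auto simp: flow_rel_def place_post_def)
    have "t \<in> F" using config_causally_closed[OF F z(2)] that(2) t by (auto simp: frontier_def)
    then show False using t that(1) by (auto simp: frontier_def)
  qed
  then show ?thesis
    using assms(2) config_no_conflict[OF F]
    by (auto simp: pairwise_concurrent_def concurrent_def frontier_def subset_iff)
qed

lemma reachable_pairwise_concurrent:
  assumes "causal_net N" "reachable N M" "C \<subseteq> set_mset M"
  shows "pairwise_concurrent N C"
proof -
  obtain F where F: "config N F" "M = mset_set (frontier N F)"
    using reachable_config[OF assms(1,2)] by blast
  then show ?thesis
    using frontier_pairwise_concurrent[OF F(1)] assms(3) finite_frontier[OF assms(1) F(1)] by simp
qed

text \<open>A transition that fires somewhere belongs to a configuration. The two branches of a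
  self-conflict would lie in its past, hence in that configuration, although they share a
  preplace.\<close>

lemma occurrence_netI:
  assumes N: "causal_net N"
    and live: "\<And>t. t \<in> transitions N \<Longrightarrow> \<exists>M. reachable N M \<and> enabled N M t"
  shows "occurrence_net N"
proof -
  have "\<not> conflict N (Inr t) (Inr t)" if t: "t \<in> transitions N" for t
  proof
    assume "conflict N (Inr t) (Inr t)"
    then obtain q t1 t2 where *: "t1 \<in> place_post N q" "t2 \<in> place_post N q" "t1 \<noteq> t2"
      "(Inr t1, Inr t) \<in> (flow_rel N)\<^sup>*" "(Inr t2, Inr t) \<in> (flow_rel N)\<^sup>*"
      by (auto simp: conflict_def)
    obtain M where "reachable N M" "enabled N M t" using live[OF t] by blast
    then obtain F where F: "config N (insert t F)"
      using reachable_config[OF N] config_fire(2)[OF N] by metis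
    have "t1 \<in> insert t F" "t2 \<in> insert t F"
      using config_causally_closed[OF F *(4)] config_causally_closed[OF F *(5)] by auto
    then show False using * F by (auto simp: config_def place_post_def)
  qed
  then show ?thesis using N by (auto simp: occurrence_net_def causal_net_def)
qed

text \<open>The causal past of \<open>C\<close> is a configuration with \<open>C\<close> in its
  frontier: it is conflict-free because no two places of \<open>C\<close> are in conflict, and it
  does not consume \<open>C\<close> because no place of \<open>C\<close> lies below another.\<close>

lemma pairwise_concurrent_reachable:
  assumes N: "causal_net N" and occ: "occurrence_net N" and fin: "finite (transitions N)"
    and C: "pairwise_concurrent N C"
  shows "\<exists>M. reachable N M \<and> C \<subseteq> set_mset M"
proof -
  let ?R = "(flow_rel N)\<^sup>*"
  define F where "F = {t \<in> transitions N. \<exists>x \<in> C. (Inr t, Inl x) \<in> ?R}"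
  \<comment> \<open>Concurrency speaks only of distinct places, but two transitions of the past may
    lie below the same place. A self-conflict of a place passes to its unique producer, which has
    none in an occurrence net.\<close>
  have place_self: "\<not> conflict N (Inl x) (Inl x)" if "x \<in> places N" for x
  proof
    assume "conflict N (Inl x) (Inl x)"
    then obtain q t1 t2 where *: "t1 \<in> place_post N q" "t2 \<in> place_post N q" "t1 \<noteq> t2"
      "(Inr t1, Inl x) \<in> ?R" "(Inr t2, Inl x) \<in> ?R"
      by (auto simp: conflict_def)
    have prod: "\<exists>s. s \<in> place_pre N x \<and> (Inr t, Inr s) \<in> ?R" if "(Inr t, Inl x) \<in> ?R" for t
      using that by (cases rule: rtranclE) (auto simp: flow_rel_def place_pre_def)
    have "\<forall>t1 \<in> place_pre N x. \<forall>t2 \<in> place_pre N x. t1 = t2"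
      using N that by (simp add: causal_net_def)
    then obtain s where s: "s \<in> place_pre N x" "(Inr t1, Inr s) \<in> ?R" "(Inr t2, Inr s) \<in> ?R"
      using prod[OF *(4)] prod[OF *(5)] by metis
    then have "conflict N (Inr s) (Inr s)" using * by (auto simp: conflict_def)
    then show False using occ s(1) by (auto simp: occurrence_net_def place_pre_def)
  qed
  have conf: "\<not> conflict N (Inl x) (Inl y)" if "x \<in> C" "y \<in> C" for x y
    using that C place_self
    by (cases "x = y") (auto simp: pairwise_concurrent_def concurrent_def)
  have config: "config N F"
    unfolding config_def
  proof (intro conjI ballI allI impI)
    show "finite F" using fin by (simp add: F_def)
  next
    fix t q assume t: "t \<in> F" and q: "q \<in># pre N t"
    then obtain x where x: "x \<in> C" "(Inr t, Inl x) \<in> ?R" by (auto simp: F_def)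
    show "place_pre N q \<subseteq> F"
    proof
      fix s assume s: "s \<in> place_pre N q"
      have "(Inr s, Inl q) \<in> flow_rel N" "(Inl q, Inr t) \<in> flow_rel N"
        using s t q by (auto simp: flow_rel_def place_pre_def F_def)
      then have "(Inr s, Inl x) \<in> ?R" using x(2) by (meson converse_rtrancl_into_rtrancl)
      then show "s \<in> F" using s x by (auto simp: F_def place_pre_def)
    qed
  next
    fix q t1 t2 assume "t1 \<in> F" "t2 \<in> F" and q: "q \<in># pre N t1" "q \<in># pre N t2"
    then obtain x y where "x \<in> C" "(Inr t1, Inl x) \<in> ?R" "y \<in> C" "(Inr t2, Inl y) \<in> ?R"
      and "t1 \<in> place_post N q" "t2 \<in> place_post N q"
      by (auto simp: F_def place_post_def)
    then show "t1 = t2" using conf[of x y] unfolding conflict_def by blast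
  qed (auto simp: F_def)
  have "x \<in> frontier N F" if x: "x \<in> C" for x
  proof -
    have xN: "x \<in> places N" using C x by (auto simp: pairwise_concurrent_def)
    have "place_pre N x \<subseteq> F"
      using x by (auto simp: F_def place_pre_def flow_rel_def intro!: bexI[of _ x] r_into_rtrancl)
    moreover have "False" if t: "t \<in> place_post N x" "t \<in> F" for t
    proof -
      obtain y where y: "y \<in> C" "(Inr t, Inl y) \<in> ?R" using t(2) by (auto simp: F_def)
      have e: "(Inl x, Inr t) \<in> flow_rel N" using t(1) by (auto simp: flow_rel_def place_post_def)
      then have "(Inl x, Inl y) \<in> (flow_rel N)\<^sup>+" using y(2) by (meson rtrancl_into_trancl2)
      then show False
      proof (cases "x = y")
        case True
        have "wf ((flow_rel N)\<^sup>+)" using N by (auto simp: causal_net_def intro: wf_trancl)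
        then show False using \<open>(Inl x, Inl y) \<in> (flow_rel N)\<^sup>+\<close> True by (meson wf_not_refl)
      next
        case False
        then show False
          using C x y(1) trancl_into_rtrancl[OF \<open>(Inl x, Inl y) \<in> (flow_rel N)\<^sup>+\<close>]
          by (auto simp: pairwise_concurrent_def concurrent_def)
      qed
    qed
    ultimately show ?thesis using xN by (auto simp: frontier_def)
  qed
  then have "C \<subseteq> set_mset (mset_set (frontier N F))" using finite_frontier[OF N config] by auto
  then show ?thesis using config_reachable[OF N config] by blast
qed

section \<open>The control games of a sliced Petri game\<close>

lemma sum_singleton_mset: "finite X \<Longrightarrow> (\<Sum>x \<in> X. {#f x#}) = image_mset f (mset_set X)"
  by (induction rule: finite_induct) auto

lemma run_append:
  "run A s (u @ v) s'' \<longleftrightarrow> (\<exists>s'. run A s u s' \<and> run A s' v s'')"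
proof (induction u arbitrary: s)
  case Nil
  then show ?case by (auto intro: run_Nil elim: run.cases)
next
  case (Cons a u)
  have *: "run A s (a # x) z \<longleftrightarrow> (\<exists>y. global_step A s a y \<and> run A y x z)" for x z
    by (auto intro: run_Cons elim: run.cases)
  show ?case by (auto simp: * Cons.IH)
qed

lemma run_snoc: "run A s (u @ [a]) s'' \<longleftrightarrow> (\<exists>s'. run A s u s' \<and> global_step A s' a s'')"
proof -
  have "run A s' [a] s'' \<longleftrightarrow> global_step A s' a s''" for s'
    by (auto intro: run_Cons run_Nil elim: run.cases)
  then show ?thesis by (simp add: run_append)
qed

text \<open>The flag \<open>h\<close> selects the game written with a hat.\<close>

locale sliced_game =
  fixes G :: "('p, 't) petri_game" and S :: "('p, 't) net set" and h :: bool
  assumes game: "petri_game G" and distr: "slice_distribution G S"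
begin

definition CG :: "(('p, 't) net, ('p, 't) action, ('p, 't) lstate) control_game" where
  "CG = (if h then control_game_det_of G S else control_game_of G S)"

abbreviation D :: "('p, 't) action \<Rightarrow> ('p, 't) net set" where
  "D \<equiv> slice_dom S"

definition clashes :: "('p, 't) action set" where
  "clashes = (if h then clash_actions G else {})"

definition Sig :: "('p, 't) action set" where
  "Sig = Tr ` transitions G \<union> commit_actions G \<union> clashes"

definition lt :: "('p, 't) net \<Rightarrow> (('p, 't) lstate \<times> ('p, 't) action \<times> ('p, 't) lstate) set" where
  "lt p = slice_trans G p \<union> (if h then clash_trans G p else {})"

lemma CG_simps [simp]:
  "processes (arena CG) = S" "actions (arena CG) = Sig" "action_dom (arena CG) = D"
  "start (arena CG) = restrict (\<lambda>p. Place (initial_place p)) S"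
  "sys_actions CG = commit_actions G" "env_actions CG = Tr ` transitions G \<union> clashes"
  "win_states CG = slice_win G"
  by (simp_all add: CG_def control_game_det_of_def control_game_of_def parallel_composition_def
      slice_automaton_def slice_automaton_det_def Sig_def clashes_def restrict_def)

subsection \<open>Slices\<close>

lemma finite_S: "finite S"
  using distr by (simp add: slice_distribution_def)

lemma slice_in: "p \<in> S \<Longrightarrow> slice G p"
  using distr by (simp add: slice_distribution_def)

lemma same_slice: "q \<in> places p \<Longrightarrow> q \<in> places p' \<Longrightarrow> p \<in> S \<Longrightarrow> p' \<in> S \<Longrightarrow> p = p'"
  using distr by (auto simp: slice_distribution_def disjoint_family_on_def)

definition prep :: "('p, 't) net \<Rightarrow> 't \<Rightarrow> 'p" where
  "prep p t = (THE q. pre p t = {#q#})"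

definition postp :: "('p, 't) net \<Rightarrow> 't \<Rightarrow> 'p" where
  "postp p t = (THE q. post p t = {#q#})"

lemma slice_mset:
  assumes "p \<in> S"
  shows "initial p = {#initial_place p#}"
    and "t \<in> transitions p \<Longrightarrow> pre p t = {#prep p t#}"
    and "t \<in> transitions p \<Longrightarrow> post p t = {#postp p t#}"
proof -
  have *: "X = {#THE q. X = {#q#}#}" if "size X = 1" for X :: "'p multiset"
    using size_1_singleton_mset[OF that] by auto
  have size: "size (initial p) = 1" "t \<in> transitions p \<Longrightarrow> size (pre p t) = 1"
    "t \<in> transitions p \<Longrightarrow> size (post p t) = 1"
    using slice_in[OF assms] unfolding slice_def by blast+
  show "initial p = {#initial_place p#}"
    unfolding initial_place_def using *[OF size(1)] .
  show "pre p t = {#prep p t#}" if "t \<in> transitions p"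
    unfolding prep_def using *[OF size(2)[OF that]] .
  show "post p t = {#postp p t#}" if "t \<in> transitions p"
    unfolding postp_def using *[OF size(3)[OF that]] .
qed

lemma slice_places:
  assumes "p \<in> S"
  shows "initial_place p \<in> places p"
    and "t \<in> transitions p \<Longrightarrow> prep p t \<in> places p"
    and "t \<in> transitions p \<Longrightarrow> postp p t \<in> places p"
    and "places p \<subseteq> places G" and "transitions p \<subseteq> transitions G"
proof -
  have "petri_net p" using slice_in[OF assms] by (simp add: slice_def)
  then show "initial_place p \<in> places p" "t \<in> transitions p \<Longrightarrow> prep p t \<in> places p"
    "t \<in> transitions p \<Longrightarrow> postp p t \<in> places p"
    using slice_mset[OF assms] by (auto simp: petri_net_def)
  show "places p \<subseteq> places G" "transitions p \<subseteq> transitions G"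
    using slice_in[OF assms] by (auto simp: slice_def)
qed

lemma finite_D [simp]: "finite (D a)"
  using finite_S by (cases a) auto

lemma D_subset: "D a \<subseteq> S"
  by (cases a) auto

text \<open>Every slice of \<open>t\<close> contributes exactly one preplace. Presets thus become
  images of the set of participants, the form in which nets and processes are compared from here
  on.\<close>

lemma pre_G:
  assumes "t \<in> transitions G"
  shows "pre G t = image_mset (\<lambda>p. prep p t) (mset_set (D (Tr t)))"
proof -
  have "pre G t = (\<Sum>p \<in> D (Tr t). pre p t)"
    using distr assms by (simp add: slice_distribution_def)
  also have "\<dots> = (\<Sum>p \<in> D (Tr t). {#prep p t#})"
    by (intro sum.cong) (auto simp: slice_mset)
  finally show ?thesis by (simp only: sum_singleton_mset[OF finite_D])
qed

lemma post_G:
  assumes "t \<in> transitions G"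
  shows "post G t = image_mset (\<lambda>p. postp p t) (mset_set (D (Tr t)))"
proof -
  have "post G t = (\<Sum>p \<in> D (Tr t). post p t)"
    using distr assms by (simp add: slice_distribution_def)
  also have "\<dots> = (\<Sum>p \<in> D (Tr t). {#postp p t#})"
    by (intro sum.cong) (auto simp: slice_mset)
  finally show ?thesis by (simp only: sum_singleton_mset[OF finite_D])
qed

lemma initial_G: "initial G = image_mset initial_place (mset_set S)"
proof -
  have "initial G = (\<Sum>p \<in> S. initial p)"
    using distr by (simp add: slice_distribution_def)
  also have "\<dots> = (\<Sum>p \<in> S. {#initial_place p#})"
    by (intro sum.cong) (auto simp: slice_mset)
  finally show ?thesis by (simp only: sum_singleton_mset[OF finite_S])
qed

lemma in_pre_G:
  assumes "t \<in> transitions G"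
  shows "q \<in># pre G t \<longleftrightarrow> (\<exists>p \<in> D (Tr t). q = prep p t)"
  unfolding pre_G[OF assms] by (auto simp del: slice_dom.simps)

lemma pre_in_slice:
  assumes "t \<in> transitions G" "q \<in># pre G t" "p \<in> S" "q \<in> places p"
  shows "p \<in> D (Tr t)" and "prep p t = q"
proof -
  obtain p' where p': "p' \<in> D (Tr t)" "q = prep p' t"
    using assms in_pre_G by blast
  moreover have "p = p'"
    using p' slice_places(2)[of p' t] assms(3,4) same_slice[of q p p'] by simp
  ultimately show "p \<in> D (Tr t)" "prep p t = q" by simp_all
qed

lemma place_post_prep: "p \<in> D (Tr t) \<Longrightarrow> t \<in> place_post G (prep p t)"
  using slice_places(5)[of p] in_pre_G[of t] by (auto simp: place_post_def)

lemma place_post_slice: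
  assumes "p \<in> S" "q \<in> places p" "t \<in> place_post G q"
  shows "p \<in> D (Tr t)" and "prep p t = q"
  using pre_in_slice[of t q p] assms by (auto simp: place_post_def simp del: slice_dom.simps)

lemma slice_of: "q \<in> places G \<Longrightarrow> \<exists>p \<in> S. q \<in> places p"
  using distr by (auto simp: slice_distribution_def)

lemma sys_env: "sys_places G \<subseteq> places G" "q \<in> sys_places G \<Longrightarrow> q \<notin> env_places G"
  "q \<in> places G \<Longrightarrow> q \<in> sys_places G \<or> q \<in> env_places G"
  using game by (auto simp: petri_game_def)

lemma D_Commit: "q \<in> places p \<Longrightarrow> p \<in> S \<Longrightarrow> D (Commit q A) = {p}"
  using same_slice by auto

lemma D_Tr_nonempty: "t \<in> transitions G \<Longrightarrow> D (Tr t) \<noteq> {}"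
  using distr by (auto simp: slice_distribution_def)

lemma D_nonempty:
  assumes "a \<in> Sig"
  shows "D a \<noteq> {}"
proof -
  consider t where "a = Tr t" "t \<in> transitions G"
    | q B where "a = Commit q B" "q \<in> sys_places G"
    | q B t1 t2 where "a = Clash q B t1 t2" "t1 \<in> transitions G"
    using assms
    by (auto simp: Sig_def commit_actions_def clashes_def clash_actions_def place_post_def
        split: if_splits)
  then show ?thesis
  proof cases
    case 1
    then show ?thesis using D_Tr_nonempty by simp
  next
    case 2
    then show ?thesis using slice_of sys_env(1) by auto
  next
    case 3
    then show ?thesis using D_Tr_nonempty[of t1] by auto
  qed
qed

lemma finite_Sig: "finite Sig"
proof -
  have fin: "finite (places G)" "finite (transitions G)"
    using game by (auto simp: petri_game_def finite_net_def)
  have sys: "finite (sys_places G)" using finite_subset[OF sys_env(1) fin(1)] .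
  have "commit_actions G \<subseteq> (\<lambda>(q, A). Commit q A) ` (sys_places G \<times> Pow (transitions G))"
    by (auto simp: commit_actions_def place_post_def)
  then have "finite (commit_actions G)" by (rule finite_subset) (use fin sys in simp)
  moreover have "clash_actions G \<subseteq> (\<lambda>(q, A, t1, t2). Clash q A t1 t2) `
      (sys_places G \<times> Pow (transitions G) \<times> transitions G \<times> transitions G)"
  proof
    fix a assume "a \<in> clash_actions G"
    then obtain q A t1 t2 where "a = Clash q A t1 t2" "q \<in> sys_places G"
        "A \<subseteq> place_post G q" "t1 \<in> A" "t2 \<in> A"
      by (auto simp: clash_actions_def)
    moreover have "place_post G q \<subseteq> transitions G" by (auto simp: place_post_def)
    ultimately show "a \<in> (\<lambda>(q, A, t1, t2). Clash q A t1 t2) `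
        (sys_places G \<times> Pow (transitions G) \<times> transitions G \<times> transitions G)"
      by (intro image_eqI[of _ _ "(q, A, t1, t2)"]) auto
  qed
  then have "finite (clash_actions G)" by (rule finite_subset) (use fin sys in simp)
  ultimately show ?thesis using fin by (simp add: Sig_def clashes_def)
qed

subsection \<open>Runs\<close>

definition ready :: "('p, 't) lstate \<Rightarrow> ('p, 't) net \<Rightarrow> 't \<Rightarrow> bool" where
  "ready x p t \<longleftrightarrow>
     x = Place (prep p t) \<and> prep p t \<in> env_places G \<or>
     (\<exists>A. x = Committed (prep p t) A \<and> prep p t \<in> sys_places G \<and>
        A \<subseteq> place_post G (prep p t) \<and> t \<in> A)"

lemma lt_Tr:
  "p \<in> D (Tr t) \<Longrightarrow> (x, Tr t, y) \<in> lt p \<longleftrightarrow> ready x p t \<and> y = Place (postp p t)"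
  using slice_mset(2,3)[of p t] slice_places(2)[of p t]
  by (auto simp: lt_def slice_trans_def clash_trans_def ready_def)

lemma lt_Commit:
  "(x, Commit q A, y) \<in> lt p \<longleftrightarrow>
     x = Place q \<and> y = Committed q A \<and> q \<in> places p \<inter> sys_places G \<and> A \<subseteq> place_post G q"
  by (auto simp: lt_def slice_trans_def clash_trans_def)

lemma lt_Clash: "(x, Clash q A t1 t2, y) \<in> lt p \<Longrightarrow> y = Bot \<and> x \<noteq> Bot"
  by (auto simp: lt_def slice_trans_def clash_trans_def split: if_splits)

lemma lt_Bot: "(Bot, a, y) \<notin> lt p"
  by (auto simp: lt_def slice_trans_def clash_trans_def)

lemma lt_det: "p \<in> D a \<Longrightarrow> (x, a, y) \<in> lt p \<Longrightarrow> (x, a, y') \<in> lt p \<Longrightarrow> y = y'"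
  by (cases a) (auto simp: lt_Tr lt_Commit dest: lt_Clash simp del: slice_dom.simps)

lemma delta_CG:
  "delta (arena CG) a s =
     (let succ = (\<lambda>s'. s' \<in> extensional (D a) \<and> (\<forall>p \<in> D a. (s p, a, s' p) \<in> lt p))
      in if \<exists>s'. succ s' then Some (THE s'. succ s') else None)"
  by (simp add: CG_def control_game_det_of_def control_game_of_def parallel_composition_def
      slice_automaton_def slice_automaton_det_def lt_def)

text \<open>Local automata are deterministic, so the successor described by \<open>THE\<close> is
  the only one and a global step can be checked process by process.\<close>

lemma global_step_iff:
  "global_step (arena CG) s a s' \<longleftrightarrow>
     a \<in> Sig \<and> (\<forall>p \<in> D a. (s p, a, s' p) \<in> lt p) \<and> (\<forall>p. p \<notin> D a \<longrightarrow> s' p = s p)"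
proof -
  define succ where "succ = (\<lambda>s'. s' \<in> extensional (D a) \<and>
      (\<forall>p \<in> D a. (restrict s (D a) p, a, s' p) \<in> lt p))"
  have uniq: "x = y" if "succ x" "succ y" for x y
    using that lt_det by (intro extensionalityI[of x "D a"]) (auto simp: succ_def)
  have delta: "delta (arena CG) a (restrict s (D a)) =
      (if \<exists>s'. succ s' then Some (THE s'. succ s') else None)"
    by (simp add: delta_CG succ_def Let_def)
  have "delta (arena CG) a (restrict s (D a)) = Some (restrict s' (D a)) \<longleftrightarrow> succ (restrict s' (D a))"
  proof
    assume "succ (restrict s' (D a))"
    then show "delta (arena CG) a (restrict s (D a)) = Some (restrict s' (D a))"
      unfolding delta using uniq by (auto intro!: the_equality)
  next
    assume d: "delta (arena CG) a (restrict s (D a)) = Some (restrict s' (D a))"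
    then obtain x where x: "succ x" unfolding delta by (auto split: if_splits)
    then have "(THE s'. succ s') = x" using uniq by blast
    then show "succ (restrict s' (D a))" using d x unfolding delta by (auto split: if_splits)
  qed
  moreover have "succ (restrict s' (D a)) \<longleftrightarrow> (\<forall>p \<in> D a. (s p, a, s' p) \<in> lt p)"
    by (auto simp: succ_def)
  ultimately show ?thesis by (simp add: global_step_def)
qed

lemma run_det:
  "run (arena CG) s u s' \<Longrightarrow> run (arena CG) s u s'' \<Longrightarrow> s' = s''"
proof (induction u arbitrary: s' s'' rule: rev_induct)
  case Nil
  then show ?case by (auto elim: run.cases)
next
  case (snoc a u)
  then obtain x where "global_step (arena CG) x a s'" "global_step (arena CG) x a s''"
    by (metis run_snoc)
  then show ?case by (intro ext) (metis global_step_iff lt_det)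
qed

definition legal :: "('p, 't) action list \<Rightarrow> bool" where
  "legal u \<longleftrightarrow> (\<exists>s. run (arena CG) (start (arena CG)) u s)"

definition st :: "('p, 't) action list \<Rightarrow> ('p, 't) net \<Rightarrow> ('p, 't) lstate" where
  "st = state (arena CG)"

definition en :: "(('p, 't) net \<Rightarrow> ('p, 't) lstate) \<Rightarrow> ('p, 't) action \<Rightarrow> bool" where
  "en s a \<longleftrightarrow> a \<in> Sig \<and> (\<forall>p \<in> D a. \<exists>y. (s p, a, y) \<in> lt p)"

lemma run_st: "run (arena CG) (start (arena CG)) u s \<Longrightarrow> st u = s"
  unfolding st_def state_def using run_det by blast

lemma legal_Nil [simp]: "legal []"
  unfolding legal_def by (blast intro: run_Nil)

lemma st_Nil: "st [] = restrict (\<lambda>p. Place (initial_place p)) S"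
  using run_st[OF run_Nil] by simp

lemma legal_run: "legal u \<Longrightarrow> run (arena CG) (start (arena CG)) u (st u)"
  using run_st by (auto simp: legal_def)

lemma legal_snoc: "legal (u @ [a]) \<longleftrightarrow> legal u \<and> en (st u) a"
proof
  assume "legal (u @ [a])"
  then obtain s s' where "run (arena CG) (start (arena CG)) u s" "global_step (arena CG) s a s'"
    by (auto simp: legal_def run_snoc)
  then show "legal u \<and> en (st u) a"
    using run_st by (auto simp: legal_def global_step_iff en_def)
next
  assume *: "legal u \<and> en (st u) a"
  then obtain g where g: "\<forall>p \<in> D a. (st u p, a, g p) \<in> lt p" by (metis en_def)
  then have "global_step (arena CG) (st u) a (\<lambda>p. if p \<in> D a then g p else st u p)"
    using * by (auto simp: global_step_iff en_def)
  then show "legal (u @ [a])" using legal_run * by (auto simp: legal_def run_snoc)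
qed

lemma st_snoc:
  assumes "legal (u @ [a])"
  shows "p \<in> D a \<Longrightarrow> (st u p, a, st (u @ [a]) p) \<in> lt p"
    and "p \<notin> D a \<Longrightarrow> st (u @ [a]) p = st u p"
proof -
  obtain s where s: "run (arena CG) (start (arena CG)) u s"
      "global_step (arena CG) s a (st (u @ [a]))"
    using legal_run[OF assms] by (auto simp: run_snoc)
  then have "s = st u" using run_st by blast
  then show "p \<in> D a \<Longrightarrow> (st u p, a, st (u @ [a]) p) \<in> lt p"
    "p \<notin> D a \<Longrightarrow> st (u @ [a]) p = st u p"
    using s(2) by (auto simp: global_step_iff)
qed

lemma legal_Sig: "legal u \<Longrightarrow> set u \<subseteq> Sig"
  by (induction u rule: rev_induct) (auto simp: legal_snoc en_def)

lemma st_outside: "legal u \<Longrightarrow> p \<notin> S \<Longrightarrow> st u p = undefined"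
proof (induction u rule: rev_induct)
  case (snoc a u)
  then show ?case using st_snoc(2)[of u a p] D_subset by (auto simp: legal_snoc)
qed (simp add: st_Nil)

text \<open>A process runs its deterministic local automaton on its own projection. That states are
  invariant under trace equivalence and depend on the view alone then follows without looking at
  commutations.\<close>

lemma st_proj_foldl:
  "legal u \<Longrightarrow> p \<in> S \<Longrightarrow>
     st u p = foldl (\<lambda>x a. THE y. (x, a, y) \<in> lt p) (Place (initial_place p)) (proj D p u)"
proof (induction u rule: rev_induct)
  case (snoc a u)
  have IH: "st u p = foldl (\<lambda>x a. THE y. (x, a, y) \<in> lt p) (Place (initial_place p)) (proj D p u)"
    using snoc by (simp add: legal_snoc)
  show ?case
  proof (cases "p \<in> D a")
    case True
    have "(THE y. (st u p, a, y) \<in> lt p) = st (u @ [a]) p"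
      using st_snoc(1)[OF snoc.prems(1) True] lt_det[OF True] by blast
    then show ?thesis using True IH by simp
  next
    case False
    then show ?thesis using IH st_snoc(2)[OF snoc.prems(1) False] by simp
  qed
qed (simp add: st_Nil)

lemma st_eq_if_proj:
  "legal u \<Longrightarrow> legal v \<Longrightarrow> p \<in> S \<Longrightarrow> proj D p u = proj D p v \<Longrightarrow> st u p = st v p"
  by (simp add: st_proj_foldl)

lemma st_eq_if_past:
  assumes "legal u" "legal v" "p \<in> S" "teq D (past D {p} u) (past D {p} v)"
  shows "st u p = st v p"
  using assms teq_proj[OF assms(4), of p] by (intro st_eq_if_proj) (simp_all add: proj_past)

lemma st_eq_if_teq:
  assumes "legal u" "legal v" "teq D u v"
  shows "st u = st v"
proof
  fix p show "st u p = st v p"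
    using assms st_eq_if_proj[OF assms(1,2)] teq_proj[OF assms(3)] st_outside
    by (cases "p \<in> S") auto
qed

lemma legal_commute:
  assumes "D a \<inter> D b = {}" "legal (x @ [a, b] @ y)"
  shows "legal (x @ [b, a] @ y)"
  using assms(2)
proof (induction y rule: rev_induct)
  case Nil
  then have l: "legal ((x @ [a]) @ [b])" by simp
  then have xa: "legal (x @ [a])" and x: "legal x" unfolding legal_snoc by auto
  have b: "en (st x) b"
    using l st_snoc(2)[OF xa] assms(1) unfolding legal_snoc en_def by (metis disjoint_iff)
  then have xb: "legal (x @ [b])" using x by (simp add: legal_snoc)
  have "en (st (x @ [b])) a"
    using xa st_snoc(2)[OF xb] assms(1) unfolding legal_snoc en_def by (metis disjoint_iff)
  with xb have "legal ((x @ [b]) @ [a])" by (simp only: legal_snoc)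
  then show ?case by simp
next
  case (snoc c y)
  then have l: "legal ((x @ [a, b] @ y) @ [c])" by simp
  then have 1: "legal (x @ [a, b] @ y)" "en (st (x @ [a, b] @ y)) c" unfolding legal_snoc by auto
  then have 2: "legal (x @ [b, a] @ y)" using snoc.IH by blast
  have "commute1 D (x @ [a, b] @ y) (x @ [b, a] @ y)" using assms(1) by (rule commute1.intros)
  then have "st (x @ [a, b] @ y) = st (x @ [b, a] @ y)" using 1 2 by (intro st_eq_if_teq) auto
  then have "legal ((x @ [b, a] @ y) @ [c])" using 1 2 by (simp only: legal_snoc)
  then show ?case by simp
qed

lemma legal_teq: "teq D u v \<Longrightarrow> legal u \<Longrightarrow> legal v"
proof (induction rule: rtranclp_induct)
  case (step v w)
  from step.hyps(2) step.IH[OF step.prems] show ?case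
    by (induction rule: commute1.induct) (rule legal_commute)
qed

lemma finite_plays_iff: "trace (arena CG) u \<in> finite_plays (arena CG) \<longleftrightarrow> legal u"
proof -
  have "finite_plays (arena CG) = {trace (arena CG) u | u. legal u}"
    by (simp add: finite_plays_def legal_def)
  then show ?thesis using legal_teq by (auto simp: trace_eq_iff dest: teq_sym)
qed

lemma en_Tr: "en s (Tr t) \<longleftrightarrow> t \<in> transitions G \<and> (\<forall>p \<in> D (Tr t). ready (s p) p t)"
  by (auto simp: en_def lt_Tr Sig_def commit_actions_def clashes_def clash_actions_def
      simp del: slice_dom.simps split: if_splits)

lemma en_Commit:
  assumes "p \<in> S" "q \<in> places p"
  shows "en s (Commit q A) \<longleftrightarrow> s p = Place q \<and> q \<in> sys_places G \<and> A \<subseteq> place_post G q"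
  using assms
  by (auto simp: en_def lt_Commit Sig_def commit_actions_def clashes_def clash_actions_def
      D_Commit[OF assms(2,1)] simp del: slice_dom.simps split: if_splits)

lemma Sig_cases:
  assumes "a \<in> Sig"
  obtains (Tr) t where "a = Tr t" "t \<in> transitions G"
  | (Commit) p q A where "a = Commit q A" "p \<in> S" "q \<in> places p" "q \<in> sys_places G"
      "A \<subseteq> place_post G q" "D a = {p}" "a \<in> commit_actions G"
  | (Clash) "a \<in> clashes"
proof (cases "a \<in> commit_actions G")
  case True
  then obtain q A where a: "a = Commit q A" "q \<in> sys_places G" "A \<subseteq> place_post G q"
    by (auto simp: commit_actions_def)
  then obtain p where p: "p \<in> S" "q \<in> places p" using slice_of sys_env(1) by blast
  show ?thesis using Commit[OF a(1) p a(2,3)] True D_Commit[OF p(2,1)] a(1) by blast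
next
  case False
  then show ?thesis using assms Tr Clash by (auto simp: Sig_def)
qed

subsection \<open>Plays consistent with a controller\<close>

definition allowed ::
    "(('p, 't) net, ('p, 't) action) controller \<Rightarrow> ('p, 't) action list \<Rightarrow> ('p, 't) action \<Rightarrow> bool"
  where
  "allowed f u a \<longleftrightarrow>
     a \<in> Tr ` transitions G \<union> clashes \<or>
     a \<in> commit_actions G \<and> (\<forall>p \<in> D a. a \<in> f p (trace (arena CG) (past D {p} u)))"

text \<open>Controlled plays as linearizations, which permits induction over the last action;
  closure under equivalence (\<open>cp_teq\<close>) makes this agree with the set of traces.\<close>

inductive cp ::
    "(('p, 't) net, ('p, 't) action) controller \<Rightarrow> ('p, 't) action list \<Rightarrow> bool" for f where
  cp_Nil: "cp f []"
| cp_snoc: "cp f u \<Longrightarrow> legal (u @ [a]) \<Longrightarrow> allowed f u a \<Longrightarrow> cp f (u @ [a])"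

lemma cp_snoc_iff: "cp f (u @ [a]) \<longleftrightarrow> cp f u \<and> legal (u @ [a]) \<and> allowed f u a"
  by (auto intro: cp_snoc elim: cp.cases)

lemma cp_legal: "cp f u \<Longrightarrow> legal u"
  by (induction rule: cp.induct) auto

lemma cp_Tr_iff:
  assumes "cp f u"
  shows "cp f (u @ [Tr t]) \<longleftrightarrow> t \<in> transitions G \<and> (\<forall>p \<in> D (Tr t). ready (st u p) p t)"
  using assms cp_legal[OF assms]
  by (auto simp: cp_snoc_iff legal_snoc en_Tr allowed_def simp del: slice_dom.simps)

lemma commit_not_env: "Commit q A \<notin> Tr ` transitions G \<union> clashes"
  by (auto simp: clashes_def clash_actions_def)

lemma cp_Commit_iff:
  assumes "cp f u" "p \<in> S" "q \<in> places p"
  shows "cp f (u @ [Commit q A]) \<longleftrightarrow> st u p = Place q \<and> q \<in> sys_places G \<and> A \<subseteq> place_post G q \<and>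
    Commit q A \<in> f p (trace (arena CG) (past D {p} u))"
  using assms cp_legal[OF assms(1)] commit_not_env[of q A]
  by (auto simp: cp_snoc_iff legal_snoc en_Commit[OF assms(2,3)] allowed_def commit_actions_def
      D_Commit[OF assms(3,2)] simp del: slice_dom.simps)

lemma cp_appendD: "cp f (u @ v) \<Longrightarrow> cp f u"
proof (induction v rule: rev_induct)
  case (snoc a v)
  then show ?case using cp_snoc_iff[of f "u @ v" a] by simp
qed simp

lemma allowed_teq: "teq D u v \<Longrightarrow> allowed f u a \<longleftrightarrow> allowed f v a"
proof -
  assume "teq D u v"
  then have "trace (arena CG) (past D {p} u) = trace (arena CG) (past D {p} v)" for p
    by (simp add: trace_eq_iff teq_past)
  then show ?thesis by (simp add: allowed_def)
qed

lemma allowed_indep: "D a \<inter> D b = {} \<Longrightarrow> allowed f (u @ [b]) a \<longleftrightarrow> allowed f u a"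
proof -
  assume "D a \<inter> D b = {}"
  then have "past D {p} (u @ [b]) = past D {p} u" if "p \<in> D a" for p
    using that by (intro past_snoc_notin) blast
  then show ?thesis by (simp add: allowed_def)
qed

lemma cp_commute:
  assumes "D a \<inter> D b = {}" "cp f (x @ [a, b] @ y)"
  shows "cp f (x @ [b, a] @ y)"
  using assms(2)
proof (induction y rule: rev_induct)
  case Nil
  have ba: "D b \<inter> D a = {}" using assms(1) by blast
  have c: "cp f ((x @ [a]) @ [b])" using Nil by simp
  have l: "legal ((x @ [b]) @ [a])"
    using legal_commute[OF assms(1), of x "[]"] cp_legal[OF c] by simp
  have "cp f x" "allowed f x a" "allowed f (x @ [a]) b" using c by (auto simp only: cp_snoc_iff)
  then have "cp f ((x @ [b]) @ [a])"
    using l assms(1) ba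
    by (simp only: cp_snoc_iff allowed_indep) (simp only: legal_snoc)
  then show ?case by simp
next
  case (snoc c y)
  then have c: "cp f ((x @ [a, b] @ y) @ [c])" by simp
  have "commute1 D (x @ [a, b] @ y) (x @ [b, a] @ y)" using assms(1) by (rule commute1.intros)
  then have "teq D (x @ [a, b] @ y) (x @ [b, a] @ y)" by blast
  moreover have "legal ((x @ [b, a] @ y) @ [c])"
    using legal_commute[OF assms(1), of x "y @ [c]"] cp_legal[OF c] by simp
  moreover have "cp f (x @ [a, b] @ y)" "allowed f (x @ [a, b] @ y) c"
    using c unfolding cp_snoc_iff by auto
  ultimately have "cp f ((x @ [b, a] @ y) @ [c])"
    using snoc.IH allowed_teq unfolding cp_snoc_iff by blast
  then show ?case by simp
qed

lemma cp_teq: "teq D u v \<Longrightarrow> cp f u \<Longrightarrow> cp f v"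
proof (induction rule: rtranclp_induct)
  case (step v w)
  from step.hyps(2) step.IH[OF step.prems] show ?case
    by (induction rule: commute1.induct) (rule cp_commute)
qed

lemma controlled_plays_iff: "trace (arena CG) u \<in> controlled_plays CG f \<longleftrightarrow> cp f u"
proof
  have "\<exists>v. U = trace (arena CG) v \<and> cp f v" if "U \<in> controlled_plays CG f" for U
    using that
  proof induction
    case empty_play
    then show ?case using cp_Nil by blast
  next
    case (extend_play u a)
    then have "cp f u" using cp_teq by (auto simp: trace_eq_iff dest: teq_sym)
    moreover have "allowed f u a"
      using extend_play.hyps by (auto simp: allowed_def view_eq_past)
    ultimately have "cp f (u @ [a])" using extend_play.hyps by (auto simp: finite_plays_iff intro: cp_snoc)
    then show ?case by blast
  qed
  then show "trace (arena CG) u \<in> controlled_plays CG f \<Longrightarrow> cp f u"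
    using cp_teq by (metis trace_eq_iff teq_sym CG_simps(3))
  show "cp f u \<Longrightarrow> trace (arena CG) u \<in> controlled_plays CG f"
  proof (induction rule: cp.induct)
    case cp_Nil
    show ?case by (rule empty_play)
  next
    case (cp_snoc u a)
    then show ?case
      by (intro extend_play) (auto simp: finite_plays_iff allowed_def view_eq_past)
  qed
qed

section \<open>Termination, final plays and saturation\<close>

definition terminating :: "(('p, 't) net, ('p, 't) action) controller \<Rightarrow> bool" where
  "terminating f \<longleftrightarrow> (\<nexists>w. \<forall>n. cp f (map w [0..<n]))"

definition stuck ::
    "(('p, 't) net, ('p, 't) action) controller \<Rightarrow> ('p, 't) action list \<Rightarrow> bool" where
  "stuck f u \<longleftrightarrow> cp f u \<and> (\<forall>a. \<not> cp f (u @ [a]))"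

lemma winning_controller_iff:
  "winning_controller CG f \<longleftrightarrow>
     controller CG f \<and> terminating f \<and> (\<forall>u. stuck f u \<longrightarrow> (\<forall>p \<in> S. st u p \<in> slice_win G p))"
  by (simp add: winning_controller_def terminating_def infinite_controlled_play_def final_play_def
      controlled_plays_iff stuck_def st_def)

lemma single_commitment_iff:
  "single_commitment CG f \<longleftrightarrow>
     (\<forall>u p. \<forall>a \<in> commit_actions G. \<forall>b \<in> commit_actions G.
        p \<in> D a \<and> p \<in> D b \<and> cp f (u @ [a]) \<and> cp f (u @ [b]) \<longrightarrow> a = b)"
  by (auto simp: single_commitment_def controlled_plays_iff cp_snoc_iff)

definition ext_rel ::
    "(('p, 't) net, ('p, 't) action) controller \<Rightarrow> (('p, 't) action list \<times> ('p, 't) action list) set"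
  where "ext_rel f = {(u @ [a], u) | u a. cp f (u @ [a])}"

text \<open>An infinite chain of one-letter extensions has a limit word all of whose prefixes are
  plays.\<close>

lemma wf_ext_rel:
  assumes "terminating f"
  shows "wf (ext_rel f)"
  unfolding wf_iff_no_infinite_down_chain
proof
  assume "\<exists>g. \<forall>i. (g (Suc i), g i) \<in> ext_rel f"
  then obtain g where g: "\<And>i. (g (Suc i), g i) \<in> ext_rel f" by blast
  have g_Suc: "\<exists>a. g (Suc i) = g i @ [a]" and g_cp: "cp f (g (Suc i))" for i
    using g[of i] by (auto simp: ext_rel_def)
  have len: "length (g i) = length (g 0) + i" for i
  proof (induction i)
    case (Suc i)
    then show ?case using g_Suc[of i] by auto
  qed simp
  have prefix: "g i = take (length (g i)) (g j)" if "i \<le> j" for i j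
    using that
  proof (induction j rule: dec_induct)
    case (step j)
    then show ?case using g_Suc[of j] len[of i] len[of j] by auto
  qed simp
  \<comment> \<open>The word \<open>g (Suc n)\<close> has more than \<open>n\<close> letters
    whatever the length of \<open>g 0\<close>, and later words extend it, so its letter at
    \<open>n\<close> is final.\<close>
  define w where "w n = g (Suc n) ! n" for n
  have "map w [0..<n] = take n (g n)" for n
  proof (rule nth_equalityI)
    fix i assume "i < length (map w [0..<n])"
    then have i: "i < n" by simp
    have "g (Suc i) = take (length (g (Suc i))) (g n)" using i by (intro prefix) simp
    from arg_cong[OF this, of "\<lambda>z. z ! i"] have "g (Suc i) ! i = g n ! i"
      using len[of "Suc i"] by simp
    then show "map w [0..<n] ! i = take n (g n) ! i" using i by (simp add: w_def)
  qed (use len[of n] in simp)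
  moreover have "cp f (take n (g n))" for n
  proof -
    have "cp f (g n)" using g_cp[of n] g_Suc[of n] cp_appendD by metis
    then show ?thesis using cp_appendD[of f "take n (g n)" "drop n (g n)"] by simp
  qed
  ultimately have "\<forall>n. cp f (map w [0..<n])" by simp
  then show False using assms by (auto simp: terminating_def)
qed

text \<open>Koenig's lemma: there are finitely many actions and no infinite play. The induction runs
  over the tree of plays from the leaves.\<close>

lemma finite_cp:
  assumes "terminating f"
  shows "finite {u. cp f u}"
proof -
  have "finite {v. cp f (u @ v)}" for u
    using wf_ext_rel[OF assms]
  proof (induction u rule: wf_induct_rule)
    case (less u)
    have "{v. cp f (u @ v)} \<subseteq>
        {[]} \<union> (\<Union>a \<in> {a \<in> Sig. cp f (u @ [a])}. (#) a ` {v. cp f ((u @ [a]) @ v)})"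
    proof
      fix v assume "v \<in> {v. cp f (u @ v)}"
      then have v: "cp f (u @ v)" by simp
      show "v \<in> {[]} \<union> (\<Union>a \<in> {a \<in> Sig. cp f (u @ [a])}. (#) a ` {v. cp f ((u @ [a]) @ v)})"
      proof (cases v)
        case (Cons a w)
        then have "cp f ((u @ [a]) @ w)" using v by simp
        moreover from this have "cp f (u @ [a])" by (rule cp_appendD)
        moreover from this have "a \<in> Sig" using legal_Sig[OF cp_legal] by fastforce
        ultimately show ?thesis using Cons by auto
      qed simp
    qed
    moreover have "finite {v. cp f ((u @ [a]) @ v)}" if "cp f (u @ [a])" for a
      using that by (intro less.IH) (auto simp: ext_rel_def)
    ultimately show ?case using finite_Sig by (auto intro: finite_subset)
  qed
  from this[of "[]"] show ?thesis by simp
qed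

lemma stuck_extension:
  assumes "terminating f" "cp f u"
  shows "\<exists>v. stuck f (u @ v)"
  using wf_ext_rel[OF assms(1)] assms(2)
proof (induction u rule: wf_induct_rule)
  case (less u)
  show ?case
  proof (cases "stuck f u")
    case True
    then show ?thesis by (auto intro: exI[of _ "[]"])
  next
    case False
    then obtain a where a: "cp f (u @ [a])" using less.prems by (auto simp: stuck_def)
    then have "(u @ [a], u) \<in> ext_rel f" by (auto simp: ext_rel_def)
    from less.IH[OF this a] show ?thesis by auto
  qed
qed

text \<open>A play in which no process can commit any more. Commitments are silent in a strategy, so
  these are the plays whose executable transitions can be read off the marking.\<close>

definition saturated ::
    "(('p, 't) net, ('p, 't) action) controller \<Rightarrow> ('p, 't) action list \<Rightarrow> bool" where
  "saturated f u \<longleftrightarrow> cp f u \<and> (\<forall>a \<in> commit_actions G. \<not> cp f (u @ [a]))"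

lemma saturate:
  assumes "terminating f" "cp f u"
  shows "\<exists>x. set x \<subseteq> commit_actions G \<and> saturated f (u @ x)"
  using wf_ext_rel[OF assms(1)] assms(2)
proof (induction u rule: wf_induct_rule)
  case (less u)
  show ?case
  proof (cases "saturated f u")
    case True
    then show ?thesis by (auto intro: exI[of _ "[]"])
  next
    case False
    then obtain a where a: "a \<in> commit_actions G" "cp f (u @ [a])"
      using less.prems by (auto simp: saturated_def)
    then have "(u @ [a], u) \<in> ext_rel f" by (auto simp: ext_rel_def)
    from less.IH[OF this a(2)] obtain x where
      "set x \<subseteq> commit_actions G" "saturated f (u @ [a] @ x)" by auto
    then show ?thesis using a(1) by (intro exI[of _ "a # x"]) auto
  qed
qed

lemma Bot_persists: "cp f (u @ v) \<Longrightarrow> st u p = Bot \<Longrightarrow> st (u @ v) p = Bot"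
proof (induction v rule: rev_induct)
  case (snoc a v)
  have l: "legal ((u @ v) @ [a])" using cp_legal[OF snoc.prems(1)] by simp
  have "cp f (u @ v)" using cp_appendD[of f "u @ v" "[a]"] snoc.prems(1) by simp
  then have "st (u @ v) p = Bot" using snoc by blast
  then show ?case using st_snoc[OF l, of p] lt_Bot by (cases "p \<in> D a") auto
qed simp

lemma winning_no_clash:
  assumes win: "winning_controller CG f" and "a \<in> clashes"
  shows "\<not> cp f (u @ [a])"
proof
  assume c: "cp f (u @ [a])"
  have l: "legal (u @ [a])" using cp_legal[OF c] .
  have "a \<in> Sig" using assms(2) by (simp add: Sig_def)
  then obtain p where p: "p \<in> D a" using D_nonempty by blast
  obtain q A t1 t2 where a: "a = Clash q A t1 t2"
    using assms(2) by (auto simp: clashes_def clash_actions_def split: if_splits)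
  have bot: "st (u @ [a]) p = Bot" using st_snoc(1)[OF l p] lt_Clash unfolding a by blast
  obtain v where v: "stuck f ((u @ [a]) @ v)"
    using stuck_extension[OF _ c] win by (auto simp: winning_controller_iff)
  have "cp f ((u @ [a]) @ v)" using v unfolding stuck_def by blast
  then have "st ((u @ [a]) @ v) p = Bot" using Bot_persists bot by blast
  moreover have "st ((u @ [a]) @ v) p \<in> slice_win G p"
    using win v p D_subset unfolding winning_controller_iff by blast
  ultimately show False by (auto simp: slice_win_def)
qed

section \<open>Thinning out the commitments of a controller\<close>

theorem single_commitment_restriction:
  assumes win: "winning_controller CG f"
  shows "\<exists>f'. restricts CG f' f \<and> winning_controller CG f' \<and> single_commitment CG f'"
proof -
  \<comment> \<open>The choice is made per view, so that the result is again a local controller.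
    Only commitments that some legal play with this view can execute are eligible; picking another
    one could block a process that had a move.\<close>
  define possible where "possible p V a \<longleftrightarrow> a \<in> f p V \<and> a \<in> commit_actions G \<and> p \<in> D a \<and>
      (\<exists>u. legal (u @ [a]) \<and> V = trace (arena CG) (past D {p} u))" for p V a
  define f' where "f' p V = (if Ex (possible p V) then {SOME a. possible p V a} else {})" for p V
  have f'_possible: "possible p V a" if "a \<in> f' p V" for p V a
    using that someI_ex[of "possible p V"] by (auto simp: f'_def split: if_splits)
  then have sub: "f' p V \<subseteq> f p V" for p V by (auto simp: possible_def)
  have cp_mono: "cp f u" if "cp f' u" for u
    using that
  proof induction
    case (cp_snoc u a)
    then have "allowed f u a" using sub unfolding allowed_def by blast
    then show ?case using cp_snoc by (auto intro: cp.cp_snoc)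
  qed (rule cp_Nil)
  have "stuck f u" if u: "stuck f' u" for u
    unfolding stuck_def
  proof (intro conjI allI notI)
    have cpu: "cp f' u" using u by (simp add: stuck_def)
    then show "cp f u" by (rule cp_mono)
    fix a assume a: "cp f (u @ [a])"
    then have l: "legal (u @ [a])" "allowed f u a" by (auto simp: cp_snoc_iff)
    show False
    proof (cases "a \<in> Tr ` transitions G \<union> clashes")
      case True
      then have "cp f' (u @ [a])" using cpu l by (auto simp: cp_snoc_iff allowed_def)
      then show False using u by (simp add: stuck_def)
    next
      case False
      then have ac: "a \<in> commit_actions G" using l(2) by (auto simp: allowed_def)
      then have "a \<in> Sig" by (simp add: Sig_def)
      then obtain p q A where p: "a = Commit q A" "p \<in> S" "q \<in> places p" "D a = {p}"
        using False ac by (cases rule: Sig_cases) (auto simp: commit_actions_def)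
      let ?V = "trace (arena CG) (past D {p} u)"
      have "possible p ?V a" using l False ac p by (auto simp: possible_def allowed_def)
      then have ex: "Ex (possible p ?V)" by blast
      define b where "b = (SOME a. possible p ?V a)"
      have b: "possible p ?V b" using ex by (simp add: b_def someI_ex)
      have bf: "b \<in> f' p ?V" using ex by (simp add: f'_def b_def)
      obtain v where v: "legal (v @ [b])" "?V = trace (arena CG) (past D {p} v)"
        using b by (auto simp: possible_def)
      have "b \<in> commit_actions G" "p \<in> D b" using b by (auto simp only: possible_def)
      then obtain q' A' where b': "b = Commit q' A'" "q' \<in> places p"
        by (auto simp: commit_actions_def)
      then have q': "b = Commit q' A'" "q' \<in> places p" "D b = {p}"
        using D_Commit[OF b'(2) p(2)] by auto
      have "legal v" "legal u" using v(1) l by (auto simp: legal_snoc)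
      \<comment> \<open>The chosen commitment was executable after \<open>v\<close>; its only
        participant has the same view, hence the same state, after \<open>u\<close>.\<close>
      then have "st u p = st v p"
        using v(2) p(2) by (intro st_eq_if_past) (auto simp: trace_eq_iff)
      moreover have "en (st v) b" using v(1) by (simp add: legal_snoc)
      ultimately have "en (st u) b" using en_Commit[OF p(2) q'(2)] q'(1) by simp
      then have "legal (u @ [b])" using \<open>legal u\<close> by (simp add: legal_snoc)
      moreover have "allowed f' u b" using bf b q'(3) by (auto simp: allowed_def possible_def)
      ultimately have "cp f' (u @ [b])" using cpu by (auto intro: cp_snoc)
      then show False using u by (simp add: stuck_def)
    qed
  qed
  then have "winning_controller CG f'"
    using win sub cp_mono unfolding winning_controller_iff controller_def terminating_def
    by (meson order_trans)
  moreover have "single_commitment CG f'"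
    unfolding single_commitment_iff
  proof (intro allI ballI impI)
    fix u p a b
    assume "a \<in> commit_actions G" "b \<in> commit_actions G"
      and *: "p \<in> D a \<and> p \<in> D b \<and> cp f' (u @ [a]) \<and> cp f' (u @ [b])"
    then have "a \<in> f' p (trace (arena CG) (past D {p} u))"
      "b \<in> f' p (trace (arena CG) (past D {p} u))"
      by (auto simp: cp_snoc_iff allowed_def commit_actions_def clashes_def clash_actions_def
          split: if_splits)
    then show "a = b" by (auto simp: f'_def split: if_splits)
  qed
  moreover have "restricts CG f' f" using sub by (simp add: restricts_def)
  ultimately show ?thesis by blast
qed

subsection \<open>Bisimilarity via a marking of plays\<close>

definition marking ::
    "(('p, 't) action list \<Rightarrow> ('p, 't) net \<Rightarrow> 'q) \<Rightarrow> ('p, 't) action list \<Rightarrow> 'q multiset" where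
  "marking m u = image_mset (m u) (mset_set S)"

lemma in_marking: "x \<in># marking m u \<longleftrightarrow> (\<exists>p \<in> S. x = m u p)"
  using finite_S by (auto simp: marking_def)

lemma marking_fire:
  assumes "t' \<in> transitions \<sigma>"
    and pre: "pre \<sigma> t' = image_mset (m u) (mset_set (D a))"
    and post: "post \<sigma> t' = image_mset (m v) (mset_set (D a))"
    and other: "\<And>p. p \<in> S - D a \<Longrightarrow> m v p = m u p"
  shows "enabled \<sigma> (marking m u) t'" and "marking m v = fire \<sigma> (marking m u) t'"
proof -
  have S: "mset_set S = mset_set (D a) + mset_set (S - D a)"
    using D_subset[of a] finite_S by (subst mset_set_Union[symmetric]) (auto simp: Un_absorb1)
  show "enabled \<sigma> (marking m u) t'"
    unfolding enabled_def marking_def pre S using assms(1) by simp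
  have "image_mset (m v) (mset_set (S - D a)) = image_mset (m u) (mset_set (S - D a))"
    using other finite_S by (intro image_mset_cong) simp
  then show "marking m v = fire \<sigma> (marking m u) t'"
    unfolding marking_def S fire_def pre post by simp
qed

end

text \<open>The interface common to both directions: \<open>m\<close> tells where the token of each
  slice lies after a play. Commitments do not move tokens, and a strategy transition may have to
  wait for some of them.\<close>

locale play_marking = sliced_game G S h
  for G :: "('p, 't) petri_game" and S :: "('p, 't) net set" and h :: bool +
  fixes \<sigma> :: "('q, 'u, 'p, 't) labelled_net"
    and f :: "(('p, 't) net, ('p, 't) action) controller"
    and m :: "('p, 't) action list \<Rightarrow> ('p, 't) net \<Rightarrow> 'q"
  assumes teq_marking: "teq D u v \<Longrightarrow> m u = m v"
    and labels: "t' \<in> transitions \<sigma> \<Longrightarrow> trans_label \<sigma> t' \<in> transitions G"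
    and marking_Nil: "marking m [] = initial \<sigma>"
    and marking_strategy_step: "cp f u \<Longrightarrow> enabled \<sigma> (marking m u) t' \<Longrightarrow>
      \<exists>x. set x \<subseteq> commit_actions G \<and> cp f (u @ x @ [Tr (trans_label \<sigma> t')]) \<and>
        marking m (u @ x @ [Tr (trans_label \<sigma> t')]) = fire \<sigma> (marking m u) t'"
    and marking_play_step: "cp f (u @ [Tr t]) \<Longrightarrow>
      \<exists>t'. enabled \<sigma> (marking m u) t' \<and> trans_label \<sigma> t' = t \<and>
        marking m (u @ [Tr t]) = fire \<sigma> (marking m u) t'"
    and marking_internal: "cp f (u @ [a]) \<Longrightarrow> a \<notin> Tr ` transitions G \<Longrightarrow>
      marking m (u @ [a]) = marking m u"
begin

lemma marking_reachable: "cp f u \<Longrightarrow> reachable \<sigma> (marking m u)"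
proof (induction rule: cp.induct)
  case cp_Nil
  then show ?case by (simp add: marking_Nil reachable_initial)
next
  case (cp_snoc u a)
  then have c: "cp f (u @ [a])" by (auto intro: cp.cp_snoc)
  show ?case
  proof (cases "a \<in> Tr ` transitions G")
    case True
    then obtain t where "a = Tr t" by blast
    then show ?thesis using marking_play_step[of u t] c cp_snoc.IH reachable_fire by metis
  next
    case False
    then show ?thesis using marking_internal[OF c] cp_snoc.IH by simp
  qed
qed

lemma reachable_marking: "reachable \<sigma> M \<Longrightarrow> \<exists>u. cp f u \<and> M = marking m u"
proof (induction rule: reachable.induct)
  case reachable_initial
  then show ?case using cp_Nil marking_Nil by metis
next
  case (reachable_fire M t)
  then show ?case using marking_strategy_step by metis
qed

text \<open>The bisimulation is the graph of \<open>marking m\<close>, well defined on traces by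
  \<open>teq_marking\<close>. All labels of \<open>\<sigma>\<close> are observable, so
  \<open>\<sigma>\<close> makes no internal step.\<close>

lemma bisimilar: "bisimilar G CG \<sigma> f"
proof -
  define B where "B M U \<longleftrightarrow> (\<exists>u. cp f u \<and> U = trace (arena CG) u \<and> M = marking m u)" for M U
  have B_trace: "B M (trace (arena CG) u) \<longleftrightarrow> cp f u \<and> M = marking m u" for M u
  proof -
    have "cp f u \<and> marking m v = marking m u" if "cp f v" "teq D u v" for v
      using that cp_teq[OF teq_sym[OF that(2)] that(1)] teq_marking[OF that(2)]
      by (simp add: marking_def)
    then show ?thesis by (auto simp: B_def trace_eq_iff)
  qed
  have no_internal: "\<not> internal_step G \<sigma> M M'" for M M'
    using labels by (auto simp: internal_step_def strategy_step_def observable_def enabled_def)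
  have commit_internal: "set x \<inter> observable G = {}" if "set x \<subseteq> commit_actions G" for x
    using that by (auto simp: observable_def commit_actions_def)
  have "bisimulation G CG \<sigma> f B"
    unfolding bisimulation_def Let_def controlled_plays_iff
  proof (intro conjI allI impI)
    fix M U assume "B M U"
    then show "reachable \<sigma> M" "U \<in> controlled_plays CG f"
      using marking_reachable by (auto simp: B_def controlled_plays_iff)
  next
    show "B (initial \<sigma>) (trace (arena CG) [])" by (simp add: B_trace cp_Nil marking_Nil)
  next
    fix M u a M'
    assume *: "B M (trace (arena CG) u) \<and> a \<in> observable G \<and> strategy_step \<sigma> M a M'"
    then obtain t' where t': "enabled \<sigma> (marking m u) t'" "a = Tr (trans_label \<sigma> t')"
      "M' = fire \<sigma> (marking m u) t'" and u: "cp f u"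
      by (auto simp: B_trace strategy_step_def)
    obtain x where x: "set x \<subseteq> commit_actions G" "cp f (u @ x @ [a])"
      "marking m (u @ x @ [a]) = M'"
      using marking_strategy_step[OF u t'(1)] t' by auto
    then show "\<exists>x y. set x \<inter> observable G = {} \<and> set y \<inter> observable G = {} \<and>
        cp f (u @ x @ [a] @ y) \<and> B M' (trace (arena CG) (u @ x @ [a] @ y))"
      using commit_internal by (intro exI[of _ x] exI[of _ "[]"]) (simp add: B_trace)
  next
    fix M u M'
    assume "B M (trace (arena CG) u) \<and> internal_step G \<sigma> M M'"
    then show "\<exists>x. set x \<inter> observable G = {} \<and> cp f (u @ x) \<and> B M' (trace (arena CG) (u @ x))"
      using no_internal by blast
  next
    fix M u a
    assume *: "B M (trace (arena CG) u) \<and> a \<in> observable G \<and> cp f (u @ [a])"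
    then obtain t where "a = Tr t" by (auto simp: observable_def)
    then obtain t' where "enabled \<sigma> M t'" "a = Tr (trans_label \<sigma> t')"
        "marking m (u @ [a]) = fire \<sigma> M t'"
      using * marking_play_step[of u t] by (auto simp: B_trace)
    then have "strategy_step \<sigma> M a (marking m (u @ [a]))" "B (marking m (u @ [a])) (trace (arena CG) (u @ [a]))"
      using * by (auto simp: strategy_step_def B_trace)
    then show "\<exists>M1 M2 M'. (internal_step G \<sigma>)\<^sup>*\<^sup>* M M1 \<and> strategy_step \<sigma> M1 a M2 \<and>
        (internal_step G \<sigma>)\<^sup>*\<^sup>* M2 M' \<and> B M' (trace (arena CG) (u @ [a]))"
      by blast
  next
    fix M u a
    assume *: "B M (trace (arena CG) u) \<and> a \<notin> observable G \<and> cp f (u @ [a])"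
    then have "B M (trace (arena CG) (u @ [a]))"
      using marking_internal[of u a] by (simp add: B_trace observable_def)
    then show "\<exists>M'. (internal_step G \<sigma>)\<^sup>*\<^sup>* M M' \<and> B M' (trace (arena CG) (u @ [a]))" by blast
  qed
  then show ?thesis by (auto simp: bisimilar_def)
qed

end

section \<open>From strategies to controllers\<close>

lemma image_mset_section:
  assumes "finite X" "image_mset l Y = image_mset g (mset_set X)"
  shows "\<exists>m. Y = image_mset m (mset_set X) \<and> (\<forall>p \<in> X. l (m p) = g p)"
  using assms
proof (induction X arbitrary: Y rule: finite_induct)
  case (insert x X)
  then have "image_mset l Y = add_mset (g x) (image_mset g (mset_set X))" by simp
  then obtain y Z where Y: "Y = add_mset y Z" "l y = g x" "image_mset l Z = image_mset g (mset_set X)"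
    using msed_map_invR by metis
  obtain m where m: "Z = image_mset m (mset_set X)" "\<forall>p \<in> X. l (m p) = g p"
    using insert.IH[OF Y(3)] by blast
  have "image_mset (m(x := y)) (mset_set X) = image_mset m (mset_set X)"
    using insert.hyps by (intro image_mset_cong) auto
  then have "Y = image_mset (m(x := y)) (mset_set (insert x X))"
    using insert.hyps Y(1) m(1) by simp
  moreover have "\<forall>p \<in> insert x X. l ((m(x := y)) p) = g p"
    using insert.hyps Y(2) m(2) by auto
  ultimately show ?case by blast
qed simp

locale strategy_controller = sliced_game G S h
  for G :: "('p, 't) petri_game" and S :: "('p, 't) net set" and h :: bool +
  fixes \<sigma> :: "('q, 'u, 'p, 't) labelled_net"
  assumes win: "winning_strategy G \<sigma>" and det: "h \<Longrightarrow> deterministic_strategy G \<sigma>"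
begin

abbreviation l :: "'q \<Rightarrow> 'p" where "l \<equiv> place_label \<sigma>"
abbreviation lab :: "'u \<Rightarrow> 't" where "lab \<equiv> trans_label \<sigma>"

lemma branching: "branching_process G \<sigma>"
  using win by (simp add: winning_strategy_def strategy_def)

lemma hom:
  "t' \<in> transitions \<sigma> \<Longrightarrow> lab t' \<in> transitions G"
  "t' \<in> transitions \<sigma> \<Longrightarrow> image_mset l (pre \<sigma> t') = pre G (lab t')"
  "t' \<in> transitions \<sigma> \<Longrightarrow> image_mset l (post \<sigma> t') = post G (lab t')"
  "image_mset l (initial \<sigma>) = initial G"
  using branching by (auto simp: branching_process_def initial_homomorphism_def)

lemma trans_unique:
  "t1 \<in> transitions \<sigma> \<Longrightarrow> t2 \<in> transitions \<sigma> \<Longrightarrow> pre \<sigma> t1 = pre \<sigma> t2 \<Longrightarrow> lab t1 = lab t2 \<Longrightarrow> t1 = t2"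
  using branching unfolding branching_process_def by blast

lemma pre_label: "t' \<in> transitions \<sigma> \<Longrightarrow> x \<in># pre \<sigma> t' \<Longrightarrow> l x \<in># pre G (lab t')"
  using hom(2)[of t'] by (metis imageI set_image_mset)

lemma causal: "causal_net \<sigma>"
proof (rule occurrence_net_causal)
  show "occurrence_net \<sigma>" using branching by (simp add: branching_process_def)
  fix t' assume t': "t' \<in> transitions \<sigma>"
  have "pre G (lab t') \<noteq> {#}"
    using D_Tr_nonempty[OF hom(1)[OF t']] finite_D[of "Tr (lab t')"]
    unfolding pre_G[OF hom(1)[OF t']] by (simp add: mset_set_empty_iff del: slice_dom.simps)
  then show "pre \<sigma> t' \<noteq> {#}" using hom(2)[OF t'] by auto
qed

lemma label_place_post: "t' \<in> place_post \<sigma> x \<Longrightarrow> lab t' \<in> place_post G (l x)"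
  using pre_label[of t' x] hom(1)[of t'] by (auto simp: place_post_def)

section \<open>Replaying plays in the strategy\<close>

definition m0 :: "('p, 't) net \<Rightarrow> 'q" where
  "m0 = (SOME m. initial \<sigma> = image_mset m (mset_set S) \<and> (\<forall>p \<in> S. l (m p) = initial_place p))"

text \<open>By the injectivity condition of branching processes at most one transition qualifies. If
  there is none, the value is arbitrary; along plays of the controller this does not happen, by
  justified refusal.\<close>

definition tr_of :: "(('p, 't) net \<Rightarrow> 'q) \<Rightarrow> 't \<Rightarrow> 'u" where
  "tr_of m t = (SOME t'. t' \<in> transitions \<sigma> \<and> lab t' = t \<and>
     pre \<sigma> t' = image_mset m (mset_set (D (Tr t))))"

definition pm :: "'u \<Rightarrow> ('p, 't) net \<Rightarrow> 'q" where
  "pm t' = (SOME m. post \<sigma> t' = image_mset m (mset_set (D (Tr (lab t')))) \<and>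
     (\<forall>p \<in> D (Tr (lab t')). l (m p) = postp p (lab t')))"

fun stp :: "(('p, 't) net \<Rightarrow> 'q) \<Rightarrow> ('p, 't) action \<Rightarrow> ('p, 't) net \<Rightarrow> 'q" where
  "stp m (Tr t) = (\<lambda>p. if p \<in> D (Tr t) then pm (tr_of m t) p else m p)"
| "stp m _ = m"

text \<open>\<open>mk u p\<close> is the place of \<open>\<sigma>\<close> on which the token of the slice \<open>p\<close> lies after the play \<open>u\<close>.\<close>

definition mk :: "('p, 't) action list \<Rightarrow> ('p, 't) net \<Rightarrow> 'q" where
  "mk u = foldl stp m0 u"

lemma mk_snoc: "mk (u @ [a]) = stp (mk u) a"
  by (simp add: mk_def)

lemma mk_commits: "set x \<subseteq> commit_actions G \<Longrightarrow> mk (u @ x) = mk u"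
proof (induction x rule: rev_induct)
  case (snoc a x)
  obtain q A where a: "a = Commit q A" using snoc.prems by (auto simp: commit_actions_def)
  have "mk ((u @ x) @ [a]) = mk (u @ x)" unfolding mk_snoc a by simp
  with snoc show ?case by simp
qed simp

lemma m0: "initial \<sigma> = image_mset m0 (mset_set S)" "p \<in> S \<Longrightarrow> l (m0 p) = initial_place p"
proof -
  have "\<exists>m. initial \<sigma> = image_mset m (mset_set S) \<and> (\<forall>p \<in> S. l (m p) = initial_place p)"
    using hom(4) initial_G finite_S by (intro image_mset_section) auto
  from someI_ex[OF this] show "initial \<sigma> = image_mset m0 (mset_set S)"
    "p \<in> S \<Longrightarrow> l (m0 p) = initial_place p"
    by (auto simp: m0_def)
qed

lemma pm:
  assumes "t' \<in> transitions \<sigma>"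
  shows "post \<sigma> t' = image_mset (pm t') (mset_set (D (Tr (lab t'))))"
    and "p \<in> D (Tr (lab t')) \<Longrightarrow> l (pm t' p) = postp p (lab t')"
proof -
  have "\<exists>m. post \<sigma> t' = image_mset m (mset_set (D (Tr (lab t')))) \<and>
      (\<forall>p \<in> D (Tr (lab t')). l (m p) = postp p (lab t'))"
    using hom(3)[OF assms] post_G[OF hom(1)[OF assms]] by (intro image_mset_section finite_D) simp
  from someI_ex[OF this] show "post \<sigma> t' = image_mset (pm t') (mset_set (D (Tr (lab t'))))"
    "p \<in> D (Tr (lab t')) \<Longrightarrow> l (pm t' p) = postp p (lab t')"
    unfolding pm_def by blast+
qed

lemma tr_of_eq:
  assumes "t' \<in> transitions \<sigma>" "pre \<sigma> t' = image_mset m (mset_set (D (Tr (lab t'))))"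
  shows "tr_of m (lab t') = t'"
  unfolding tr_of_def
  by (rule some_equality) (use assms trans_unique in auto)

text \<open>The replay of an action looks only at the tokens of its participants. Hence the place of
  a token depends on the trace only and can be computed from the view of its process.\<close>

sublocale mk: local_valuation D mk
proof
  fix p a u assume "p \<notin> D a"
  then show "mk (u @ [a]) p = mk u p" unfolding mk_snoc by (cases a) auto
next
  fix p a u v assume p: "p \<in> D a" and eq: "\<And>r. r \<in> D a \<Longrightarrow> mk u r = mk v r"
  show "mk (u @ [a]) p = mk (v @ [a]) p"
  proof (cases a)
    case (Tr t)
    have "image_mset (mk u) (mset_set (D (Tr t))) = image_mset (mk v) (mset_set (D (Tr t)))"
      using eq Tr by (intro image_mset_cong) (simp del: slice_dom.simps)
    then have "tr_of (mk u) t = tr_of (mk v) t" by (simp only: tr_of_def)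
    then show ?thesis using p Tr by (simp add: mk_snoc)
  qed (use p eq in \<open>auto simp: mk_snoc\<close>)
qed

text \<open>The linearization \<open>u\<close> of the trace \<open>V\<close> is arbitrary, as
  \<open>mk\<close> does not depend on it. The intersection makes the offer a set of controllable
  actions of \<open>p\<close> for every trace.\<close>

definition f :: "(('p, 't) net, ('p, 't) action) controller" where
  "f p V = {c. \<exists>u. V = trace (arena CG) u \<and> c = Commit (l (mk u p)) (lab ` place_post \<sigma> (mk u p))}
     \<inter> (commit_actions G \<inter> local_actions (arena CG) p)"

lemma f_eq:
  assumes "p \<in> S" "q \<in> places p"
  shows "Commit q A \<in> f p (trace (arena CG) (past D {p} u)) \<longleftrightarrow>
    q = l (mk u p) \<and> A = lab ` place_post \<sigma> (mk u p) \<and> Commit q A \<in> commit_actions G"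
proof -
  have *: "mk v p = mk u p" if "teq D (past D {p} u) v" for v
    using mk.invariant[OF that] mk.past_eq[of p "{p}" u] by simp
  have "Commit q A \<in> f p (trace (arena CG) (past D {p} u)) \<longleftrightarrow>
      (\<exists>v. teq D (past D {p} u) v \<and> q = l (mk v p) \<and> A = lab ` place_post \<sigma> (mk v p)) \<and>
      Commit q A \<in> commit_actions G"
    using assms by (auto simp: f_def trace_eq_iff local_actions_def Sig_def)
  also have "\<dots> \<longleftrightarrow> q = l (mk u p) \<and> A = lab ` place_post \<sigma> (mk u p) \<and> Commit q A \<in> commit_actions G"
    using * by auto
  finally show ?thesis .
qed

section \<open>The invariant of controlled plays\<close>

definition num_trans :: "('p, 't) action list \<Rightarrow> nat" where
  "num_trans u = length (filter (\<lambda>a. a \<in> range Tr) u)"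

text \<open>The configuration records the fired transitions of \<open>\<sigma>\<close>, each once,
  so its size ties the number of transitions played to the size of \<open>\<sigma>\<close>. A state
  may be ahead of its token by a pending commitment, which must be the prescribed one.\<close>

definition faithful :: "('p, 't) action list \<Rightarrow> bool" where
  "faithful u \<longleftrightarrow>
     (\<exists>F. config \<sigma> F \<and> marking mk u = mset_set (frontier \<sigma> F) \<and> card F = num_trans u) \<and>
     (\<forall>p \<in> S. l (mk u p) \<in> places p \<and>
        (st u p = Place (l (mk u p)) \<or>
         st u p = Committed (l (mk u p)) (lab ` place_post \<sigma> (mk u p)) \<and>
           l (mk u p) \<in> sys_places G))"

lemma faithfulD:
  assumes "faithful u"
  shows "reachable \<sigma> (marking mk u)"
    and "p \<in> S \<Longrightarrow> l (mk u p) \<in> places p"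
    and "p \<in> S \<Longrightarrow> st u p = Place (l (mk u p)) \<or>
         st u p = Committed (l (mk u p)) (lab ` place_post \<sigma> (mk u p)) \<and>
           l (mk u p) \<in> sys_places G"
  using assms config_reachable[OF causal] by (auto simp: faithful_def)

lemma inj_mk:
  assumes "faithful u"
  shows "inj_on (mk u) S"
  using faithfulD(2)[OF assms] same_slice by (metis inj_onI)

text \<open>If all participants of \<open>t\<close> are ready for it, then no system place refuses \<open>t\<close>, hence \<open>t\<close> is
  enabled in \<open>\<sigma>\<close> by justified refusal.\<close>

lemma ready_enabled:
  assumes faithful: "faithful u" and t: "t \<in> transitions G"
    and ready: "\<And>p. p \<in> D (Tr t) \<Longrightarrow> ready (st u p) p t"
  shows "\<exists>t'. enabled \<sigma> (marking mk u) t' \<and> lab t' = t \<and>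
    pre \<sigma> t' = image_mset (mk u) (mset_set (D (Tr t)))"
proof -
  define C where "C = mk u ` D (Tr t)"
  have sub: "D (Tr t) \<subseteq> S" by (rule D_subset)
  have inj: "inj_on (mk u) (D (Tr t))" using inj_mk[OF faithful] sub by (rule inj_on_subset)
  have C: "mset_set C = image_mset (mk u) (mset_set (D (Tr t)))"
    unfolding C_def using inj by (rule image_mset_mset_set[symmetric])
  have loc: "l (mk u p) = prep p t" "prep p t \<in> sys_places G \<Longrightarrow> t \<in> lab ` place_post \<sigma> (mk u p)"
    if "p \<in> D (Tr t)" for p
    using ready[OF that] faithfulD(3)[OF faithful, of p] sub that sys_env(2) by (auto simp: ready_def)
  have "image_mset l (mset_set C) = image_mset (\<lambda>p. prep p t) (mset_set (D (Tr t)))"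
    unfolding C multiset.map_comp using loc(1)
    by (intro image_mset_cong) (simp del: slice_dom.simps)
  then have label: "image_mset l (mset_set C) = pre G t" by (simp only: pre_G[OF t])
  have "C \<subseteq> set_mset (marking mk u)" using sub by (auto simp: C_def in_marking)
  then have "pairwise_concurrent \<sigma> C"
    using reachable_pairwise_concurrent[OF causal faithfulD(1)[OF faithful]] by blast
  moreover have "finite C" by (simp add: C_def del: slice_dom.simps)
  moreover have "\<not> (\<exists>q \<in> C. l q \<in> sys_places G \<and> t \<notin> lab ` place_post \<sigma> q)"
    using loc by (auto simp: C_def)
  moreover have "justified_refusal G \<sigma>" using win by (simp add: winning_strategy_def strategy_def)
  ultimately obtain t' where t': "t' \<in> transitions \<sigma>" "lab t' = t" "pre \<sigma> t' = mset_set C"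
    using t label unfolding justified_refusal_def by blast
  have "pre \<sigma> t' \<subseteq># marking mk u"
    unfolding t'(3) C marking_def using sub finite_S
    by (intro image_mset_subseteq_mono subset_imp_msubset_mset_set)
  then show ?thesis using t' C by (auto simp: enabled_def)
qed

text \<open>Slices have disjoint places, so a token can only match the preplace that the transition
  has in the slice of the token. Hence the preset consists of the tokens of the
  participants.\<close>

lemma enabled_pre:
  assumes faithful: "faithful u" and en: "enabled \<sigma> (marking mk u) t'"
  shows "pre \<sigma> t' = image_mset (mk u) (mset_set (D (Tr (lab t'))))"
    and "p \<in> D (Tr (lab t')) \<Longrightarrow> l (mk u p) = prep p (lab t') \<and> t' \<in> place_post \<sigma> (mk u p)"
proof -
  let ?t = "lab t'"
  have t': "t' \<in> transitions \<sigma>" and sub: "pre \<sigma> t' \<subseteq># marking mk u"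
    using en by (auto simp: enabled_def)
  note t = hom(1)[OF t']
  have part: "l (mk u p) = prep p ?t \<and> mk u p \<in># pre \<sigma> t'" if p: "p \<in> D (Tr ?t)" for p
  proof -
    have "prep p ?t \<in># pre G ?t" using in_pre_G[OF t] p by blast
    then have "prep p ?t \<in> l ` set_mset (pre \<sigma> t')" using hom(2)[OF t'] by (metis set_image_mset)
    then obtain x where x: "x \<in># pre \<sigma> t'" "l x = prep p ?t" by auto
    then obtain p' where p': "p' \<in> S" "x = mk u p'"
      using sub in_marking[of _ mk u] by (meson mset_subset_eqD)
    have "p' = p"
      using p p' x slice_places(2)[of p ?t] faithfulD(2)[OF faithful p'(1)] same_slice[of "prep p ?t" p' p]
      by simp
    then show ?thesis using x p' by simp
  qed
  then show "p \<in> D (Tr ?t) \<Longrightarrow> l (mk u p) = prep p ?t \<and> t' \<in> place_post \<sigma> (mk u p)"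
    using t' by (auto simp: place_post_def)
  have "p \<in> D (Tr ?t)" if "p \<in> S" "mk u p \<in># pre \<sigma> t'" for p
    using pre_in_slice(1)[OF t pre_label[OF t' that(2)] that(1)] faithfulD(2)[OF faithful that(1)] .
  then have "x \<in> mk u ` D (Tr ?t)" if "x \<in># pre \<sigma> t'" for x
    using that in_marking[of x mk u] set_mset_mono[OF sub] by blast
  then have "set_mset (pre \<sigma> t') = mk u ` D (Tr ?t)" using part by blast
  moreover have "mset_set (set_mset (pre \<sigma> t')) = pre \<sigma> t'"
    using causal t' by (auto simp: causal_net_def intro!: mset_set_set_mset_if_simple)
  moreover have "inj_on (mk u) (D (Tr ?t))"
    using inj_mk[OF faithful] D_subset by (rule inj_on_subset)
  ultimately show "pre \<sigma> t' = image_mset (mk u) (mset_set (D (Tr ?t)))"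
    by (simp only: image_mset_mset_set)
qed

lemma mk_fire:
  assumes faithful: "faithful u" and en: "enabled \<sigma> (marking mk u) t'"
  shows "marking mk (u @ [Tr (lab t')]) = fire \<sigma> (marking mk u) t'"
    and "p \<in> D (Tr (lab t')) \<Longrightarrow> l (mk (u @ [Tr (lab t')]) p) = postp p (lab t')"
    and "p \<notin> D (Tr (lab t')) \<Longrightarrow> mk (u @ [Tr (lab t')]) p = mk u p"
proof -
  let ?t = "lab t'" and ?D = "D (Tr (lab t'))"
  have t': "t' \<in> transitions \<sigma>" using en by (simp add: enabled_def)
  have mk': "mk (u @ [Tr ?t]) = (\<lambda>p. if p \<in> ?D then pm t' p else mk u p)"
    by (simp only: mk_snoc stp.simps tr_of_eq[OF t' enabled_pre(1)[OF faithful en]])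
  then show "p \<in> ?D \<Longrightarrow> l (mk (u @ [Tr ?t]) p) = postp p ?t"
    "p \<notin> ?D \<Longrightarrow> mk (u @ [Tr ?t]) p = mk u p"
    using pm(2)[OF t'] by (simp_all del: slice_dom.simps)
  have "image_mset (mk (u @ [Tr ?t])) (mset_set ?D) = image_mset (pm t') (mset_set ?D)"
    unfolding mk' by (intro image_mset_cong) (simp del: slice_dom.simps)
  then have "post \<sigma> t' = image_mset (mk (u @ [Tr ?t])) (mset_set ?D)" using pm(1)[OF t'] by simp
  moreover have "mk (u @ [Tr ?t]) p = mk u p" if "p \<in> S - ?D" for p
    using that unfolding mk' by (simp del: slice_dom.simps)
  ultimately show "marking mk (u @ [Tr ?t]) = fire \<sigma> (marking mk u) t'"
    using marking_fire(2)[of t' \<sigma> mk u "Tr ?t" "u @ [Tr ?t]"] t' enabled_pre(1)[OF faithful en]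
    by blast
qed

text \<open>The side conditions of all three kinds of clash transitions say that the local state is
  ready for whichever of \<open>t1\<close> and \<open>t2\<close> the process takes part in.\<close>

lemma clash_ready:
  assumes "(x, Clash q A t1 t2, y) \<in> lt p" "p \<in> S" "t \<in> {t1, t2}" "t \<in> transitions p"
  shows "ready x p t"
proof -
  have p: "p \<in> D (Tr t)" using assms by simp
  have cl: "Clash q A t1 t2 \<in> clash_actions G"
    using assms(1) by (auto simp: lt_def slice_trans_def clash_trans_def split: if_splits)
  from assms(1) consider "x = Committed q A" "q \<in> places p"
    | q0 where "x = Place q0" "q0 \<in> places p" "q0 \<in> env_places G" "t \<in> place_post G q0"
    | q0 A0 where "x = Committed q0 A0" "q0 \<in> places p" "q0 \<in> sys_places G"
        "A0 \<subseteq> place_post G q0" "t \<in> A0"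
    using assms(3,4) by (auto simp: lt_def slice_trans_def clash_trans_def split: if_splits)
  then show ?thesis
  proof cases
    case 1
    have A: "q \<in> sys_places G" "A \<subseteq> place_post G q" "t \<in> A"
      using cl assms(3) by (auto simp: clash_actions_def)
    then have "prep p t = q" using place_post_slice(2)[OF assms(2) 1(2)] by blast
    then show ?thesis using 1 A by (simp add: ready_def)
  next
    case 2
    then have "prep p t = q0" using place_post_slice(2)[OF assms(2) 2(2)] by blast
    then show ?thesis using 2 by (simp add: ready_def)
  next
    case 3
    then have "prep p t = q0" using place_post_slice(2)[OF assms(2) 3(2)] by blast
    then show ?thesis using 3 by (simp add: ready_def)
  qed
qed

lemma no_clash:
  assumes faithful: "faithful u" and a: "a \<in> clashes"
  shows "\<not> en (st u) a"
proof
  assume en: "en (st u) a"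
  obtain q A t1 t2 where cl: "a = Clash q A t1 t2" "q \<in> sys_places G" "A \<subseteq> place_post G q"
    "t1 \<in> A" "t2 \<in> A" "t1 \<noteq> t2" and h
    using a by (auto simp: clashes_def clash_actions_def split: if_splits)
  obtain p where p: "p \<in> S" "q \<in> places p" using slice_of sys_env(1) cl(2) by blast
  have pD: "p \<in> D (Tr t1)" "p \<in> D (Tr t2)"
    using place_post_slice(1)[OF p] cl by blast+
  have T: "t1 \<in> transitions G" "t2 \<in> transitions G" using cl by (auto simp: place_post_def)
  have rdy: "ready (st u r) r t" if "t \<in> {t1, t2}" "r \<in> D (Tr t)" for r t
  proof -
    have "r \<in> D a" using that cl(1) by auto
    then obtain y where "(st u r, Clash q A t1 t2, y) \<in> lt r" using en cl(1) by (auto simp: en_def)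
    then show ?thesis using that by (intro clash_ready) auto
  qed
  obtain t1' where t1': "enabled \<sigma> (marking mk u) t1'" "lab t1' = t1"
    using ready_enabled[OF faithful T(1)] rdy by blast
  obtain t2' where t2': "enabled \<sigma> (marking mk u) t2'" "lab t2' = t2"
    using ready_enabled[OF faithful T(2)] rdy by blast
  have post: "t1' \<in> place_post \<sigma> (mk u p)" "t2' \<in> place_post \<sigma> (mk u p)"
    using enabled_pre(2)[OF faithful t1'(1)] enabled_pre(2)[OF faithful t2'(1)] pD t1'(2) t2'(2) by blast+
  have "l (mk u p) = prep p t1" using enabled_pre(2)[OF faithful t1'(1)] pD t1'(2) by blast
  then have "l (mk u p) \<in> sys_places G"
    using place_post_slice(2)[OF p] cl by auto
  moreover have "mk u p \<in># marking mk u" using p by (auto simp: in_marking)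
  ultimately have "t1' = t2'"
    using det[OF \<open>h\<close>] faithfulD(1)[OF faithful] post t1'(1) t2'(1)
    unfolding deterministic_strategy_def by blast
  then show False using t1'(2) t2'(2) cl by simp
qed

lemma faithful_Nil: "faithful []"
  unfolding faithful_def
proof (intro conjI exI[of _ "{}"] ballI)
  show "config \<sigma> {}" by (rule config_empty)
  show "marking mk [] = mset_set (frontier \<sigma> {})"
    using initial_frontier[OF causal] m0(1) by (simp add: marking_def mk_def)
  fix p assume "p \<in> S"
  then show "l (mk [] p) \<in> places p" "st [] p = Place (l (mk [] p)) \<or>
      st [] p = Committed (l (mk [] p)) (lab ` place_post \<sigma> (mk [] p)) \<and> l (mk [] p) \<in> sys_places G"
    using m0(2) slice_places(1) by (auto simp: mk_def st_Nil)
qed (simp add: num_trans_def)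

lemma faithful_snoc:
  assumes faithful: "faithful u" and cp: "cp f (u @ [a])"
  shows "faithful (u @ [a])"
proof -
  have l: "legal (u @ [a])" using cp_legal[OF cp] .
  have cpu: "cp f u" using cp by (simp add: cp_snoc_iff)
  have "a \<in> Sig" using l by (simp add: legal_snoc en_def)
  then show ?thesis
  proof (cases rule: Sig_cases)
    case (Tr t)
    have "\<forall>p \<in> D (Tr t). ready (st u p) p t" using cp cp_Tr_iff[OF cpu] Tr by simp
    then obtain t' where t': "enabled \<sigma> (marking mk u) t'" "lab t' = t"
      using ready_enabled[OF faithful Tr(2)] by blast
    note fire = mk_fire[OF faithful t'(1), unfolded t'(2)]
    obtain F where F: "config \<sigma> F" "marking mk u = mset_set (frontier \<sigma> F)" "card F = num_trans u"
      using faithful by (auto simp: faithful_def)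
    note step = config_fire[OF causal F(1), of t', folded F(2), OF t'(1)]
    have "card (insert t' F) = num_trans (u @ [a])"
      using step(1) F Tr by (simp add: num_trans_def config_def)
    moreover have "l (mk (u @ [a]) p) \<in> places p \<and>
        (st (u @ [a]) p = Place (l (mk (u @ [a]) p)) \<or>
         st (u @ [a]) p = Committed (l (mk (u @ [a]) p)) (lab ` place_post \<sigma> (mk (u @ [a]) p)) \<and>
           l (mk (u @ [a]) p) \<in> sys_places G)" if p: "p \<in> S" for p
    proof (cases "p \<in> D a")
      case True
      then have "st (u @ [a]) p = Place (postp p t)" using st_snoc(1)[OF l True] Tr lt_Tr by auto
      then show ?thesis using True Tr fire(2) slice_places(3)[OF p, of t] by simp
    next
      case False
      then have "mk (u @ [a]) p = mk u p" "st (u @ [a]) p = st u p"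
        using Tr fire(3) st_snoc(2)[OF l] by auto
      then show ?thesis using faithfulD(2,3)[OF faithful p] by simp
    qed
    ultimately show ?thesis
      unfolding faithful_def using step(2,3) fire(1) Tr by auto
  next
    case (Commit r q A)
    have mk: "mk (u @ [a]) = mk u" using Commit by (simp add: mk_snoc)
    have num: "num_trans (u @ [a]) = num_trans u" using Commit by (auto simp: num_trans_def)
    have c: "st u r = Place q" "Commit q A \<in> f r (trace (arena CG) (past D {r} u))"
      using cp cp_Commit_iff[OF cpu Commit(2,3)] Commit(1) by auto
    then have A: "q = l (mk u r)" "A = lab ` place_post \<sigma> (mk u r)"
      using f_eq[OF Commit(2,3)] by auto
    have "st (u @ [a]) r = Committed q A"
      using st_snoc(1)[OF l, of r] Commit(1,6) by (auto simp: lt_Commit)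
    moreover have "st (u @ [a]) p = st u p" if "p \<noteq> r" for p
      using st_snoc(2)[OF l, of p] Commit(6) that by simp
    ultimately have "st (u @ [a]) p = Place (l (mk u p)) \<or>
        st (u @ [a]) p = Committed (l (mk u p)) (lab ` place_post \<sigma> (mk u p)) \<and>
           l (mk u p) \<in> sys_places G" if "p \<in> S" for p
      using that A Commit(4) faithfulD(3)[OF faithful that] by (cases "p = r") auto
    then show ?thesis using faithful unfolding faithful_def mk num marking_def by simp
  next
    case Clash
    then show ?thesis using no_clash[OF faithful] l by (simp add: legal_snoc)
  qed
qed

lemma cp_faithful: "cp f u \<Longrightarrow> faithful u"
proof (induction u rule: rev_induct)
  case (snoc a u)
  then show ?case using faithful_snoc by (auto simp: cp_snoc_iff)
qed (simp add: faithful_Nil)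

definition committed :: "('p, 't) action list \<Rightarrow> ('p, 't) net set" where
  "committed u = {p \<in> S. \<exists>q A. st u p = Committed q A}"

text \<open>A commitment increases the number of committed slices; a transition may reset it to zero, but
  every transition of \<open>\<sigma>\<close> occurs at most once.\<close>

lemma length_bound: "cp f u \<Longrightarrow> length u \<le> num_trans u * (card S + 1) + card (committed u)"
proof (induction u rule: rev_induct)
  case (snoc a u)
  have l: "legal (u @ [a])" using cp_legal[OF snoc.prems] .
  have cpu: "cp f u" using snoc.prems by (simp add: cp_snoc_iff)
  have IH: "length u \<le> num_trans u * (card S + 1) + card (committed u)" using snoc.IH cpu .
  have fin: "finite (committed u)" "committed u \<subseteq> S" using finite_S by (auto simp: committed_def)
  have "a \<in> Sig" using l by (simp add: legal_snoc en_def)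
  then show ?case
  proof (cases rule: Sig_cases)
    case (Tr t)
    then have num: "num_trans (u @ [a]) = Suc (num_trans u)" by (simp add: num_trans_def)
    have "card (committed u) \<le> card S" using fin finite_S by (simp add: card_mono)
    then show ?thesis using IH num by simp
  next
    case (Commit r q A)
    have num: "num_trans (u @ [a]) = num_trans u" using Commit by (auto simp: num_trans_def)
    have r: "(st u r, Commit q A, st (u @ [a]) r) \<in> lt r"
      using st_snoc(1)[OF l, of r] Commit(1,6) by auto
    have "st (u @ [a]) p = st u p" if "p \<noteq> r" for p
      using st_snoc(2)[OF l, of p] Commit(6) that by simp
    then have "p \<in> committed (u @ [a]) \<longleftrightarrow> p \<in> insert r (committed u)" for p
      using r Commit(2) by (cases "p = r") (auto simp: committed_def lt_Commit)
    then have "committed (u @ [a]) = insert r (committed u)" by blast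
    moreover have "r \<notin> committed u" using r by (auto simp: committed_def lt_Commit)
    ultimately show ?thesis using IH num fin by simp
  next
    case Clash
    then show ?thesis using no_clash[OF cp_faithful[OF cpu]] l by (simp add: legal_snoc)
  qed
qed (simp add: num_trans_def)

section \<open>Termination, bisimilarity and winning of the controller\<close>

lemma terminating: "terminating f"
  unfolding terminating_def
proof
  assume "\<exists>w. \<forall>n. cp f (map w [0..<n])"
  then obtain w where w: "\<And>n. cp f (map w [0..<n])" by blast
  \<comment> \<open>Each transition played is charged for itself and for at most
    \<open>card S\<close> commitments that it resets; at most \<open>card S\<close> commitments are
    pending at the end. The transitions played form a configuration of the finite
    \<open>\<sigma>\<close>.\<close>
  define K where "K = card (transitions \<sigma>) * (card S + 1) + card S"
  have bound: "length u \<le> K" if "cp f u" for u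
  proof -
    obtain F where "config \<sigma> F" "card F = num_trans u"
      using cp_faithful[OF \<open>cp f u\<close>] by (auto simp: faithful_def)
    moreover have "finite (transitions \<sigma>)"
      using win by (simp add: winning_strategy_def finite_net_def)
    ultimately have "num_trans u \<le> card (transitions \<sigma>)"
      by (metis card_mono config_def)
    then have "num_trans u * (card S + 1) \<le> card (transitions \<sigma>) * (card S + 1)"
      by (rule mult_le_mono1)
    moreover have "card (committed u) \<le> card S"
      using finite_S by (auto simp: committed_def intro!: card_mono)
    ultimately show ?thesis using length_bound[OF that] by (simp add: K_def)
  qed
  from bound[OF w[of "Suc K"]] show False by simp
qed

lemma saturated_committed:
  assumes sat: "saturated f u" and p: "p \<in> S" and sys: "l (mk u p) \<in> sys_places G"
  shows "st u p = Committed (l (mk u p)) (lab ` place_post \<sigma> (mk u p))"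
proof (rule ccontr)
  have cpu: "cp f u" using sat by (simp add: saturated_def)
  note faithful = cp_faithful[OF cpu]
  let ?q = "l (mk u p)" and ?A = "lab ` place_post \<sigma> (mk u p)"
  assume "st u p \<noteq> Committed ?q ?A"
  then have "st u p = Place ?q" using faithfulD(3)[OF faithful p] by blast
  moreover have A: "?A \<subseteq> place_post G ?q" using label_place_post by blast
  then have act: "Commit ?q ?A \<in> commit_actions G" using sys by (auto simp: commit_actions_def)
  ultimately have "cp f (u @ [Commit ?q ?A])"
    using A sys f_eq[OF p faithfulD(2)[OF faithful p]] cp_Commit_iff[OF cpu p faithfulD(2)[OF faithful p]] by auto
  then show False using sat act by (auto simp: saturated_def)
qed

sublocale play_marking G S h \<sigma> f mk
proof
  show "mk u = mk v" if "teq D u v" for u v using mk.invariant[OF that] .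
  show "trans_label \<sigma> t' \<in> transitions G" if "t' \<in> transitions \<sigma>" for t' using hom(1)[OF that] .
  show "marking mk [] = initial \<sigma>" using m0(1) by (simp add: marking_def mk_def)
next
  fix u t' assume cpu: "cp f u" and en: "enabled \<sigma> (marking mk u) t'"
  \<comment> \<open>Participants on system places may not have committed yet. In a saturated
    extension they hold the prescribed commitments, which contain the label of \<open>t'\<close>
    because \<open>t'\<close> leaves their places.\<close>
  obtain x where x: "set x \<subseteq> commit_actions G" "saturated f (u @ x)"
    using saturate[OF terminating cpu] by blast
  have cpx: "cp f (u @ x)" using x(2) by (simp add: saturated_def)
  note faithful = cp_faithful[OF cpx]
  have mk: "mk (u @ x) = mk u" using mk_commits[OF x(1)] .
  then have en': "enabled \<sigma> (marking mk (u @ x)) t'" using en by (simp add: marking_def)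
  have t: "lab t' \<in> transitions G" using en hom(1) by (simp add: enabled_def)
  have "ready (st (u @ x) p) p (lab t')" if p: "p \<in> D (Tr (lab t'))" for p
  proof -
    have pS: "p \<in> S" using p D_subset by blast
    have *: "l (mk (u @ x) p) = prep p (lab t')" "t' \<in> place_post \<sigma> (mk (u @ x) p)"
      using enabled_pre(2)[OF faithful en' p] by auto
    show ?thesis
    proof (cases "l (mk (u @ x) p) \<in> sys_places G")
      case True
      then show ?thesis
        using saturated_committed[OF x(2) pS True] * label_place_post[of _ "mk (u @ x) p"]
        by (auto simp: ready_def)
    next
      case False
      then have "l (mk (u @ x) p) \<in> env_places G"
        using sys_env(3) faithfulD(2)[OF faithful pS] slice_places(4)[OF pS] by blast
      then show ?thesis using False faithfulD(3)[OF faithful pS] * by (simp add: ready_def)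
    qed
  qed
  then have "cp f ((u @ x) @ [Tr (lab t')])" using cp_Tr_iff[OF cpx] t by blast
  moreover have "marking mk ((u @ x) @ [Tr (lab t')]) = fire \<sigma> (marking mk u) t'"
    using mk_fire(1)[OF faithful en'] mk by (simp add: marking_def)
  ultimately show "\<exists>x. set x \<subseteq> commit_actions G \<and> cp f (u @ x @ [Tr (lab t')]) \<and>
      marking mk (u @ x @ [Tr (lab t')]) = fire \<sigma> (marking mk u) t'"
    using x(1) by auto
next
  fix u t assume cp: "cp f (u @ [Tr t])"
  then have cpu: "cp f u" by (simp add: cp_snoc_iff)
  then have "t \<in> transitions G" "\<forall>p \<in> D (Tr t). ready (st u p) p t"
    using cp cp_Tr_iff[OF cpu] by auto
  then obtain t' where t': "enabled \<sigma> (marking mk u) t'" "lab t' = t"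
    using ready_enabled[OF cp_faithful[OF cpu]] by blast
  then show "\<exists>t'. enabled \<sigma> (marking mk u) t' \<and> trans_label \<sigma> t' = t \<and>
      marking mk (u @ [Tr t]) = fire \<sigma> (marking mk u) t'"
    using mk_fire(1)[OF cp_faithful[OF cpu] t'(1)] by auto
next
  fix u a assume cp: "cp f (u @ [a])" and a: "a \<notin> Tr ` transitions G"
  have "a \<in> Sig" using cp_legal[OF cp] by (simp add: legal_snoc en_def)
  then have "mk (u @ [a]) = mk u"
    using a by (cases a) (auto simp: mk_snoc Sig_def commit_actions_def clashes_def clash_actions_def
        split: if_splits)
  then show "marking mk (u @ [a]) = marking mk u" by (simp add: marking_def)
qed

lemma winning: "winning_controller CG f"
  unfolding winning_controller_iff
proof (intro conjI allI impI ballI)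
  show "controller CG f" by (auto simp: controller_def f_def)
  show "terminating f" by (rule terminating)
  fix u p assume stuck: "stuck f u" and p: "p \<in> S"
  have cpu: "cp f u" using stuck by (simp add: stuck_def)
  note faithful = cp_faithful[OF cpu]
  have "\<not> enabled \<sigma> (marking mk u) t'" for t'
  proof
    assume "enabled \<sigma> (marking mk u) t'"
    \<comment> \<open>A match of \<open>t'\<close> may begin with commitments, but its first action
      already extends the stuck play.\<close>
    then obtain x where "cp f (u @ x @ [Tr (lab t')])" using marking_strategy_step[OF cpu] by blast
    moreover obtain b y where "x @ [Tr (lab t')] = b # y" by (cases x) auto
    ultimately have "cp f ((u @ [b]) @ y)" by simp
    then have "cp f (u @ [b])" by (rule cp_appendD)
    then show False using stuck by (simp add: stuck_def)
  qed
  then have "final_marking \<sigma> (marking mk u)" by (simp add: final_marking_def)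
  then have w: "l (mk u p) \<in> win_places G"
    using win faithfulD(1)[OF faithful] p in_marking[of "mk u p" mk u]
    unfolding winning_strategy_def by blast
  have "lab ` place_post \<sigma> (mk u p) \<subseteq> place_post G (l (mk u p))" using label_place_post by blast
  then show "st u p \<in> slice_win G p"
    using faithfulD(2,3)[OF faithful p] w by (auto simp: slice_win_def)
qed

lemma single: "single_commitment CG f"
  unfolding single_commitment_iff
proof (intro allI ballI impI)
  fix u p a b
  assume ab: "a \<in> commit_actions G" "b \<in> commit_actions G"
    and *: "p \<in> D a \<and> p \<in> D b \<and> cp f (u @ [a]) \<and> cp f (u @ [b])"
  obtain q A q' A' where a: "a = Commit q A" "b = Commit q' A'"
    using ab by (auto simp: commit_actions_def)
  have p: "p \<in> S" "q \<in> places p" "q' \<in> places p" using * a by auto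
  have cpu: "cp f u" using * by (simp add: cp_snoc_iff)
  show "a = b"
    using * a cp_Commit_iff[OF cpu p(1,2)] cp_Commit_iff[OF cpu p(1,3)]
      f_eq[OF p(1,2)] f_eq[OF p(1,3)] by auto
qed

end

section \<open>From controllers to strategies\<close>

type_synonym ('p, 't) node = "'p \<times> ('p, 't) action list set"
type_synonym ('p, 't) event = "'t \<times> ('p, 't) node set \<times> ('p, 't) action list set"

locale winning_single = sliced_game G S h
  for G :: "('p, 't) petri_game" and S :: "('p, 't) net set" and h :: bool +
  fixes f :: "(('p, 't) net, ('p, 't) action) controller"
  assumes win: "winning_controller CG f" and single: "single_commitment CG f"
begin

lemma terminating: "terminating f"
  using win by (simp add: winning_controller_iff)

abbreviation tr :: "('p, 't) action list \<Rightarrow> ('p, 't) action list set" where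
  "tr \<equiv> trace (arena CG)"

section \<open>Nodes: the places of the strategy to be built\<close>

fun rnd :: "('p, 't) action list \<Rightarrow> ('p, 't) net \<Rightarrow> ('p, 't) node" where
  "rnd [] p = (initial_place p, tr [])"
| "rnd (Tr t # u) p =
     (if p \<in> D (Tr t) then (postp p t, tr (past D (D (Tr t)) (rev u) @ [Tr t])) else rnd u p)"
| "rnd (a # u) p = rnd u p"

text \<open>\<open>nd u p\<close> is the place of the strategy on which the token of the slice \<open>p\<close> lies after the play
  \<open>u\<close>: its label together with the view of \<open>p\<close> right after the last transition of \<open>p\<close>, that is,
  without the commitment that \<open>p\<close> may have made since.\<close>

definition nd :: "('p, 't) action list \<Rightarrow> ('p, 't) net \<Rightarrow> ('p, 't) node" where
  "nd u = rnd (rev u)"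

lemma nd_Nil: "nd [] p = (initial_place p, tr [])"
  by (simp add: nd_def)

lemma nd_Tr:
  "nd (u @ [Tr t]) p =
     (if p \<in> D (Tr t) then (postp p t, tr (past D (D (Tr t)) u @ [Tr t])) else nd u p)"
  by (simp add: nd_def)

lemma nd_internal: "a \<notin> range Tr \<Longrightarrow> nd (u @ [a]) = nd u"
  by (cases a) (auto simp: nd_def)

lemma nd_snoc_simps [simp]:
  "nd (u @ [Commit q A]) = nd u" "nd (u @ [Clash q A t1 t2]) = nd u"
  by (auto intro!: nd_internal)

lemma nd_commits: "set x \<subseteq> commit_actions G \<Longrightarrow> nd (u @ x) = nd u"
proof (induction x rule: rev_induct)
  case (snoc a x)
  then have "nd ((u @ x) @ [a]) = nd (u @ x)"
    by (intro nd_internal) (auto simp: commit_actions_def)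
  with snoc show ?case by simp
qed simp

text \<open>Unlike the replay in a given strategy, a new node records the common past of the
  participants; it is the hypothesis on this past in \<open>own\<close> that makes the node
  invariant.\<close>

sublocale nd: local_valuation D nd
proof
  fix p a u assume "p \<notin> D a"
  then show "nd (u @ [a]) p = nd u p" by (cases a) (simp_all add: nd_Tr del: slice_dom.simps)
next
  fix p a u v
  assume p: "p \<in> D a" and eq: "\<And>r. r \<in> D a \<Longrightarrow> nd u r = nd v r"
    and past: "teq D (past D (D a) u) (past D (D a) v)"
  show "nd (u @ [a]) p = nd (v @ [a]) p"
  proof (cases a)
    case (Tr t)
    have "tr (past D (D a) u @ [a]) = tr (past D (D a) v @ [a])"
      using teq_append_right[OF past, of "[a]"] by (simp add: trace_eq_iff)
    then show ?thesis using p Tr by (simp add: nd_Tr del: slice_dom.simps)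
  qed (use p eq in \<open>simp_all del: slice_dom.simps\<close>)
qed

text \<open>Since its node was created a process has committed at most once, and that commitment
  ends its view. The play \<open>w\<close> of the last claim catches the process before it commits,
  the situation in which alternative commitments compete.\<close>

lemma cp_nd:
  assumes "cp f u" "p \<in> S"
  shows "fst (nd u p) \<in> places p"
    and "st u p = Place (fst (nd u p)) \<and> tr (past D {p} u) = snd (nd u p) \<or>
      (\<exists>A v. st u p = Committed (fst (nd u p)) A \<and> past D {p} u = v @ [Commit (fst (nd u p)) A] \<and>
        tr v = snd (nd u p) \<and> Commit (fst (nd u p)) A \<in> f p (snd (nd u p)) \<and>
        fst (nd u p) \<in> sys_places G \<and> A \<subseteq> place_post G (fst (nd u p)))" (is "?Q u")
    and "\<exists>w. cp f w \<and> tr (past D {p} w) = snd (nd u p) \<and> st w p = Place (fst (nd u p))"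
proof -
  let ?R = "\<lambda>u. fst (nd u p) \<in> places p \<and> ?Q u \<and>
    (\<exists>w. cp f w \<and> tr (past D {p} w) = snd (nd u p) \<and> st w p = Place (fst (nd u p)))"
  from assms(1) have "?R u"
  proof (induction u rule: rev_induct)
    case Nil
    have "st [] p = Place (initial_place p)" "past D {p} [] = []"
      using assms(2) by (auto simp: st_Nil)
    then show ?case
      using slice_places(1)[OF assms(2)] cp_Nil unfolding nd_Nil by (metis fst_conv snd_conv)
  next
    case (snoc a u)
    have l: "legal (u @ [a])" using cp_legal[OF snoc.prems] .
    have cpu: "cp f u" using snoc.prems by (simp add: cp_snoc_iff)
    note IH = snoc.IH[OF cpu]
    have aS: "a \<in> Sig" using l by (simp add: legal_snoc en_def)
    show ?case
    proof (cases "p \<in> D a")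
      case False
      have "nd (u @ [a]) p = nd u p" using nd.other[OF False] .
      moreover have "st (u @ [a]) p = st u p" using st_snoc(2)[OF l False] .
      moreover have "past D {p} (u @ [a]) = past D {p} u" using past_snoc_notin[of p D a u] False .
      ultimately show ?thesis using IH by simp
    next
      case True
      from aS show ?thesis
      proof (cases rule: Sig_cases)
        case (Tr t)
        have nd: "nd (u @ [a]) p = (postp p t, tr (past D (D a) u @ [a]))"
          using True Tr by (simp add: nd_Tr)
        have "st (u @ [a]) p = Place (postp p t)" using st_snoc(1)[OF l True] Tr lt_Tr True by auto
        moreover have "tr (past D {p} (u @ [a])) = tr (past D (D a) u @ [a])"
          using past_snoc_in[of p D a u, OF True] by simp
        moreover have "postp p t \<in> places p" using slice_places(3)[OF assms(2)] True Tr by simp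
        ultimately show ?thesis using snoc.prems unfolding nd fst_conv snd_conv by blast
      next
        case (Commit r q A)
        then have r: "r = p" using True by simp
        have nd: "nd (u @ [a]) p = nd u p" using Commit(1) by (simp add: nd_internal image_iff)
        have c: "st u p = Place q" "Commit q A \<in> f p (tr (past D {p} u))"
          using snoc.prems cp_Commit_iff[OF cpu Commit(2,3)] Commit(1) r by auto
        then have q: "q = fst (nd u p)" "tr (past D {p} u) = snd (nd u p)" using IH by auto
        have "st (u @ [a]) p = Committed q A"
          using st_snoc(1)[OF l True] Commit(1) by (auto simp: lt_Commit)
        moreover have "past D {p} (u @ [a]) = past D {p} u @ [Commit q A]"
          using past_snoc_in[of p D a u, OF True] Commit(1,6) r by simp
        ultimately have "?Q (u @ [a])" using q c(2) Commit(4,5) unfolding nd by auto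
        then show ?thesis using IH unfolding nd by blast
      next
        case Clash
        then show ?thesis using winning_no_clash[OF win] snoc.prems by blast
      qed
    qed
  qed
  then show "fst (nd u p) \<in> places p" "?Q u"
    "\<exists>w. cp f w \<and> tr (past D {p} w) = snd (nd u p) \<and> st w p = Place (fst (nd u p))"
    by blast+
qed

lemma ready_node:
  assumes "cp f u" "p \<in> S" "ready (st u p) p t"
  shows "fst (nd u p) = prep p t"
  using cp_nd(2)[OF assms(1,2)] assms(3) by (auto simp: ready_def)

text \<open>This is where single commitment is used: the place of the strategy determines the commitment.\<close>

lemma commitment_unique:
  assumes "cp f u1" "cp f u2" "p \<in> S" "nd u1 p = nd u2 p" "st u1 p = Committed q A"
  shows "st u2 p = Committed q A \<or> st u2 p = Place q \<and> cp f (u2 @ [Commit q A])"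
proof -
  have 1: "q = fst (nd u2 p)" "Commit q A \<in> f p (snd (nd u2 p))" "q \<in> sys_places G"
    "A \<subseteq> place_post G q"
    using cp_nd(2)[OF assms(1,3)] assms(4,5) by auto
  have qp: "q \<in> places p" using cp_nd(1)[OF assms(2,3)] 1(1) by simp
  from cp_nd(2)[OF assms(2,3)] show ?thesis
  proof (elim disjE exE conjE)
    assume 2: "st u2 p = Place (fst (nd u2 p))" "tr (past D {p} u2) = snd (nd u2 p)"
    then have "cp f (u2 @ [Commit q A])"
      using cp_Commit_iff[OF assms(2,3) qp] 1 by simp
    then show ?thesis using 2 1(1) by simp
  next
    fix A' v assume 2: "st u2 p = Committed (fst (nd u2 p)) A'"
      "Commit (fst (nd u2 p)) A' \<in> f p (snd (nd u2 p))" "A' \<subseteq> place_post G (fst (nd u2 p))"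
    obtain w where w: "cp f w" "tr (past D {p} w) = snd (nd u2 p)" "st w p = Place (fst (nd u2 p))"
      using cp_nd(3)[OF assms(2,3)] by blast
    have "cp f (w @ [Commit q A])" "cp f (w @ [Commit q A'])"
      using cp_Commit_iff[OF w(1) assms(3) qp] 1 2 w(2,3) by auto
    moreover have "Commit q A \<in> commit_actions G" "Commit q A' \<in> commit_actions G"
      using 1 2 by (auto simp: commit_actions_def)
    moreover have "p \<in> D (Commit q A)" "p \<in> D (Commit q A')" using qp assms(3) by auto
    ultimately have "Commit q A = Commit q A'" using single unfolding single_commitment_iff by blast
    then show ?thesis using 1(1) 2(1) by simp
  qed
qed

text \<open>The node fixes the commitment of the process up to its being made; saturation or
  readiness of the second play ensures that it has been made there.\<close>

lemma st_same:
  assumes "cp f u1" "cp f u2" "p \<in> S" "nd u1 p = nd u2 p" "ready (st u1 p) p t"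
    and "saturated f u2 \<or> ready (st u2 p) p t"
  shows "st u2 p = st u1 p"
proof -
  let ?q = "prep p t"
  have q1: "fst (nd u1 p) = ?q" using ready_node[OF assms(1,3,5)] .
  then have q2: "fst (nd u2 p) = ?q" using assms(4) by simp
  from assms(5) show ?thesis
    unfolding ready_def
  proof (elim disjE exE conjE)
    assume "st u1 p = Place ?q" "?q \<in> env_places G"
    then show ?thesis using cp_nd(2)[OF assms(2,3)] q2 sys_env(2) by auto
  next
    fix A assume A: "st u1 p = Committed ?q A" "?q \<in> sys_places G" "A \<subseteq> place_post G ?q"
    have "\<not> (st u2 p = Place ?q \<and> cp f (u2 @ [Commit ?q A]))"
      using assms(6) A sys_env(2) by (auto simp: saturated_def commit_actions_def ready_def)
    then show ?thesis using commitment_unique[OF assms(1-4) A(1)] A(1) by auto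
  qed
qed

lemma past_same:
  assumes "cp f u1" "cp f u2" "p \<in> S" "nd u1 p = nd u2 p" "st u1 p = st u2 p"
  shows "teq D (past D {p} u1) (past D {p} u2)"
proof (cases "st u1 p = Place (fst (nd u1 p))")
  case True
  then have "tr (past D {p} u1) = tr (past D {p} u2)"
    using cp_nd(2)[OF assms(1,3)] cp_nd(2)[OF assms(2,3)] assms(4,5) by auto
  then show ?thesis by (simp add: trace_eq_iff)
next
  case False
  let ?q = "fst (nd u1 p)"
  obtain A v where 1: "st u1 p = Committed ?q A" "past D {p} u1 = v @ [Commit ?q A]"
      "tr v = snd (nd u1 p)"
    using cp_nd(2)[OF assms(1,3)] False by blast
  obtain A' v' where 2: "st u2 p = Committed ?q A'" "past D {p} u2 = v' @ [Commit ?q A']"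
      "tr v' = snd (nd u1 p)"
    using cp_nd(2)[OF assms(2,3)] False unfolding assms(4,5) by blast
  have "tr v = tr v'" "A = A'" using 1 2 assms(5) by auto
  then have "teq D v v'" "A = A'" by (simp_all add: trace_eq_iff)
  then show ?thesis unfolding 1 2 by (simp add: teq_append_right)
qed

lemma past_dom_same:
  assumes "cp f u1" "cp f u2" "t \<in> transitions G"
    and "\<And>p. p \<in> D (Tr t) \<Longrightarrow> nd u1 p = nd u2 p \<and> st u1 p = st u2 p"
  shows "teq D (past D (D (Tr t)) u1) (past D (D (Tr t)) u2)"
proof (rule past_join)
  show "D (Tr t) \<noteq> {}" using D_Tr_nonempty[OF assms(3)] .
  show "D a \<noteq> {}" if "a \<in> set u1 \<union> set u2" for a
    using that legal_Sig[OF cp_legal[OF assms(1)]] legal_Sig[OF cp_legal[OF assms(2)]] D_nonempty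
    by blast
  show "teq D (past D {p} u1) (past D {p} u2)" if "p \<in> D (Tr t)" for p
    using past_same[OF assms(1,2)] assms(4)[OF that] D_subset that by blast
qed

section \<open>Events and their relation to nodes\<close>

definition ev :: "('p, 't) action list \<Rightarrow> 't \<Rightarrow> ('p, 't) event" where
  "ev u t = (t, nd u ` D (Tr t), tr (past D (D (Tr t)) u @ [Tr t]))"

definition NP :: "('p, 't) node set" where
  "NP = {nd u p | u p. cp f u \<and> p \<in> S}"

definition NT :: "('p, 't) event set" where
  "NT = {ev u t | u t. cp f (u @ [Tr t])}"

lemma finite_NP: "finite NP"
proof -
  have "NP = (\<lambda>(u, p). nd u p) ` ({u. cp f u} \<times> S)" by (auto simp: NP_def)
  then show ?thesis using finite_cp[OF terminating] finite_S by simp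
qed

lemma finite_NT: "finite NT"
proof -
  have "NT \<subseteq> (\<lambda>(u, t). ev u t) ` ({u. cp f u} \<times> transitions G)"
    using cp_Tr_iff by (force simp: NT_def cp_snoc_iff)
  moreover have "finite (transitions G)" using game by (simp add: petri_game_def finite_net_def)
  then have "finite ((\<lambda>(u, t). ev u t) ` ({u. cp f u} \<times> transitions G))"
    using finite_cp[OF terminating] by simp
  ultimately show ?thesis by (rule finite_subset)
qed

lemma nodes_agree:
  assumes "cp f u1" "cp f u2" "X \<subseteq> S" "nd u1 ` X \<subseteq> nd u2 ` S" "p \<in> X"
  shows "nd u1 p = nd u2 p"
proof -
  obtain p' where p': "p' \<in> S" "nd u1 p = nd u2 p'" using assms(4,5) by blast
  have "p' = p"
    using cp_nd(1)[OF assms(1), of p] cp_nd(1)[OF assms(2) p'(1)] p' assms(3,5)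
    by (intro same_slice[of "fst (nd u1 p)"]) auto
  then show ?thesis using p' by simp
qed

lemma inj_nd: "cp f u \<Longrightarrow> inj_on (nd u) S"
  by (rule inj_onI) (metis cp_nd(1) same_slice)

lemma nd_origin:
  assumes "cp f u" "p \<in> S"
  shows "nd u p = nd [] p \<or> (\<exists>w t. cp f (w @ [Tr t]) \<and> p \<in> D (Tr t) \<and> nd u p = nd (w @ [Tr t]) p)"
  using assms(1)
proof (induction u rule: rev_induct)
  case (snoc a u)
  then have cpu: "cp f u" by (simp add: cp_snoc_iff)
  show ?case
  proof (cases "\<exists>t. a = Tr t \<and> p \<in> D a")
    case True
    then show ?thesis using snoc.prems by blast
  next
    case False
    then have "nd (u @ [a]) p = nd u p"
      by (cases a) (auto simp: nd_Tr simp del: slice_dom.simps)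
    then show ?thesis using snoc.IH[OF cpu] by simp
  qed
qed simp

definition len :: "('p, 't) action list set \<Rightarrow> nat" where
  "len V = length (SOME w. w \<in> V)"

lemma len_trace: "len (tr w) = length w"
proof -
  have "w \<in> tr w" by (simp add: trace_def trace_equiv_def)
  then have "(SOME v. v \<in> tr w) \<in> tr w" by (rule someI)
  then show ?thesis using teq_length by (fastforce simp: len_def trace_def trace_equiv_def)
qed

lemma len_nd_le: "len (snd (nd u p)) \<le> length u"
proof (induction u rule: rev_induct)
  case (snoc a u)
  show ?case
  proof (cases "\<exists>t. a = Tr t \<and> p \<in> D a")
    case True
    then show ?thesis by (auto simp: nd_Tr len_trace length_past_le simp del: slice_dom.simps)
  next
    case False
    then have "nd (u @ [a]) p = nd u p"
      by (cases a) (auto simp: nd_Tr simp del: slice_dom.simps)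
    then show ?thesis using snoc by simp
  qed
qed (simp add: nd_Nil len_trace)

text \<open>The node of a participant is already determined by the common past, so its trace is no
  longer than that past; \<open>t\<close> itself makes the inequality strict.\<close>

lemma len_nd_past:
  assumes "p \<in> D (Tr t)"
  shows "len (snd (nd u p)) < len (tr (past D (D (Tr t)) u @ [Tr t]))"
  using nd.past_eq[OF assms, of u] len_nd_le[of "past D (D (Tr t)) u" p]
  by (simp add: len_trace del: slice_dom.simps)

text \<open>The trace stored in a produced node ends with its producer. Cancelling that action
  leaves the common past, which determines the nodes of all participants, hence the whole
  event.\<close>

lemma producer_unique:
  assumes "cp f (u1 @ [Tr t1])" "cp f (u2 @ [Tr t2])" "p1 \<in> D (Tr t1)" "p2 \<in> D (Tr t2)"
    and eq: "nd (u1 @ [Tr t1]) p1 = nd (u2 @ [Tr t2]) p2"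
  shows "ev u1 t1 = ev u2 t2"
proof -
  let ?v1 = "past D (D (Tr t1)) u1" and ?v2 = "past D (D (Tr t2)) u2"
  have pS: "p1 \<in> S" "p2 \<in> S" using assms(3,4) by auto
  have "postp p1 t1 = postp p2 t2" and V: "tr (?v1 @ [Tr t1]) = tr (?v2 @ [Tr t2])"
    using eq assms(3,4) by (auto simp: nd_Tr)
  then have p: "p1 = p2"
    using slice_places(3)[OF pS(1), of t1] slice_places(3)[OF pS(2), of t2] assms(3,4) pS
    by (intro same_slice[of "postp p1 t1"]) auto
  have t_eq: "teq D (?v1 @ [Tr t1]) (?v2 @ [Tr t2])" using V by (simp only: trace_eq_iff CG_simps)
  from teq_proj[OF this, of p1] have t: "t1 = t2" using assms(3,4) p by simp
  have "teq D ?v1 ?v2"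
  proof (rule teq_cancel_last)
    show "teq D (?v1 @ [Tr t1]) (?v2 @ [Tr t1])" using t_eq t by simp
    fix a assume "a \<in> set (?v1 @ ?v2)"
    then have "a \<in> set (u1 @ [Tr t1]) \<union> set (u2 @ [Tr t2])" using set_past by fastforce
    then show "D a \<noteq> {}"
      using legal_Sig[OF cp_legal[OF assms(1)]] legal_Sig[OF cp_legal[OF assms(2)]] D_nonempty by blast
  qed
  then have "nd ?v1 = nd ?v2" by (rule nd.invariant)
  then have "nd u1 p = nd u2 p" if "p \<in> D (Tr t1)" for p
    using nd.past_eq[OF that, of u1] nd.past_eq[of p "D (Tr t2)" u2] that t by simp
  then show ?thesis using V t by (auto simp: ev_def)
qed

end

text \<open>The node types of a strategy are prescribed, so the natural nodes are renamed along maps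
  that are injective on the finitely many nodes that occur.\<close>

locale controller_strategy = winning_single G S h f
  for G :: "('p, 't) petri_game" and S :: "('p, 't) net set" and h :: bool
    and f :: "(('p, 't) net, ('p, 't) action) controller" +
  fixes iq :: "('p, 't) node \<Rightarrow> 'q" and iu :: "('p, 't) event \<Rightarrow> 'u"
  assumes inj_iq: "inj_on iq NP" and inj_iu: "inj_on iu NT"
begin

text \<open>All participants have the same view right after a transition, so its postplaces share
  the trace \<open>V\<close> of the event; \<open>inv_into\<close> undoes the renaming.\<close>

definition \<sigma> :: "('q, 'u, 'p, 't) labelled_net" where
  "\<sigma> = \<lparr> places = iq ` NP, transitions = iu ` NT,
     pre = (\<lambda>e. image_mset iq (mset_set (fst (snd (inv_into NT iu e))))),
     post = (\<lambda>e. case inv_into NT iu e of (t, X, V) \<Rightarrow>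
       image_mset (\<lambda>p. iq (postp p t, V)) (mset_set (D (Tr t)))),
     initial = image_mset (\<lambda>p. iq (nd [] p)) (mset_set S),
     place_label = (\<lambda>x. fst (inv_into NP iq x)),
     trans_label = (\<lambda>e. fst (inv_into NT iu e)) \<rparr>"

definition m :: "('p, 't) action list \<Rightarrow> ('p, 't) net \<Rightarrow> 'q" where
  "m u p = iq (nd u p)"

definition e :: "('p, 't) action list \<Rightarrow> 't \<Rightarrow> 'u" where
  "e u t = iu (ev u t)"

lemma nd_NP: "cp f u \<Longrightarrow> p \<in> S \<Longrightarrow> nd u p \<in> NP"
  by (auto simp: NP_def)

lemma m_eq_iff:
  "cp f u \<Longrightarrow> cp f v \<Longrightarrow> p \<in> S \<Longrightarrow> r \<in> S \<Longrightarrow> m u p = m v r \<longleftrightarrow> nd u p = nd v r"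
  using inj_on_eq_iff[OF inj_iq nd_NP nd_NP] by (simp add: m_def)

lemma inj_m: "cp f u \<Longrightarrow> inj_on (m u) S"
  by (rule inj_onI) (metis inj_nd inj_onD m_eq_iff)

lemma inv_iq: "cp f u \<Longrightarrow> p \<in> S \<Longrightarrow> inv_into NP iq (m u p) = nd u p"
  unfolding m_def by (rule inv_into_f_f[OF inj_iq nd_NP])

lemma inv_iu: "cp f (u @ [Tr t]) \<Longrightarrow> inv_into NT iu (e u t) = ev u t"
  unfolding e_def by (rule inv_into_f_f[OF inj_iu]) (auto simp: NT_def)

lemma places_\<sigma>: "x \<in> places \<sigma> \<longleftrightarrow> (\<exists>u p. cp f u \<and> p \<in> S \<and> x = m u p)"
proof -
  have "places \<sigma> = iq ` NP" by (simp add: \<sigma>_def)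
  then show ?thesis unfolding m_def NP_def by blast
qed

lemma transitions_\<sigma>: "x \<in> transitions \<sigma> \<longleftrightarrow> (\<exists>u t. cp f (u @ [Tr t]) \<and> x = e u t)"
proof -
  have "transitions \<sigma> = iu ` NT" by (simp add: \<sigma>_def)
  then show ?thesis unfolding e_def NT_def by blast
qed

lemma e_\<sigma>:
  assumes "cp f (u @ [Tr t])"
  shows "pre \<sigma> (e u t) = image_mset (m u) (mset_set (D (Tr t)))"
    and "post \<sigma> (e u t) = image_mset (m (u @ [Tr t])) (mset_set (D (Tr t)))"
    and "trans_label \<sigma> (e u t) = t"
    and "t \<in> transitions G"
    and "cp f u"
proof -
  show cpu: "cp f u" using assms by (simp add: cp_snoc_iff)
  show "t \<in> transitions G" using assms cp_Tr_iff[OF cpu] by blast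
  have "inj_on (nd u) (D (Tr t))" using inj_nd[OF cpu] D_subset by (rule inj_on_subset)
  then have "image_mset iq (mset_set (nd u ` D (Tr t))) = image_mset (m u) (mset_set (D (Tr t)))"
    by (simp only: image_mset_mset_set[symmetric] multiset.map_comp) (simp add: comp_def m_def[abs_def])
  then show "pre \<sigma> (e u t) = image_mset (m u) (mset_set (D (Tr t)))"
    using inv_iu[OF assms] by (simp add: \<sigma>_def ev_def)
  have "image_mset (m (u @ [Tr t])) (mset_set (D (Tr t))) =
      image_mset (\<lambda>p. iq (postp p t, tr (past D (D (Tr t)) u @ [Tr t]))) (mset_set (D (Tr t)))"
    by (intro image_mset_cong) (simp add: m_def nd_Tr del: slice_dom.simps)
  then show "post \<sigma> (e u t) = image_mset (m (u @ [Tr t])) (mset_set (D (Tr t)))"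
    using inv_iu[OF assms] by (simp add: \<sigma>_def ev_def)
  show "trans_label \<sigma> (e u t) = t" using inv_iu[OF assms] by (simp add: \<sigma>_def ev_def)
qed

lemma place_label_m: "cp f u \<Longrightarrow> p \<in> S \<Longrightarrow> place_label \<sigma> (m u p) = fst (nd u p)"
  using inv_iq[of u p] by (simp add: \<sigma>_def)

lemma initial_\<sigma>: "initial \<sigma> = image_mset (m []) (mset_set S)"
  by (simp add: \<sigma>_def m_def[abs_def])

lemma in_pre_e: "cp f (u @ [Tr t]) \<Longrightarrow> x \<in># pre \<sigma> (e u t) \<longleftrightarrow> (\<exists>p \<in> D (Tr t). x = m u p)"
  by (auto simp: e_\<sigma> simp del: slice_dom.simps)

lemma in_post_e: "cp f (u @ [Tr t]) \<Longrightarrow> x \<in># post \<sigma> (e u t) \<longleftrightarrow> (\<exists>p \<in> D (Tr t). x = m (u @ [Tr t]) p)"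
  by (auto simp: e_\<sigma> simp del: slice_dom.simps)

lemma cp_ready:
  assumes "cp f (u @ [Tr t])" "p \<in> D (Tr t)"
  shows "ready (st u p) p t" and "fst (nd u p) = prep p t"
proof -
  show r: "ready (st u p) p t" using assms cp_Tr_iff[OF e_\<sigma>(5)[OF assms(1)]] by blast
  show "fst (nd u p) = prep p t"
    using ready_node[OF e_\<sigma>(5)[OF assms(1)] _ r] assms(2) D_subset by blast
qed

lemma e_fire:
  assumes "cp f (u @ [Tr t])"
  shows "enabled \<sigma> (marking m u) (e u t)"
    and "marking m (u @ [Tr t]) = fire \<sigma> (marking m u) (e u t)"
proof -
  have "e u t \<in> transitions \<sigma>" using assms unfolding transitions_\<sigma> by blast
  moreover have "m (u @ [Tr t]) p = m u p" if "p \<in> S - D (Tr t)" for p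
    using that by (simp add: m_def nd_Tr del: slice_dom.simps)
  ultimately show "enabled \<sigma> (marking m u) (e u t)"
    "marking m (u @ [Tr t]) = fire \<sigma> (marking m u) (e u t)"
    using marking_fire[OF _ e_\<sigma>(1,2)[OF assms]] by blast+
qed

lemma m_agree:
  assumes "cp f u1" "cp f u2" "X \<subseteq> S" "m u1 ` X \<subseteq> m u2 ` S" "p \<in> X"
  shows "nd u1 p = nd u2 p"
proof (rule nodes_agree[OF assms(1-3) _ assms(5)])
  show "nd u1 ` X \<subseteq> nd u2 ` S"
  proof
    fix z assume "z \<in> nd u1 ` X"
    then obtain r where r: "r \<in> X" "z = nd u1 r" by blast
    then obtain r' where "r' \<in> S" "m u1 r = m u2 r'" using assms(4) by blast
    then show "z \<in> nd u2 ` S" using r m_eq_iff[OF assms(1,2), of r r'] assms(3) by auto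
  qed
qed

text \<open>An event does not depend on the play that executes it: the nodes of its participants fix
  their states once commitments are made, nodes and states fix the views, and the views fix the
  common past.\<close>

lemma e_same:
  assumes "cp f (u1 @ [Tr t])" "cp f u2"
    and nd: "\<And>p. p \<in> D (Tr t) \<Longrightarrow> nd u1 p = nd u2 p"
    and sat: "saturated f u2 \<or> cp f (u2 @ [Tr t])"
  shows "cp f (u2 @ [Tr t])" and "e u1 t = e u2 t"
proof -
  note cp1 = e_\<sigma>(5)[OF assms(1)] and t = e_\<sigma>(4)[OF assms(1)]
  have st: "st u2 p = st u1 p" if p: "p \<in> D (Tr t)" for p
  proof (rule st_same[OF cp1 assms(2) _ nd[OF p] cp_ready(1)[OF assms(1) p]])
    show "p \<in> S" using p D_subset by blast
    show "saturated f u2 \<or> ready (st u2 p) p t" using sat cp_ready(1)[OF _ p] by blast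
  qed
  then have "\<forall>p \<in> D (Tr t). ready (st u2 p) p t" using cp_ready(1)[OF assms(1)] by simp
  then show "cp f (u2 @ [Tr t])" using cp_Tr_iff[OF assms(2)] t by blast
  have "teq D (past D (D (Tr t)) u1) (past D (D (Tr t)) u2)"
    using past_dom_same[OF cp1 assms(2) t] nd st by metis
  then have "tr (past D (D (Tr t)) u1 @ [Tr t]) = tr (past D (D (Tr t)) u2 @ [Tr t])"
    using teq_append_right by (simp only: trace_eq_iff CG_simps)
  moreover have "nd u1 ` D (Tr t) = nd u2 ` D (Tr t)" using nd by (rule image_cong[OF refl])
  ultimately show "e u1 t = e u2 t" by (simp only: e_def ev_def)
qed

text \<open>An enabled transition stems from a possibly different play. Its participants have the
  same nodes there and here, and saturation supplies their commitments here, so the same event can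
  be executed.\<close>

lemma enabled_saturated:
  assumes sat: "saturated f u" and en: "enabled \<sigma> (marking m u) x"
  shows "\<exists>t. x = e u t \<and> cp f (u @ [Tr t])"
proof -
  have cpu: "cp f u" using sat by (simp add: saturated_def)
  obtain u' t where x: "x = e u' t" "cp f (u' @ [Tr t])"
    using en by (auto simp: enabled_def transitions_\<sigma>)
  have "pre \<sigma> x \<subseteq># marking m u" using en by (simp add: enabled_def)
  then have "set_mset (pre \<sigma> x) \<subseteq> set_mset (marking m u)" by (rule set_mset_mono)
  then have sub: "m u' ` D (Tr t) \<subseteq> m u ` S"
    using in_pre_e[OF x(2)] in_marking[of _ m u] unfolding x(1) by blast
  have "nd u' p = nd u p" if "p \<in> D (Tr t)" for p
    using m_agree[OF e_\<sigma>(5)[OF x(2)] cpu D_subset sub that] .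
  then show ?thesis using e_same[OF x(2) cpu] sat x(1) by blast
qed

sublocale play_marking G S h \<sigma> f m
proof
  show "m u = m v" if "teq D u v" for u v
    using nd.invariant[OF that] by (simp add: m_def[abs_def])
  show "trans_label \<sigma> x \<in> transitions G" if "x \<in> transitions \<sigma>" for x
    using that e_\<sigma>(3,4) by (auto simp: transitions_\<sigma>)
  show "marking m [] = initial \<sigma>" by (simp add: marking_def initial_\<sigma>)
next
  fix u x assume cpu: "cp f u" and en: "enabled \<sigma> (marking m u) x"
  obtain y where y: "set y \<subseteq> commit_actions G" "saturated f (u @ y)"
    using saturate[OF terminating cpu] by blast
  have m: "marking m (u @ y) = marking m u"
    using nd_commits[OF y(1)] by (simp add: marking_def m_def[abs_def])
  obtain t where t: "x = e (u @ y) t" "cp f ((u @ y) @ [Tr t])"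
    using enabled_saturated[OF y(2)] en m by auto
  have "trans_label \<sigma> x = t" using e_\<sigma>(3)[OF t(2)] t(1) by simp
  then show "\<exists>y. set y \<subseteq> commit_actions G \<and> cp f (u @ y @ [Tr (trans_label \<sigma> x)]) \<and>
      marking m (u @ y @ [Tr (trans_label \<sigma> x)]) = fire \<sigma> (marking m u) x"
    using y(1) t e_fire(2)[OF t(2)] m by auto
next
  fix u t assume "cp f (u @ [Tr t])"
  then show "\<exists>x. enabled \<sigma> (marking m u) x \<and> trans_label \<sigma> x = t \<and>
      marking m (u @ [Tr t]) = fire \<sigma> (marking m u) x"
    using e_fire e_\<sigma>(3) by blast
next
  fix u a assume cp: "cp f (u @ [a])" and a: "a \<notin> Tr ` transitions G"
  have "a \<in> Sig" using cp_legal[OF cp] by (simp add: legal_snoc en_def)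
  then have "a \<notin> range Tr"
    using a by (auto simp: Sig_def commit_actions_def clashes_def clash_actions_def split: if_splits)
  then show "marking m (u @ [a]) = marking m u" by (simp add: marking_def m_def[abs_def] nd_internal)
qed

lemma reachable_saturated:
  assumes "reachable \<sigma> M"
  shows "\<exists>u. saturated f u \<and> M = marking m u"
proof -
  obtain u where u: "cp f u" "M = marking m u" using reachable_marking[OF assms] by blast
  obtain y where y: "set y \<subseteq> commit_actions G" "saturated f (u @ y)"
    using saturate[OF terminating u(1)] by blast
  have "M = marking m (u @ y)"
    using nd_commits[OF y(1)] u(2) by (simp add: marking_def m_def[abs_def])
  then show ?thesis using y(2) by blast
qed

lemma in_place_pre:
  assumes "cp f u" "p \<in> S" "x \<in> place_pre \<sigma> (m u p)"
  obtains v t r where "cp f (v @ [Tr t])" "x = e v t" "r \<in> D (Tr t)" "nd u p = nd (v @ [Tr t]) r"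
proof -
  obtain v t where v: "cp f (v @ [Tr t])" "x = e v t" "m u p \<in># post \<sigma> (e v t)"
    using assms(3) by (auto simp: place_pre_def transitions_\<sigma>)
  then obtain r where r: "r \<in> D (Tr t)" "m u p = m (v @ [Tr t]) r" using in_post_e by blast
  moreover have "r \<in> S" using r(1) D_subset by blast
  ultimately show thesis using that v m_eq_iff[OF assms(1) v(1) assms(2)] by blast
qed

section \<open>The constructed net is a branching process\<close>

lemma initial_places: "{x \<in> places \<sigma>. place_pre \<sigma> x = {}} = m [] ` S"
proof (intro subset_antisym subsetI)
  fix x assume "x \<in> {x \<in> places \<sigma>. place_pre \<sigma> x = {}}"
  then obtain u p where x: "cp f u" "p \<in> S" "x = m u p" "place_pre \<sigma> x = {}"
    by (auto simp: places_\<sigma>)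
  have "nd u p = nd [] p"
  proof (rule ccontr)
    assume "nd u p \<noteq> nd [] p"
    then obtain w t where w: "cp f (w @ [Tr t])" "p \<in> D (Tr t)" "nd u p = nd (w @ [Tr t]) p"
      using nd_origin[OF x(1,2)] by blast
    then have "e w t \<in> place_pre \<sigma> x"
      using in_post_e[OF w(1)] x(3) by (auto simp: place_pre_def transitions_\<sigma> m_def)
    then show False using x(4) by blast
  qed
  then show "x \<in> m [] ` S" using x by (auto simp: m_def)
next
  fix x assume "x \<in> m [] ` S"
  then obtain p where p: "p \<in> S" "x = m [] p" by blast
  have "False" if y: "y \<in> place_pre \<sigma> (m [] p)" for y
  proof -
    obtain v t r where "r \<in> D (Tr t)" "nd [] p = nd (v @ [Tr t]) r"
      using in_place_pre[OF cp_Nil p(1) y] .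
    then have "tr [] = tr (past D (D (Tr t)) v @ [Tr t])" by (simp add: nd_Nil nd_Tr del: slice_dom.simps)
    then have "len (tr []) = len (tr (past D (D (Tr t)) v @ [Tr t]))" by simp
    then show False by (simp add: len_trace)
  qed
  then show "x \<in> {x \<in> places \<sigma>. place_pre \<sigma> x = {}}" using p cp_Nil by (auto simp: places_\<sigma>)
qed

lemma wf_flow: "wf (flow_rel \<sigma>)"
proof -
  \<comment> \<open>A place has the trace of its producer, hence the offset 1; a consumer has a
    longer trace, and the factor 2 leaves room for the offset.\<close>
  define \<mu> where "\<mu> x = (case x of Inl q \<Rightarrow> 2 * len (snd (inv_into NP iq q)) + 1
    | Inr y \<Rightarrow> 2 * len (snd (snd (inv_into NT iu y))))" for x
  have "\<mu> x < \<mu> y" if "(x, y) \<in> flow_rel \<sigma>" for x y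
    using that unfolding flow_rel_def
  proof (elim UnE CollectE exE conjE)
    fix q z assume xy: "(x, y) = (Inl q, Inr z)" and z: "z \<in> transitions \<sigma>" "q \<in># pre \<sigma> z"
    obtain u t where u: "cp f (u @ [Tr t])" "z = e u t" using z by (auto simp: transitions_\<sigma>)
    then obtain p where p: "p \<in> D (Tr t)" "q = m u p" using in_pre_e z by blast
    have "inv_into NP iq q = nd u p"
      using inv_iq[OF e_\<sigma>(5)[OF u(1)]] p D_subset by blast
    moreover have "inv_into NT iu z = ev u t" using inv_iu u by blast
    ultimately show ?thesis
      using len_nd_past[OF p(1), of u] xy by (simp add: \<mu>_def ev_def del: slice_dom.simps)
  next
    fix q z assume xy: "(x, y) = (Inr z, Inl q)" and z: "z \<in> transitions \<sigma>" "q \<in># post \<sigma> z"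
    obtain u t where u: "cp f (u @ [Tr t])" "z = e u t" using z by (auto simp: transitions_\<sigma>)
    then obtain p where p: "p \<in> D (Tr t)" "q = m (u @ [Tr t]) p" using in_post_e z by blast
    have "inv_into NP iq q = nd (u @ [Tr t]) p"
      using inv_iq[OF u(1)] p D_subset by blast
    moreover have "inv_into NT iu z = ev u t" using inv_iu u by blast
    ultimately show ?thesis
      using xy p(1) by (simp add: \<mu>_def ev_def nd_Tr del: slice_dom.simps)
  qed
  then have "flow_rel \<sigma> \<subseteq> measure \<mu>" by auto
  then show ?thesis using wf_measure wf_subset by blast
qed

lemma count_image_m: "cp f u \<Longrightarrow> X \<subseteq> S \<Longrightarrow> count (image_mset (m u) (mset_set X)) x \<le> 1"
  using image_mset_mset_set[OF inj_on_subset[OF inj_m]] by (simp add: count_mset_set')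

lemma causal: "causal_net \<sigma>"
  unfolding causal_net_def
proof (intro conjI ballI allI)
  show "petri_net \<sigma>"
    unfolding petri_net_def
  proof (intro conjI ballI)
    fix x assume "x \<in> transitions \<sigma>"
    then obtain u t where u: "cp f (u @ [Tr t])" "x = e u t" by (auto simp: transitions_\<sigma>)
    note cpu = e_\<sigma>(5)[OF u(1)]
    have "m u p \<in> places \<sigma>" "m (u @ [Tr t]) p \<in> places \<sigma>" if "p \<in> D (Tr t)" for p
      using that u(1) cpu D_subset unfolding places_\<sigma> by blast+
    then show "set_mset (pre \<sigma> x) \<subseteq> places \<sigma>" "set_mset (post \<sigma> x) \<subseteq> places \<sigma>"
      unfolding u(2) by (auto simp: in_pre_e[OF u(1)] in_post_e[OF u(1)] simp del: slice_dom.simps)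
  next
    have "m [] p \<in> places \<sigma>" if "p \<in> S" for p
      using that cp_Nil unfolding places_\<sigma> by blast
    then show "set_mset (initial \<sigma>) \<subseteq> places \<sigma>" by (auto simp: initial_\<sigma> finite_S)
  qed
next
  fix x y assume "x \<in> transitions \<sigma>"
  then obtain u t where u: "cp f (u @ [Tr t])" "x = e u t" by (auto simp: transitions_\<sigma>)
  show "count (pre \<sigma> x) y \<le> 1" "count (post \<sigma> x) y \<le> 1"
    unfolding u(2) e_\<sigma>(1,2)[OF u(1)]
    using count_image_m[OF e_\<sigma>(5)[OF u(1)] D_subset] count_image_m[OF u(1) D_subset] by blast+
next
  show "initial \<sigma> = mset_set {q \<in> places \<sigma>. place_pre \<sigma> q = {}}"
    unfolding initial_places initial_\<sigma> using inj_m[OF cp_Nil] by (rule image_mset_mset_set)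
  show "finite {q \<in> places \<sigma>. place_pre \<sigma> q = {}}"
    unfolding initial_places using finite_S by simp
next
  fix x y z assume "x \<in> places \<sigma>" and yz: "y \<in> place_pre \<sigma> x" "z \<in> place_pre \<sigma> x"
  then obtain u p where u: "cp f u" "p \<in> S" "x = m u p" by (auto simp: places_\<sigma>)
  obtain v1 t1 r1 where 1: "cp f (v1 @ [Tr t1])" "y = e v1 t1" "r1 \<in> D (Tr t1)"
    "nd u p = nd (v1 @ [Tr t1]) r1"
    using in_place_pre[OF u(1,2)] yz(1) u(3) by blast
  obtain v2 t2 r2 where 2: "cp f (v2 @ [Tr t2])" "z = e v2 t2" "r2 \<in> D (Tr t2)"
    "nd u p = nd (v2 @ [Tr t2]) r2"
    using in_place_pre[OF u(1,2)] yz(2) u(3) by blast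
  have "ev v1 t1 = ev v2 t2" using producer_unique[OF 1(1) 2(1) 1(3) 2(3)] 1(4) 2(4) by simp
  then show "y = z" using 1(2) 2(2) by (simp add: e_def)
next
  show "wf (flow_rel \<sigma>)" by (rule wf_flow)
next
  fix x assume "x \<in> transitions \<sigma>"
  then obtain u t where u: "cp f (u @ [Tr t])" "x = e u t" by (auto simp: transitions_\<sigma>)
  then show "pre \<sigma> x \<noteq> {#}"
    using in_pre_e[OF u(1)] D_Tr_nonempty[OF e_\<sigma>(4)[OF u(1)]] by (metis all_not_in_conv empty_iff set_mset_empty)
qed

lemma occurrence: "occurrence_net \<sigma>"
proof (rule occurrence_netI[OF causal])
  fix x assume "x \<in> transitions \<sigma>"
  then obtain u t where u: "cp f (u @ [Tr t])" "x = e u t" by (auto simp: transitions_\<sigma>)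
  then show "\<exists>M. reachable \<sigma> M \<and> enabled \<sigma> M x"
    using e_fire(1)[OF u(1)] marking_reachable[OF e_\<sigma>(5)[OF u(1)]] by blast
qed

lemma homomorphism: "initial_homomorphism \<sigma> G"
  unfolding initial_homomorphism_def
proof (intro conjI ballI)
  show "place_label \<sigma> ` places \<sigma> \<subseteq> places G"
    using place_label_m cp_nd(1) slice_places(4) by (fastforce simp: places_\<sigma>)
  show "trans_label \<sigma> ` transitions \<sigma> \<subseteq> transitions G" using labels by blast
next
  fix x assume "x \<in> transitions \<sigma>"
  then obtain u t where u: "cp f (u @ [Tr t])" "x = e u t" by (auto simp: transitions_\<sigma>)
  note t = e_\<sigma>(4)[OF u(1)]
  have sub: "p \<in> S" if "p \<in> D (Tr t)" for p using that D_subset by blast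
  have "image_mset (place_label \<sigma>) (pre \<sigma> x) = image_mset (\<lambda>p. prep p t) (mset_set (D (Tr t)))"
    unfolding u(2) e_\<sigma>(1)[OF u(1)] multiset.map_comp
    using place_label_m[OF e_\<sigma>(5)[OF u(1)] sub] cp_ready(2)[OF u(1)]
    by (intro image_mset_cong) (simp del: slice_dom.simps)
  then show "image_mset (place_label \<sigma>) (pre \<sigma> x) = pre G (trans_label \<sigma> x)"
    using pre_G[OF t] e_\<sigma>(3)[OF u(1)] u(2) by simp
  have "image_mset (place_label \<sigma>) (post \<sigma> x) = image_mset (\<lambda>p. postp p t) (mset_set (D (Tr t)))"
    unfolding u(2) e_\<sigma>(2)[OF u(1)] multiset.map_comp
    using place_label_m[OF u(1) sub]
    by (intro image_mset_cong) (simp add: nd_Tr del: slice_dom.simps)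
  then show "image_mset (place_label \<sigma>) (post \<sigma> x) = post G (trans_label \<sigma> x)"
    using post_G[OF t] e_\<sigma>(3)[OF u(1)] u(2) by simp
next
  show "image_mset (place_label \<sigma>) (initial \<sigma>) = initial G"
    unfolding initial_\<sigma> initial_G multiset.map_comp
    using place_label_m[OF cp_Nil] finite_S by (intro image_mset_cong) (simp add: nd_Nil)
qed

lemma trans_unique:
  assumes "x \<in> transitions \<sigma>" "y \<in> transitions \<sigma>" "pre \<sigma> x = pre \<sigma> y"
    "trans_label \<sigma> x = trans_label \<sigma> y"
  shows "x = y"
proof -
  obtain u t where u: "cp f (u @ [Tr t])" "x = e u t" using assms(1) by (auto simp: transitions_\<sigma>)
  obtain v t' where v': "cp f (v @ [Tr t'])" "y = e v t'" using assms(2) by (auto simp: transitions_\<sigma>)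
  have "t' = t" using assms(4) u(2) v'(2) e_\<sigma>(3)[OF u(1)] e_\<sigma>(3)[OF v'(1)] by simp
  then have v: "cp f (v @ [Tr t])" "y = e v t" using v' by simp_all
  have "m u ` D (Tr t) \<subseteq> m v ` S"
  proof
    fix z assume "z \<in> m u ` D (Tr t)"
    then have "z \<in># pre \<sigma> (e u t)" using in_pre_e[OF u(1)] by blast
    then have "z \<in># pre \<sigma> (e v t)" using assms(3) u(2) v(2) by simp
    then show "z \<in> m v ` S" using in_pre_e[OF v(1)] D_subset by blast
  qed
  then have "nd u p = nd v p" if "p \<in> D (Tr t)" for p
    using m_agree[OF e_\<sigma>(5)[OF u(1)] e_\<sigma>(5)[OF v(1)] D_subset _ that] by blast
  then show ?thesis using e_same(2)[OF u(1) e_\<sigma>(5)[OF v(1)]] u(2) v by blast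
qed

section \<open>Justified refusal, winning and determinism\<close>

text \<open>Concurrent places occur together after a saturated play, where \<open>C\<close> must
  consist of the tokens of the participants of \<open>t\<close>. If all are ready, the transition
  exists. Otherwise one that is not ready sits on a system place, since tokens on environment places
  are always ready, and no transition labelled \<open>t\<close> leaves it.\<close>

lemma justified: "justified_refusal G \<sigma>"
  unfolding justified_refusal_def
proof (intro allI ballI impI)
  fix C t
  assume t: "t \<in> transitions G" and C: "finite C \<and> pairwise_concurrent \<sigma> C \<and>
      image_mset (place_label \<sigma>) (mset_set C) = pre G t"
  have "finite (transitions \<sigma>)" using finite_NT by (simp add: \<sigma>_def)
  then obtain M where M: "reachable \<sigma> M" "C \<subseteq> set_mset M"
    using pairwise_concurrent_reachable[OF causal occurrence] C by blast
  obtain u where sat: "saturated f u" and Mu: "M = marking m u"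
    using reachable_saturated M by blast
  have cpu: "cp f u" using sat by (simp add: saturated_def)
  have lab: "place_label \<sigma> ` C = set_mset (pre G t)"
    using C by (metis finite_set_mset_mset_set set_image_mset)
  have "x \<in> m u ` D (Tr t)" if x: "x \<in> C" for x
  proof -
    obtain p where p: "p \<in> S" "x = m u p" using x M(2) Mu in_marking[of x m u] by blast
    have "fst (nd u p) \<in># pre G t" using lab x place_label_m[OF cpu p(1)] p(2) by (metis imageI)
    then have "p \<in> D (Tr t)" using pre_in_slice(1)[OF t _ p(1) cp_nd(1)[OF cpu p(1)]] by blast
    then show ?thesis using p(2) by blast
  qed
  moreover have part: "m u p \<in> C \<and> fst (nd u p) = prep p t" if p: "p \<in> D (Tr t)" for p
  proof -
    have "prep p t \<in> place_label \<sigma> ` C" using lab in_pre_G[OF t] p by blast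
    then obtain x where x: "x \<in> C" "place_label \<sigma> x = prep p t" by auto
    obtain p' where p': "p' \<in> S" "x = m u p'" using x(1) M(2) Mu in_marking[of x m u] by blast
    have *: "fst (nd u p') = prep p t" using place_label_m[OF cpu p'(1)] x(2) p'(2) by simp
    have "p' = p"
      using same_slice[of "prep p t" p' p] cp_nd(1)[OF cpu p'(1)] * slice_places(2)[of p t] p p'(1)
      by simp
    then show ?thesis using x p' * by simp
  qed
  ultimately have Ceq: "C = m u ` D (Tr t)" by blast
  show "(\<exists>x \<in> transitions \<sigma>. trans_label \<sigma> x = t \<and> pre \<sigma> x = mset_set C) \<or>
      (\<exists>q \<in> C. place_label \<sigma> q \<in> sys_places G \<and> t \<notin> trans_label \<sigma> ` place_post \<sigma> q)"
  proof (cases "\<forall>p \<in> D (Tr t). ready (st u p) p t")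
    case True
    then have cp: "cp f (u @ [Tr t])" using cp_Tr_iff[OF cpu] t by blast
    have "pre \<sigma> (e u t) = mset_set C"
      unfolding e_\<sigma>(1)[OF cp] Ceq using inj_on_subset[OF inj_m[OF cpu] D_subset]
      by (rule image_mset_mset_set)
    moreover have "e u t \<in> transitions \<sigma>" using cp unfolding transitions_\<sigma> by blast
    ultimately show ?thesis using e_\<sigma>(3)[OF cp] by blast
  next
    case False
    then obtain p where p: "p \<in> D (Tr t)" "\<not> ready (st u p) p t" by blast
    have pS: "p \<in> S" using p(1) D_subset by blast
    have q: "fst (nd u p) = prep p t" "m u p \<in> C" using part[OF p(1)] by auto
    have "prep p t \<in> sys_places G"
    proof (rule ccontr)
      assume "prep p t \<notin> sys_places G"
      moreover from this have "prep p t \<in> env_places G"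
        using sys_env(3) slice_places(2,4)[OF pS] p(1) by auto
      ultimately show False using p(2) cp_nd(2)[OF cpu pS] q(1) by (auto simp: ready_def)
    qed
    \<comment> \<open>Such a transition would come from a play \<open>v\<close> in which
      \<open>p\<close> is ready for \<open>t\<close> at the same node. The saturated
      \<open>u\<close> then has the same state there, against the choice of
      \<open>p\<close>.\<close>
    moreover have "t \<notin> trans_label \<sigma> ` place_post \<sigma> (m u p)"
    proof
      assume "t \<in> trans_label \<sigma> ` place_post \<sigma> (m u p)"
      then obtain v t' where v': "cp f (v @ [Tr t'])" "trans_label \<sigma> (e v t') = t" "m u p \<in># pre \<sigma> (e v t')"
        by (auto simp: place_post_def transitions_\<sigma>)
      then have "t' = t" using e_\<sigma>(3) by simp
      then have v: "cp f (v @ [Tr t])" "m u p \<in># pre \<sigma> (e v t)" using v' by simp_all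
      note cpv = e_\<sigma>(5)[OF v(1)]
      obtain r where r: "r \<in> D (Tr t)" "m u p = m v r" using in_pre_e[OF v(1)] v(2) by blast
      have rS: "r \<in> S" using r(1) D_subset by blast
      have nd: "nd u p = nd v r" using m_eq_iff[OF cpu cpv pS rS] r(2) by blast
      have "r = p"
        using same_slice[of "fst (nd u p)" r p] cp_nd(1)[OF cpu pS] cp_nd(1)[OF cpv rS] nd pS rS by simp
      then have "st u p = st v p"
        using st_same[OF cpv cpu pS _ _ disjI1[OF sat], of t] nd cp_ready(1)[OF v(1) p(1)] by simp
      then show False using p cp_ready(1)[OF v(1) p(1)] by simp
    qed
    ultimately show ?thesis using q place_label_m[OF cpu pS] by metis
  qed
qed

lemma winning: "winning_strategy G \<sigma>"
  unfolding winning_strategy_def strategy_def branching_process_def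
proof (intro conjI allI impI ballI)
  show "finite_net \<sigma>" using finite_NP finite_NT by (simp add: finite_net_def \<sigma>_def)
next
  fix M x assume M: "reachable \<sigma> M \<and> final_marking \<sigma> M" and x: "x \<in># M"
  obtain u where sat: "saturated f u" and Mu: "M = marking m u"
    using reachable_saturated M by blast
  have cpu: "cp f u" using sat by (simp add: saturated_def)
  have "\<not> cp f (u @ [a])" for a
  proof
    assume cp: "cp f (u @ [a])"
    have "a \<in> Sig" using cp_legal[OF cp] by (simp add: legal_snoc en_def)
    then show False
    proof (cases rule: Sig_cases)
      case (Tr t)
      then have "enabled \<sigma> M (e u t)" using e_fire(1) cp Mu by simp
      then show False using M by (auto simp: final_marking_def)
    next
      case (Commit r q A)
      then show False using sat cp by (auto simp: saturated_def)
    next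
      case Clash
      then show False using winning_no_clash[OF win] cp by blast
    qed
  qed
  then have stuck: "stuck f u" using cpu by (simp add: stuck_def)
  obtain p where p: "p \<in> S" "x = m u p" using x Mu in_marking[of x m u] by blast
  have "st u p \<in> slice_win G p" using win stuck p(1) by (simp add: winning_controller_iff)
  then have "fst (nd u p) \<in> win_places G"
    using cp_nd(2)[OF cpu p(1)] by (auto simp: slice_win_def)
  then show "place_label \<sigma> x \<in> win_places G" using place_label_m[OF cpu p(1)] p(2) by simp
qed (use occurrence homomorphism justified trans_unique in auto)

text \<open>After a saturated play, two transitions enabled at one system place both belong to its
  commitment. All participants are ready for theirs, so the clash between the two would be
  executable, which a winning controller excludes.\<close>

lemma deterministic:
  assumes h
  shows "deterministic_strategy G \<sigma>"
  unfolding deterministic_strategy_def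
proof (intro allI impI ballI)
  fix M x y1 y2
  assume M: "reachable \<sigma> M \<and> x \<in># M \<and> place_label \<sigma> x \<in> sys_places G"
    and post: "y1 \<in> place_post \<sigma> x" "y2 \<in> place_post \<sigma> x"
    and en: "enabled \<sigma> M y1 \<and> enabled \<sigma> M y2"
  obtain u where sat: "saturated f u" and Mu: "M = marking m u"
    using reachable_saturated M by blast
  have cpu: "cp f u" using sat by (simp add: saturated_def)
  obtain t1 where t1: "y1 = e u t1" "cp f (u @ [Tr t1])"
    using enabled_saturated[OF sat] en Mu by blast
  obtain t2 where t2: "y2 = e u t2" "cp f (u @ [Tr t2])"
    using enabled_saturated[OF sat] en Mu by blast
  show "y1 = y2"
  proof (rule ccontr)
    assume "y1 \<noteq> y2"
    then have neq: "t1 \<noteq> t2" using t1 t2 by blast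
    have rdy: "ready (st u r) r t" if "t \<in> {t1, t2}" "r \<in> D (Tr t)" for r t
      using that cp_ready(1) t1(2) t2(2) by blast
    obtain p where p1: "p \<in> D (Tr t1)" "x = m u p"
      using post(1) t1 in_pre_e[OF t1(2)] by (auto simp: place_post_def simp del: slice_dom.simps)
    obtain p' where p': "p' \<in> D (Tr t2)" "x = m u p'"
      using post(2) t2 in_pre_e[OF t2(2)] by (auto simp: place_post_def simp del: slice_dom.simps)
    have pS: "p \<in> S" "p' \<in> S" using p1 p' D_subset by blast+
    have "p = p'" using inj_onD[OF inj_m[OF cpu]] p1 p' pS by metis
    then have p2: "p \<in> D (Tr t2)" using p' by simp
    have q: "fst (nd u p) = prep p t1" "fst (nd u p) = prep p t2"
      using cp_ready(2)[OF t1(2) p1(1)] cp_ready(2)[OF t2(2) p2] by auto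
    define q where "q = fst (nd u p)"
    have sys: "q \<in> sys_places G" using M p1(2) place_label_m[OF cpu pS(1)] by (simp add: q_def)
    obtain A where A: "st u p = Committed q A" "A \<subseteq> place_post G q" "t1 \<in> A" "t2 \<in> A"
      using rdy[of t1 p] rdy[of t2 p] p1(1) p2 q sys sys_env(2) by (auto simp: ready_def q_def)
    have qp: "q \<in> places p" using cp_nd(1)[OF cpu pS(1)] by (simp add: q_def)
    let ?c = "Clash q A t1 t2"
    have cl: "?c \<in> clash_actions G" using sys A neq by (auto simp: clash_actions_def)
    have lt: "clash_trans G r \<subseteq> lt r" for r unfolding lt_def using \<open>h\<close> by auto
    have "(st u r, ?c, Bot) \<in> lt r" if r: "r \<in> D ?c" for r
    proof (cases "r = p")
      case True
      then show ?thesis using A qp cl by (intro subsetD[OF lt]) (auto simp: clash_trans_def)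
    next
      case False
      have rS: "r \<in> S" and rt: "t1 \<in> transitions r \<or> t2 \<in> transitions r" using r by auto
      have qr: "q \<notin> places r" using False same_slice[OF _ qp rS pS(1)] by blast
      have loc: "ready (st u r) r t \<and> t \<in> place_post G (prep r t)"
        if "t \<in> {t1, t2}" "t \<in> transitions r" for t
        using rdy[OF that(1)] place_post_prep[of r t] that(2) rS by simp
      then obtain t0 where t0: "t0 \<in> {t1, t2}" "t0 \<in> transitions r" "ready (st u r) r t0"
        using rt by blast
      define q0 where "q0 = prep r t0"
      have q0: "q0 \<in> places r" using slice_places(2)[OF rS t0(2)] by (simp add: q0_def)
      from t0(3) show ?thesis
        unfolding ready_def q0_def[symmetric]
      proof (elim disjE exE conjE)
        assume s: "st u r = Place q0" "q0 \<in> env_places G"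
        have "\<forall>t \<in> {t1, t2}. t \<in> transitions r \<longrightarrow> t \<in> place_post G q0"
          using loc s by (auto simp: ready_def)
        then have "(st u r, ?c, Bot) \<in> clash_trans G r"
          using s q0 qr rt cl unfolding clash_trans_def by blast
        then show ?thesis using lt by blast
      next
        fix A0 assume s: "st u r = Committed q0 A0" "q0 \<in> sys_places G" "A0 \<subseteq> place_post G q0"
        have "\<forall>t \<in> {t1, t2}. t \<in> transitions r \<longrightarrow> t \<in> A0"
          using loc s by (auto simp: ready_def)
        then have "(st u r, ?c, Bot) \<in> clash_trans G r"
          using s q0 qr rt cl unfolding clash_trans_def by blast
        then show ?thesis using lt by blast
      qed
    qed
    moreover have c: "?c \<in> clashes" unfolding clashes_def using cl \<open>h\<close> by simp
    ultimately have "en (st u) ?c" unfolding en_def Sig_def by blast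
    then have "cp f (u @ [?c])"
      using cpu cp_legal[OF cpu] c by (simp add: cp_snoc_iff legal_snoc allowed_def)
    then show False using winning_no_clash[OF win c] by blast
  qed
qed

end

section \<open>Strategy-equivalence of the Petri game and the control games\<close>

lemma ex_inj_on_infinite: "finite X \<Longrightarrow> \<exists>g :: 'a \<Rightarrow> 'b :: infinite. inj_on g X"
proof -
  assume X: "finite X"
  obtain Y :: "'b set" where "finite Y" "card Y = card X"
    using infinite_arbitrarily_large[OF infinite_UNIV] by metis
  then obtain g where "bij_betw g X Y" using finite_same_card_bij[OF X] by metis
  then show ?thesis by (auto simp: bij_betw_def)
qed

text \<open>Covers both games: without the hat the requirement of determinism is vacuous.\<close>

lemma (in sliced_game) strategy_equivalence:
  "strategy_equivalent G CG
     {\<sigma> :: ('q::infinite, 'u::infinite, 'p, 't) labelled_net.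
        winning_strategy G \<sigma> \<and> (h \<longrightarrow> deterministic_strategy G \<sigma>)}
     {f. winning_controller CG f \<and> single_commitment CG f}"
  unfolding strategy_equivalent_def
proof (intro conjI ballI)
  fix \<sigma> :: "('q, 'u, 'p, 't) labelled_net"
  assume "\<sigma> \<in> {\<sigma>. winning_strategy G \<sigma> \<and> (h \<longrightarrow> deterministic_strategy G \<sigma>)}"
  then interpret sc: strategy_controller G S h \<sigma> by unfold_locales auto
  show "\<exists>f \<in> {f. winning_controller CG f \<and> single_commitment CG f}. bisimilar G CG \<sigma> f"
    using sc.winning sc.single sc.bisimilar by blast
next
  fix f assume "f \<in> {f. winning_controller CG f \<and> single_commitment CG f}"
  then interpret ws: winning_single G S h f by unfold_locales auto
  obtain iq :: "('p, 't) node \<Rightarrow> 'q" where "inj_on iq ws.NP"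
    using ex_inj_on_infinite[OF ws.finite_NP] by blast
  moreover obtain iu :: "('p, 't) event \<Rightarrow> 'u" where "inj_on iu ws.NT"
    using ex_inj_on_infinite[OF ws.finite_NT] by blast
  ultimately interpret cs: controller_strategy G S h f iq iu by unfold_locales
  show "\<exists>\<sigma> \<in> {\<sigma> :: ('q, 'u, 'p, 't) labelled_net.
      winning_strategy G \<sigma> \<and> (h \<longrightarrow> deterministic_strategy G \<sigma>)}. bisimilar G CG \<sigma> f"
    using cs.winning cs.deterministic cs.bisimilar by blast
qed

text \<open>The clauses on restrictions complement the equivalences: a winning controller that
  offers several commitments contains a single-commitment one that still wins and to which the
  equivalence applies.\<close>

theorem theorem3:
  fixes G :: "('p, 't) petri_game" and S :: "('p, 't) net set"
  assumes "petri_game G" and "slice_distribution G S"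
  shows
    "strategy_equivalent G (control_game_of G S)
       {\<sigma> :: ('q::infinite, 'u::infinite, 'p, 't) labelled_net. winning_strategy G \<sigma>}
       {f. winning_controller (control_game_of G S) f \<and> single_commitment (control_game_of G S) f} \<and>
     (\<forall>f. winning_controller (control_game_of G S) f \<longrightarrow>
       (\<exists>f'. restricts (control_game_of G S) f' f \<and>
         winning_controller (control_game_of G S) f' \<and>
         single_commitment (control_game_of G S) f')) \<and>
     strategy_equivalent G (control_game_det_of G S)
       {\<sigma> :: ('q, 'u, 'p, 't) labelled_net. winning_strategy G \<sigma> \<and> deterministic_strategy G \<sigma>}
       {f. winning_controller (control_game_det_of G S) f \<and>
           single_commitment (control_game_det_of G S) f} \<and>
     (\<forall>f. winning_controller (control_game_det_of G S) f \<longrightarrow>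
       (\<exists>f'. restricts (control_game_det_of G S) f' f \<and>
         winning_controller (control_game_det_of G S) f' \<and>
         single_commitment (control_game_det_of G S) f'))"
proof -
  interpret plain: sliced_game G S False using assms by unfold_locales
  interpret hat: sliced_game G S True using assms by unfold_locales
  have "plain.CG = control_game_of G S" "hat.CG = control_game_det_of G S"
    by (simp_all add: plain.CG_def hat.CG_def)
  then show ?thesis
    using plain.strategy_equivalence hat.strategy_equivalence
      plain.single_commitment_restriction hat.single_commitment_restriction
    by auto
qed

end
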